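(* Let $J\subset I\subset A$ be proper non-zero ideals, $\Gamma=\Gamma_P(I)$ and $\Gamma'=\Gamma_P(J)$, so $\Gamma'\trianglelefteq\Gamma\trianglelefteq\Gamma_P$. Since every $\Gamma'$-unstable simplex is $\Gamma$-unstable, the inclusion $C_\bullet(\mathcal{B}_\bullet(W)^{\Gamma'\text{-}\mathrm{un}},\mathbb{Z})\subset C_\bullet(\mathcal{B}_\bullet(W)^{\Gamma\text{-}\mathrm{un}},\mathbb{Z})$ induces a surjection of quotient complexes $C_\bullet(\mathcal{B}_\bullet(W),\mathbb{Z})^{\Gamma'\text{-}\mathrm{st}}\to C_\bullet(\mathcal{B}_\bullet(W),\mathbb{Z})^{\Gamma\text{-}\mathrm{st}}$ and hence a canonical $\Gamma_P$-equivariant homomorphism $i_{J,I}:\mathrm{St}^J(P)\to\mathrm{St}^I(P)$. Then $\mathrm{GQ}_I\circ i_{J,I}=\mathrm{GQ}_J$.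
   Context: Let $\mathbb{F}_q$ be a finite field, $C$ a smooth geometrically irreducible projective curve over $\mathbb{F}_q$ with function field $K$, $\infty$ a closed point, $A$ the ring of functions regular outside $\infty$, $R=\mathcal{O}_{C,\infty}$ with uniformizer $\varpi$, $W$ a $K$-vector space of dimension $r\ge2$. The Bruhat–Tits building $\mathcal{B}_\bullet(W)$: vertices are homothety classes $\langle L\rangle$ of $R$-lattices (finitely generated $R$-submodules of rank $r$) in $W$; a set of $d+1$ vertices is a simplex iff it has representatives $L_0\supsetneq\cdots\supsetneq L_d\supsetneq\varpi L_0$. $P\subset W$ is a projective $A$-submodule of rank $r$ with $KP=W$, $\Gamma_P=\mathrm{Aut}_A(P)$, $\Gamma_P(I)=\ker(\mathrm{Aut}_A(P)\to\mathrm{Aut}_A(P/IP))$. For $\Gamma=\Gamma_P(I)$, the unstable subcomplex $\mathcal{B}_\bullet(W)^{\Gamma\text{-}\mathrm{un}}$ consists of simplices with non-trivial $\Gamma$-stabilizer. The Tits building $\mathcal{T}_\bullet(W)$ is the simplicial complex of finite chains of proper non-zero subspaces of $W$; $\mathrm{St}(W):=\tilde H_{r-2}(\mathcal{T}_\bullet(W),\mathbb{Z})$. $C_\bullet(\mathcal{B}_\bullet(W),\mathbb{Z})$ is the augmented (reduced) oriented simplicial chain complex of $\mathcal{B}_\bullet(W)$ (with $C_{-1}=\mathbb{Z}$), $C_\bullet(\mathcal{B}_\bullet(W)^{\Gamma\text{-}\mathrm{un}},\mathbb{Z})$ its subcomplex spanned by unstable simplices, and $C_\bullet(\mathcal{B}_\bullet(W),\mathbb{Z})^{\Gamma\text{-}\mathrm{st}}$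 the quotient complex, with homology $H_\bullet(\mathcal{B}_\bullet(W)^{\Gamma\text{-}\mathrm{st}},\mathbb{Z})$. Define $\mathrm{St}^I(P):=H_{r-1}(\mathcal{B}_\bullet(W)^{\Gamma\text{-}\mathrm{st}},\mathbb{Z})$. Since $|\mathcal{B}_\bullet(W)|$ is contractible, the connecting map $\delta_I:\mathrm{St}^I(P)\to\tilde H_{r-2}(\mathcal{B}_\bullet(W)^{\Gamma\text{-}\mathrm{un}},\mathbb{Z})$ is an isomorphism. For a proper non-zero subspace $W_1$ (a vertex $\sigma$ of $\mathcal{T}_\bullet(W)$), let $\mathcal{B}_\bullet(W)_\sigma$ be the subcomplex of simplices $\{\langle L_0\rangle,\dots,\langle L_d\rangle\}$ for which there is $g\in\Gamma\setminus\{1\}$ with $gL_i=L_i$ for all $i$ and $g|_{W_1}=\mathrm{id}$. Let $X'$ be the poset of simplices of $\mathcal{B}_\bullet(W)^{\Gamma\text{-}\mathrm{un}}$ (its barycentric subdivision), $\mathcal{T}$ the poset of proper non-zero subspaces, and $Z_\Gamma=\{(\gamma,\sigma)\in X'\times\mathcal{T}:\gamma\text{ is a simplex of }\mathcal{B}_\bullet(W)_\sigma\}$ with the product order; the projection $p_1:Z_\Gamma\to X'$ induces an isomorphism on homology and $p_2:Z_\Gamma\to\mathcal{T}$ is the second projection. Let $\varphi_I=(p_2)_*\circ(p_1)_*^{-1}:\tilde H_{r-2}(\mathcal{B}_\bullet(W)^{\Gamma\text{-}\mathrm{un}},\mathbb{Z})\to\tilde H_{r-2}(\mathcal{T}_\bullet(W),\mathbb{Z})=\mathrm{St}(W)$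 (using the canonical identification of the homology of a complex with that of its barycentric subdivision). Then $\mathrm{GQ}_I:=\varphi_I\circ\delta_I:\mathrm{St}^I(P)\xrightarrow{\sim}\mathrm{St}(W)$, a $\Gamma_P$-equivariant isomorphism. *)

theory Defs
  imports
    "HOL-Algebra.Algebra"
    "HOL-Algebra.Algebraic_Closure_Type"
    "HOL-Combinatorics.Permutations"
    "HOL-Library.Poly_Mapping"
begin

section \<open>Chain complexes of abelian groups and their homology\<close>

record 'c chain_cx =
  grp :: "int \<Rightarrow> 'c monoid"
  bd :: "int \<Rightarrow> 'c \<Rightarrow> 'c"

definition homology_group :: "'c chain_cx \<Rightarrow> int \<Rightarrow> 'c set monoid" where
  "homology_group C n =
     (grp C n)\<lparr>carrier := kernel (grp C n) (grp C (n - 1)) (bd C n)\<rparr>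
       Mod (bd C (n + 1) ` carrier (grp C (n + 1)))"

definition homology_class :: "'c chain_cx \<Rightarrow> int \<Rightarrow> 'c \<Rightarrow> 'c set" where
  "homology_class C n z = bd C (n + 1) ` carrier (grp C (n + 1)) #>\<^bsub>grp C n\<^esub> z"

text \<open>The map on homology induced by a chain map, given by its component in degree \<open>n\<close>.
  As in the library's treatment of factor groups, a value on a coset is the unique value taken on
  representatives.\<close>

definition homology_map ::
    "'c chain_cx \<Rightarrow> 'd chain_cx \<Rightarrow> int \<Rightarrow> ('c \<Rightarrow> 'd) \<Rightarrow> 'c set \<Rightarrow> 'd set" where
  "homology_map C D n f \<alpha> = the_elem ((\<lambda>z. homology_class D n (f z)) ` \<alpha>)"

text \<open>For a subcomplex \<open>D\<close> of \<open>C\<close>: the map into \<open>C\<^sub>n / D\<^sub>n\<close> induced on cosets by a map \<open>f\<close> into \<open>C\<^sub>n\<close>.\<close>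

definition quot_map :: "'c chain_cx \<Rightarrow> 'c chain_cx \<Rightarrow> int \<Rightarrow> ('b \<Rightarrow> 'c) \<Rightarrow> 'b set \<Rightarrow> 'c set" where
  "quot_map C D n f Y = the_elem ((\<lambda>x. carrier (grp D n) #>\<^bsub>grp C n\<^esub> f x) ` Y)"

definition quot_cx :: "'c chain_cx \<Rightarrow> 'c chain_cx \<Rightarrow> 'c set chain_cx" where
  "quot_cx C D =
     \<lparr>grp = (\<lambda>n. grp C n Mod carrier (grp D n)),
      bd = (\<lambda>n. quot_map C D (n - 1) (bd C n))\<rparr>"

text \<open>The connecting homomorphism \<open>H\<^sub>n(C/D) \<rightarrow> H\<^sub>n\<^sub>-\<^sub>1(D)\<close> of the long exact sequence of \<open>D \<subseteq> C\<close>: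
  lift to \<open>C\<^sub>n\<close>, then apply the differential.\<close>

definition connecting_map :: "'c chain_cx \<Rightarrow> 'c chain_cx \<Rightarrow> int \<Rightarrow> 'c set set \<Rightarrow> 'c set" where
  "connecting_map C D n \<alpha> =
     the_elem {homology_class D (n - 1) (bd C n c) | c.
        c \<in> carrier (grp C n) \<and> bd C n c \<in> carrier (grp D (n - 1)) \<and>
        homology_class (quot_cx C D) n (carrier (grp D n) #>\<^bsub>grp C n\<^esub> c) = \<alpha>}"


section \<open>Oriented simplicial chains\<close>

text \<open>An abstract simplicial complex is given by its set of non-empty simplices.
  An oriented \<open>n\<close>-chain is a finitely supported integer function on the orderings
  \<open>[v\<^sub>0, \<dots>, v\<^sub>n]\<close> of \<open>n\<close>-simplices that changes sign under odd reorderings. The empty list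
  contributes the augmentation term \<open>\<int>\<close> in degree \<open>-1\<close>.\<close>

definition oriented_chains :: "'v set set \<Rightarrow> int \<Rightarrow> ('v list \<Rightarrow>\<^sub>0 int) set" where
  "oriented_chains Y n =
     {c. (\<forall>vs \<in> Poly_Mapping.keys c.
            distinct vs \<and> int (length vs) = n + 1 \<and> (vs = [] \<or> set vs \<in> Y)) \<and>
         (\<forall>vs p. p permutes {..<length vs} \<longrightarrow>
            Poly_Mapping.lookup c (permute_list p vs) = sign p * Poly_Mapping.lookup c vs)}"

text \<open>The elementary chain of the oriented simplex \<open>[v\<^sub>0, \<dots>, v\<^sub>n]\<close>.\<close>

definition oriented_simplex :: "'v list \<Rightarrow> ('v list \<Rightarrow>\<^sub>0 int)" where
  "oriented_simplex vs =
     (\<Sum>p | p permutes {..<length vs}. frag_cmul (sign p) (frag_of (permute_list p vs)))"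

text \<open>Every ordering of a simplex occurs in an oriented chain, so the usual boundary is obtained by
  only removing the first vertex; \<open>boundary_oriented_simplex\<close> below is the usual formula.\<close>

definition simplicial_boundary :: "('v list \<Rightarrow>\<^sub>0 int) \<Rightarrow> ('v list \<Rightarrow>\<^sub>0 int)" where
  "simplicial_boundary = frag_extend (\<lambda>vs. case vs of [] \<Rightarrow> 0 | v # ws \<Rightarrow> frag_of ws)"

definition front_cycle :: "nat \<Rightarrow> nat \<Rightarrow> nat" where
  "front_cycle i j = (if j = 0 then i else if j \<le> i then j - 1 else j)"

definition shift_perm :: "(nat \<Rightarrow> nat) \<Rightarrow> nat \<Rightarrow> nat" where
  "shift_perm q j = (case j of 0 \<Rightarrow> 0 | Suc m \<Rightarrow> Suc (q m))"

lemma front_cycle_0: "front_cycle 0 = id"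
  by (auto simp: front_cycle_def fun_eq_iff)

lemma front_cycle_Suc: "front_cycle (Suc i) = transpose i (Suc i) \<circ> front_cycle i"
  by (auto simp: fun_eq_iff front_cycle_def transpose_def)

lemma front_cycle_permutes: "i \<le> n \<Longrightarrow> front_cycle i permutes {..<Suc n}"
proof (induction i)
  case 0
  show ?case unfolding front_cycle_0 by (rule permutes_id)
next
  case (Suc i)
  then show ?case
    unfolding front_cycle_Suc by (intro permutes_compose permutes_swap_id) auto
qed

lemma sign_front_cycle: "sign (front_cycle i) = (-1) ^ i"
proof (induction i)
  case 0
  show ?case unfolding front_cycle_0 by simp
next
  case (Suc i)
  have "permutation (front_cycle i)"
    using front_cycle_permutes[of i i] by (auto simp: permutation_permutes)
  then have "sign (front_cycle (Suc i)) = sign (transpose i (Suc i)) * sign (front_cycle i)"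
    unfolding front_cycle_Suc by (intro sign_compose permutation_swap_id)
  with Suc show ?case by (simp add: sign_swap_id)
qed

lemma shift_perm_swap:
  "shift_perm (q \<circ> transpose a b) = shift_perm q \<circ> transpose (Suc a) (Suc b)"
  by (auto simp: fun_eq_iff shift_perm_def transpose_def split: nat.splits)

lemma shift_perm_id: "shift_perm id = id"
  by (auto simp: fun_eq_iff shift_perm_def split: nat.splits)

lemma shift_perm_permutes_sign:
  assumes "q permutes {..<n}"
  shows "shift_perm q permutes {..<Suc n} \<and> sign (shift_perm q) = sign q"
proof -
  have "finite {..<n}" by simp
  from this assms show ?thesis
  proof (induction rule: permutes_rev_induct)
    case id
    show ?case unfolding shift_perm_id using permutes_id by blast
  next
    case (swap a b p)
    then have "permutation (shift_perm p)" "permutation p"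
      by (auto simp: permutation_permutes)
    then have "sign (shift_perm (p \<circ> transpose a b)) = sign (p \<circ> transpose a b)"
      using swap by (simp only: shift_perm_swap sign_compose permutation_swap_id sign_swap_id) simp
    moreover have "shift_perm (p \<circ> transpose a b) permutes {..<Suc n}"
      unfolding shift_perm_swap using swap by (intro permutes_compose permutes_swap_id) auto
    ultimately show ?case by blast
  qed
qed

lemma bij_betw_cycle_shift:
  "bij_betw (\<lambda>(i, q). front_cycle i \<circ> shift_perm q)
     ({..<Suc n} \<times> {q. q permutes {..<n}}) {p. p permutes {..<Suc n}}"
proof -
  let ?F = "\<lambda>(i, q). front_cycle i \<circ> shift_perm q"
  let ?D = "{..<Suc n} \<times> {q. q permutes {..<n}}"
  have inj: "inj_on ?F ?D"
  proof (rule inj_onI)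
    fix x y assume "x \<in> ?D" "y \<in> ?D" "?F x = ?F y"
    moreover obtain i q i' q' where xy: "x = (i, q)" "y = (i', q')"
      by (cases x, cases y)
    ultimately have i: "i \<in> {..<Suc n}"
      and eq: "front_cycle i \<circ> shift_perm q = front_cycle i' \<circ> shift_perm q'"
      by (simp_all only: mem_Sigma_iff case_prod_conv)
    have "i = i'"
      using fun_cong[OF eq, of 0] by (simp add: front_cycle_def shift_perm_def)
    moreover have "inj (front_cycle i)"
      using front_cycle_permutes[of i n] i by (auto intro: permutes_inj)
    ultimately have "shift_perm q j = shift_perm q' j" for j
      using fun_cong[OF eq, of j] by (simp add: inj_eq)
    from this[of "Suc _"] have "q m = q' m" for m
      by (simp add: shift_perm_def)
    then have "q = q'" by (rule ext)
    with \<open>i = i'\<close> show "x = y" using xy by blast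
  qed
  have sub: "?F ` ?D \<subseteq> {p. p permutes {..<Suc n}}"
  proof (rule image_subsetI)
    fix x assume "x \<in> ?D"
    then obtain i q where x: "x = (i, q)" and "i \<le> n" "q permutes {..<n}"
      by auto
    then have "front_cycle i \<circ> shift_perm q permutes {..<Suc n}"
      using front_cycle_permutes[of i n] shift_perm_permutes_sign[of q n]
      by (intro permutes_compose) auto
    then show "?F x \<in> {p. p permutes {..<Suc n}}" by (simp only: x case_prod_conv mem_Collect_eq)
  qed
  have perms: "card {p. p permutes {..<m}} = fact m" for m :: nat
    by (rule card_permutations) simp_all
  have "card (?F ` ?D) = card {p. p permutes {..<Suc n}}"
    by (simp only: card_image[OF inj] card_cartesian_product perms card_lessThan fact_Suc of_nat_id)
  then have "?F ` ?D = {p. p permutes {..<Suc n}}"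
    using sub finite_permutations[of "{..<Suc n}"] card_subset_eq by blast
  with inj show ?thesis by (simp add: bij_betw_def)
qed

lemma tl_permute_list_cycle_shift:
  assumes len: "length vs = Suc n" and i: "i \<le> n" and q: "q permutes {..<n}"
  shows "tl (permute_list (front_cycle i \<circ> shift_perm q) vs)
           = permute_list q (take i vs @ drop (Suc i) vs)"
proof (rule nth_equalityI)
  show "length (tl (permute_list (front_cycle i \<circ> shift_perm q) vs))
          = length (permute_list q (take i vs @ drop (Suc i) vs))"
    using len i by simp
next
  fix j assume "j < length (tl (permute_list (front_cycle i \<circ> shift_perm q) vs))"
  then have j: "j < n" using len by simp
  then have qj: "q j < n" using permutes_in_image[OF q, of j] by simp
  have p: "front_cycle i \<circ> shift_perm q permutes {..<length vs}"
    using front_cycle_permutes[OF i] shift_perm_permutes_sign[OF q] len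
    by (auto intro: permutes_compose)
  have "tl (permute_list (front_cycle i \<circ> shift_perm q) vs) ! j
          = vs ! front_cycle i (Suc (q j))"
    using j len by (simp add: nth_tl permute_list_nth[OF p] shift_perm_def)
  also have "\<dots> = (take i vs @ drop (Suc i) vs) ! q j"
    using qj i len by (simp add: nth_append front_cycle_def min_def Suc_le_eq)
  also have "\<dots> = permute_list q (take i vs @ drop (Suc i) vs) ! j"
    using q j len i by (simp add: permute_list_def)
  finally show "tl (permute_list (front_cycle i \<circ> shift_perm q) vs) ! j
          = permute_list q (take i vs @ drop (Suc i) vs) ! j" .
qed

lemma boundary_oriented_simplex:
  "simplicial_boundary (oriented_simplex vs)
     = (\<Sum>i<length vs. frag_cmul ((-1) ^ i) (oriented_simplex (take i vs @ drop (Suc i) vs)))"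
proof (cases "length vs")
  case 0
  then have "vs = []" by simp
  moreover have "{p. p permutes {..<length ([] :: 'a list)}} = {id}" by auto
  ultimately show ?thesis
    by (simp only: oriented_simplex_def simplicial_boundary_def) (simp add: frag_extend_cmul)
next
  case (Suc n)
  let ?del = "\<lambda>i. take i vs @ drop (Suc i) vs"
  have drop_first: "(case ws of [] \<Rightarrow> 0 | v # us \<Rightarrow> frag_of us) = frag_of (tl ws)"
    if "length ws = Suc n" for ws :: "'a list"
    using that by (cases ws) auto
  have "simplicial_boundary (oriented_simplex vs)
      = (\<Sum>p | p permutes {..<Suc n}. frag_cmul (sign p) (frag_of (tl (permute_list p vs))))"
    by (simp add: oriented_simplex_def simplicial_boundary_def frag_extend_sum frag_extend_cmul
        finite_permutations drop_first Suc)
  also have "\<dots> = (\<Sum>(i, q) \<in> {..<Suc n} \<times> {q. q permutes {..<n}}.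
        frag_cmul (sign (front_cycle i \<circ> shift_perm q))
          (frag_of (tl (permute_list (front_cycle i \<circ> shift_perm q) vs))))"
    by (subst sum.reindex_bij_betw[OF bij_betw_cycle_shift, symmetric])
      (simp add: case_prod_unfold)
  also have "\<dots> = (\<Sum>(i, q) \<in> {..<Suc n} \<times> {q. q permutes {..<n}}.
        frag_cmul ((-1) ^ i * sign q) (frag_of (permute_list q (?del i))))"
  proof (rule sum.cong[OF refl])
    fix x assume "x \<in> {..<Suc n} \<times> {q. q permutes {..<n}}"
    then obtain i q where x: "x = (i, q)" and i: "i \<le> n" and q: "q permutes {..<n}"
      by auto
    have "permutation (front_cycle i)" "permutation (shift_perm q)"
      using front_cycle_permutes[OF i] shift_perm_permutes_sign[OF q]
      by (auto simp: permutation_permutes)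
    then have "sign (front_cycle i \<circ> shift_perm q) = (-1) ^ i * sign q"
      using shift_perm_permutes_sign[OF q] by (simp add: sign_compose sign_front_cycle)
    then show "(case x of (i, q) \<Rightarrow> frag_cmul (sign (front_cycle i \<circ> shift_perm q))
          (frag_of (tl (permute_list (front_cycle i \<circ> shift_perm q) vs))))
        = (case x of (i, q) \<Rightarrow> frag_cmul ((-1) ^ i * sign q) (frag_of (permute_list q (?del i))))"
      by (simp only: x case_prod_conv tl_permute_list_cycle_shift[OF Suc i q])
  qed
  also have "\<dots> = (\<Sum>i<Suc n. \<Sum>q | q permutes {..<n}.
        frag_cmul ((-1) ^ i * sign q) (frag_of (permute_list q (?del i))))"
    by (simp only: sum.cartesian_product)
  also have "\<dots> = (\<Sum>i<Suc n. frag_cmul ((-1) ^ i) (oriented_simplex (?del i)))"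
  proof (rule sum.cong[OF refl])
    fix i assume "i \<in> {..<Suc n}"
    then have "length (?del i) = n" using Suc by simp
    then show "(\<Sum>q | q permutes {..<n}.
          frag_cmul ((-1) ^ i * sign q) (frag_of (permute_list q (?del i))))
        = frag_cmul ((-1) ^ i) (oriented_simplex (?del i))"
      by (simp only: oriented_simplex_def frag_cmul_sum frag_cmul_cmul)
  qed
  also have "\<dots> = (\<Sum>i<length vs. frag_cmul ((-1) ^ i) (oriented_simplex (?del i)))"
    by (simp only: Suc)
  finally show ?thesis .
qed

definition chain_complex_of :: "'v set set \<Rightarrow> ('v list \<Rightarrow>\<^sub>0 int) chain_cx" where
  "chain_complex_of Y =
     \<lparr>grp = (\<lambda>n. (free_Abelian_group UNIV)\<lparr>carrier := oriented_chains Y n\<rparr>),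
      bd = (\<lambda>n. simplicial_boundary)\<rparr>"

text \<open>The chain map of a simplicial map \<open>f\<close>: simplices on which \<open>f\<close> is not injective go to \<open>0\<close>.\<close>

definition simplicial_chain_map :: "('v \<Rightarrow> 'u) \<Rightarrow> ('v list \<Rightarrow>\<^sub>0 int) \<Rightarrow> ('u list \<Rightarrow>\<^sub>0 int)" where
  "simplicial_chain_map f =
     frag_extend (\<lambda>vs. if distinct (map f vs) then frag_of (map f vs) else 0)"

text \<open>The complex of non-empty finite chains of a poset. Homology of a poset is homology of this
  complex, and the barycentric subdivision of \<open>Y\<close> is \<open>order_complex (\<subseteq>) Y\<close>.\<close>

definition order_complex :: "('a \<Rightarrow> 'a \<Rightarrow> bool) \<Rightarrow> 'a set \<Rightarrow> 'a set set" where
  "order_complex ord S =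
     {s. s \<noteq> {} \<and> finite s \<and> s \<subseteq> S \<and> Complete_Partial_Order.chain ord s}"

text \<open>The subdivision operator, recursively \<open>sd \<sigma> = [\<sigma>, sd \<partial>\<sigma>]\<close> (cone from the barycentre
  of \<open>\<sigma>\<close>). Expanding the recursion, \<open>[v\<^sub>0, \<dots>, v\<^sub>n]\<close> goes to the signed sum over all reorderings
  \<open>ws\<close> of the oriented flags \<open>[{w\<^sub>0, \<dots>, w\<^sub>n}, {w\<^sub>1, \<dots>, w\<^sub>n}, \<dots>, {w\<^sub>n}]\<close>; the reorderings and their
  signs are already part of an oriented chain.\<close>

fun flag_of :: "'v list \<Rightarrow> 'v set list" where
  "flag_of [] = []"
| "flag_of (v # vs) = set (v # vs) # flag_of vs"

definition subdivision :: "('v list \<Rightarrow>\<^sub>0 int) \<Rightarrow> ('v set list \<Rightarrow>\<^sub>0 int)" where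
  "subdivision = frag_extend (\<lambda>vs. oriented_simplex (flag_of vs))"


section \<open>The curve\<close>

abbreviation univ_ring :: "'k::field ring" where
  "univ_ring \<equiv> ring_of_type_algebra"

text \<open>The type \<open>'k\<close> is the function field \<open>K\<close> of \<open>C\<close>, and \<open>k\<close> is the finite constant field.
  A smooth projective curve is determined by its function field. As \<open>k\<close> is perfect, the curve is
  geometrically irreducible iff \<open>k\<close> is algebraically closed in \<open>K\<close>.\<close>

definition function_field_of_curve :: "'k::field set \<Rightarrow> bool" where
  "function_field_of_curve k \<longleftrightarrow>
     finite k \<and> subfield k univ_ring \<and>
     (\<exists>t. ring.transcendental univ_ring k t \<and>
          ring.finite_dimension univ_ring (generate_field univ_ring (insert t k)) UNIV) \<and>
     (\<forall>x. ring.algebraic univ_ring k x \<longrightarrow> x \<in> k)"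

text \<open>A closed point is identified with its local ring; these are the valuation rings
  \<open>k \<subseteq> Q \<subset> K\<close>, all of which are discrete.\<close>

definition closed_points :: "'k::field set \<Rightarrow> 'k set set" where
  "closed_points k =
     {Q. subring Q univ_ring \<and> k \<subseteq> Q \<and> Q \<noteq> UNIV \<and> (\<forall>x. x \<in> Q \<or> inverse x \<in> Q)}"

definition regular_functions_away :: "'k::field set \<Rightarrow> 'k set \<Rightarrow> 'k set" where
  "regular_functions_away k R = \<Inter> (closed_points k - {R})"

text \<open>A generator of the maximal ideal (the set of non-units) of the valuation ring \<open>R\<close>.\<close>

definition uniformizer :: "'k::field set \<Rightarrow> 'k \<Rightarrow> bool" where
  "uniformizer R \<pi> \<longleftrightarrow> {x \<in> R. x = 0 \<or> inverse x \<notin> R} = (\<lambda>a. a * \<pi>) ` R"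

abbreviation subring_as_ring :: "'k::field set \<Rightarrow> 'k ring" where
  "subring_as_ring S \<equiv> univ_ring\<lparr>carrier := S\<rparr>"


section \<open>Modules\<close>

definition module_of :: "('k \<Rightarrow> 'w \<Rightarrow> 'w) \<Rightarrow> 'w::ab_group_add set \<Rightarrow> ('k, 'w) module" where
  "module_of scale M =
     \<lparr>carrier = M, monoid.mult = undefined, one = undefined,
      ring.zero = 0, add = (+), module.smult = scale\<rparr>"

definition module_homs ::
    "('a, 'e) ring_scheme \<Rightarrow> ('a, 'b, 'f) module_scheme \<Rightarrow> ('a, 'c, 'g) module_scheme \<Rightarrow> ('b \<Rightarrow> 'c) set"
  where
  "module_homs A M N =
     {f \<in> carrier M \<rightarrow> carrier N.
        (\<forall>x \<in> carrier M. \<forall>y \<in> carrier M. f (x \<oplus>\<^bsub>M\<^esub> y) = f x \<oplus>\<^bsub>N\<^esub> f y) \<and>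
        (\<forall>a \<in> carrier A. \<forall>x \<in> carrier M. f (a \<odot>\<^bsub>M\<^esub> x) = a \<odot>\<^bsub>N\<^esub> f x)}"

definition free_module :: "('a, 'e) ring_scheme \<Rightarrow> 'x set \<Rightarrow> ('a, 'x \<Rightarrow> 'a) module" where
  "free_module A Y =
     \<lparr>carrier = {f \<in> Y \<rightarrow>\<^sub>E carrier A. finite {x \<in> Y. f x \<noteq> \<zero>\<^bsub>A\<^esub>}},
      monoid.mult = undefined, one = undefined,
      ring.zero = (\<lambda>x \<in> Y. \<zero>\<^bsub>A\<^esub>), add = (\<lambda>f g. \<lambda>x \<in> Y. f x \<oplus>\<^bsub>A\<^esub> g x),
      module.smult = (\<lambda>a f. \<lambda>x \<in> Y. a \<otimes>\<^bsub>A\<^esub> f x)\<rparr>"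

text \<open>Direct summand of a free module. A basis inside the type of \<open>M\<close> is no restriction: if \<open>M\<close> is
  projective, it is a summand of the free module on its own underlying set.\<close>

definition projective_module :: "('a, 'e) ring_scheme \<Rightarrow> ('a, 'b, 'f) module_scheme \<Rightarrow> bool" where
  "projective_module A M \<longleftrightarrow>
     module A M \<and>
     (\<exists>Y :: 'b set. \<exists>s \<in> module_homs A (free_module A Y) M. \<exists>i \<in> module_homs A M (free_module A Y).
        \<forall>x \<in> carrier M. s (i x) = x)"


section \<open>Bruhat--Tits building and Tits building\<close>

text \<open>Throughout, \<open>scale\<close> is the scalar multiplication of the \<open>K\<close>-vector space \<open>W\<close>, which is the
  whole type \<open>'w\<close>.\<close>

definition lattice_in :: "('k::field \<Rightarrow> 'w \<Rightarrow> 'w) \<Rightarrow> 'k set \<Rightarrow> 'w::ab_group_add set \<Rightarrow> bool" where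
  "lattice_in scale R L \<longleftrightarrow>
     (\<exists>B. finite B \<and> L = {\<Sum>b\<in>B. scale (c b) b | c. \<forall>b \<in> B. c b \<in> R}) \<and>
     vector_space.dim scale L = vector_space.dim scale UNIV"

definition homothety_class :: "('k::field \<Rightarrow> 'w \<Rightarrow> 'w) \<Rightarrow> 'w set \<Rightarrow> 'w set set" where
  "homothety_class scale L = {scale a ` L | a. a \<noteq> 0}"

definition building ::
    "('k::field \<Rightarrow> 'w \<Rightarrow> 'w) \<Rightarrow> 'k set \<Rightarrow> 'k \<Rightarrow> 'w::ab_group_add set set set set" where
  "building scale R \<pi> =
     {s. \<exists>d L. card s = d + 1 \<and> s = homothety_class scale ` L ` {0..d} \<and>
           (\<forall>i \<le> d. lattice_in scale R (L i)) \<and>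
           (\<forall>i < d. L (Suc i) \<subset> L i) \<and> scale \<pi> ` L 0 \<subset> L d}"

definition proper_subspaces :: "('k::field \<Rightarrow> 'w \<Rightarrow> 'w) \<Rightarrow> 'w::ab_group_add set set" where
  "proper_subspaces scale = {U. module.subspace scale U \<and> U \<noteq> {0} \<and> U \<noteq> UNIV}"

definition tits_building :: "('k::field \<Rightarrow> 'w \<Rightarrow> 'w) \<Rightarrow> 'w::ab_group_add set set set" where
  "tits_building scale = order_complex (\<subseteq>) (proper_subspaces scale)"

definition Steinberg ::
    "('k::field \<Rightarrow> 'w \<Rightarrow> 'w) \<Rightarrow> ('w::ab_group_add set list \<Rightarrow>\<^sub>0 int) set monoid" where
  "Steinberg scale =
     homology_group (chain_complex_of (tits_building scale)) (int (vector_space.dim scale (UNIV :: 'w set)) - 2)"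


section \<open>Arithmetic groups and unstable simplices\<close>

text \<open>\<open>Aut\<^sub>A(P)\<close>, where an automorphism of \<open>P\<close> is represented by its unique \<open>K\<close>-linear extension
  to \<open>W = KP\<close>.\<close>

definition aut_group ::
    "('k::field \<Rightarrow> 'w \<Rightarrow> 'w) \<Rightarrow> 'w::ab_group_add set \<Rightarrow> ('w \<Rightarrow> 'w) monoid" where
  "aut_group scale P =
     \<lparr>carrier = {g. Vector_Spaces.linear scale scale g \<and> bij_betw g P P},
      monoid.mult = (\<circ>), one = id\<rparr>"

definition ideal_times ::
    "('k::field \<Rightarrow> 'w \<Rightarrow> 'w) \<Rightarrow> 'k set \<Rightarrow> 'w::ab_group_add set \<Rightarrow> 'w set" where
  "ideal_times scale I P =
     generate (add_monoid (module_of scale UNIV)) {scale a x | a x. a \<in> I \<and> x \<in> P}"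

definition congruence_subgroup ::
    "('k::field \<Rightarrow> 'w \<Rightarrow> 'w) \<Rightarrow> 'w::ab_group_add set \<Rightarrow> 'k set \<Rightarrow> ('w \<Rightarrow> 'w) set" where
  "congruence_subgroup scale P I =
     {g \<in> carrier (aut_group scale P). \<forall>x \<in> P. g x - x \<in> ideal_times scale I P}"

definition vertex_action :: "('w \<Rightarrow> 'w) \<Rightarrow> 'w set set \<Rightarrow> 'w set set" where
  "vertex_action g v = (\<lambda>L. g ` L) ` v"

definition unstable ::
    "('k::field \<Rightarrow> 'w \<Rightarrow> 'w) \<Rightarrow> 'k set \<Rightarrow> 'k \<Rightarrow> ('w \<Rightarrow> 'w) set \<Rightarrow> 'w::ab_group_add set set set set" where
  "unstable scale R \<pi> \<Gamma> =
     {s \<in> building scale R \<pi>. \<exists>g \<in> \<Gamma>. g \<noteq> id \<and> vertex_action g ` s = s}"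

definition fixing_subcomplex ::
    "('k::field \<Rightarrow> 'w \<Rightarrow> 'w) \<Rightarrow> 'k set \<Rightarrow> 'k \<Rightarrow> ('w \<Rightarrow> 'w) set \<Rightarrow> 'w set \<Rightarrow> 'w::ab_group_add set set set set"
  where
  "fixing_subcomplex scale R \<pi> \<Gamma> W1 =
     {s \<in> building scale R \<pi>. \<exists>g \<in> \<Gamma>. g \<noteq> id \<and>
        (\<forall>v \<in> s. \<forall>L \<in> v. g ` L = L) \<and> (\<forall>x \<in> W1. g x = x)}"

definition stable_chains ::
    "('k::field \<Rightarrow> 'w \<Rightarrow> 'w) \<Rightarrow> 'k set \<Rightarrow> 'k \<Rightarrow> ('w \<Rightarrow> 'w) set
      \<Rightarrow> ('w::ab_group_add set set list \<Rightarrow>\<^sub>0 int) set chain_cx" where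
  "stable_chains scale R \<pi> \<Gamma> =
     quot_cx (chain_complex_of (building scale R \<pi>)) (chain_complex_of (unstable scale R \<pi> \<Gamma>))"

text \<open>\<open>St\<^sup>I(P)\<close>, for \<open>\<Gamma> = \<Gamma>\<^sub>P(I)\<close>.\<close>

definition level_Steinberg ::
    "('k::field \<Rightarrow> 'w \<Rightarrow> 'w) \<Rightarrow> 'k set \<Rightarrow> 'k \<Rightarrow> ('w \<Rightarrow> 'w) set
      \<Rightarrow> ('w::ab_group_add set set list \<Rightarrow>\<^sub>0 int) set set monoid" where
  "level_Steinberg scale R \<pi> \<Gamma> =
     homology_group (stable_chains scale R \<pi> \<Gamma>) (int (vector_space.dim scale (UNIV :: 'w set)) - 1)"

text \<open>The action of \<open>\<Gamma>\<^sub>P\<close> on \<open>St\<^sup>I(P)\<close> induced by its action on the building.\<close>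

definition level_Steinberg_action ::
    "('k::field \<Rightarrow> 'w \<Rightarrow> 'w) \<Rightarrow> 'k set \<Rightarrow> 'k \<Rightarrow> ('w \<Rightarrow> 'w) set \<Rightarrow> ('w \<Rightarrow> 'w)
      \<Rightarrow> ('w::ab_group_add set set list \<Rightarrow>\<^sub>0 int) set set \<Rightarrow> ('w set set list \<Rightarrow>\<^sub>0 int) set set" where
  "level_Steinberg_action scale R \<pi> \<Gamma> g =
     (let n = int (vector_space.dim scale (UNIV :: 'w set)) - 1 in
      homology_map (stable_chains scale R \<pi> \<Gamma>) (stable_chains scale R \<pi> \<Gamma>) n
        (quot_map (chain_complex_of (building scale R \<pi>)) (chain_complex_of (unstable scale R \<pi> \<Gamma>)) n
           (simplicial_chain_map (vertex_action g))))"


section \<open>The maps\<close>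

text \<open>For \<open>\<Gamma>' \<subseteq> \<Gamma>\<close>: the projection of quotient complexes, sending a coset modulo the
  \<open>\<Gamma>'\<close>-unstable chains to the coset modulo the \<open>\<Gamma>\<close>-unstable chains that contains it (it does not
  depend on \<open>\<Gamma>'\<close> otherwise), and the map \<open>i\<^sub>J\<^sub>,\<^sub>I\<close> it induces.\<close>

definition stable_projection ::
    "('k::field \<Rightarrow> 'w \<Rightarrow> 'w) \<Rightarrow> 'k set \<Rightarrow> 'k \<Rightarrow> ('w \<Rightarrow> 'w) set \<Rightarrow> int
      \<Rightarrow> ('w::ab_group_add set set list \<Rightarrow>\<^sub>0 int) set \<Rightarrow> ('w set set list \<Rightarrow>\<^sub>0 int) set" where
  "stable_projection scale R \<pi> \<Gamma> n =
     quot_map (chain_complex_of (building scale R \<pi>)) (chain_complex_of (unstable scale R \<pi> \<Gamma>)) n (\<lambda>c. c)"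

definition level_change ::
    "('k::field \<Rightarrow> 'w \<Rightarrow> 'w) \<Rightarrow> 'k set \<Rightarrow> 'k \<Rightarrow> ('w \<Rightarrow> 'w) set \<Rightarrow> ('w \<Rightarrow> 'w) set
      \<Rightarrow> ('w::ab_group_add set set list \<Rightarrow>\<^sub>0 int) set set \<Rightarrow> ('w set set list \<Rightarrow>\<^sub>0 int) set set" where
  "level_change scale R \<pi> \<Gamma>' \<Gamma> =
     (let n = int (vector_space.dim scale (UNIV :: 'w set)) - 1 in
      homology_map (stable_chains scale R \<pi> \<Gamma>') (stable_chains scale R \<pi> \<Gamma>) n
        (stable_projection scale R \<pi> \<Gamma> n))"

definition delta_map ::
    "('k::field \<Rightarrow> 'w \<Rightarrow> 'w) \<Rightarrow> 'k set \<Rightarrow> 'k \<Rightarrow> ('w \<Rightarrow> 'w) set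
      \<Rightarrow> ('w::ab_group_add set set list \<Rightarrow>\<^sub>0 int) set set \<Rightarrow> ('w set set list \<Rightarrow>\<^sub>0 int) set" where
  "delta_map scale R \<pi> \<Gamma> =
     connecting_map (chain_complex_of (building scale R \<pi>)) (chain_complex_of (unstable scale R \<pi> \<Gamma>))
       (int (vector_space.dim scale (UNIV :: 'w set)) - 1)"

definition Z_poset ::
    "('k::field \<Rightarrow> 'w \<Rightarrow> 'w) \<Rightarrow> 'k set \<Rightarrow> 'k \<Rightarrow> ('w \<Rightarrow> 'w) set
      \<Rightarrow> ('w::ab_group_add set set set \<times> 'w set) set" where
  "Z_poset scale R \<pi> \<Gamma> =
     {(\<gamma>, \<sigma>). \<gamma> \<in> unstable scale R \<pi> \<Gamma> \<and> \<sigma> \<in> proper_subspaces scale \<and>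
        \<gamma> \<in> fixing_subcomplex scale R \<pi> \<Gamma> \<sigma>}"

text \<open>\<open>(p\<^sub>2)\<^sub>* \<circ> (p\<^sub>1)\<^sub>*\<^sup>-\<^sup>1\<close>, precomposed with the identification of the homology of the unstable
  complex with that of its barycentric subdivision. Since \<open>(p\<^sub>1)\<^sub>*\<close> is bijective for congruence
  subgroups of proper non-zero level, \<^const>\<open>inv_into\<close> is its inverse.\<close>

definition phi_map ::
    "('k::field \<Rightarrow> 'w \<Rightarrow> 'w) \<Rightarrow> 'k set \<Rightarrow> 'k \<Rightarrow> ('w \<Rightarrow> 'w) set
      \<Rightarrow> ('w::ab_group_add set set list \<Rightarrow>\<^sub>0 int) set \<Rightarrow> ('w set list \<Rightarrow>\<^sub>0 int) set" where
  "phi_map scale R \<pi> \<Gamma> =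
     (let n = int (vector_space.dim scale (UNIV :: 'w set)) - 2;
          Y = chain_complex_of (unstable scale R \<pi> \<Gamma>);
          Y' = chain_complex_of (order_complex (\<subseteq>) (unstable scale R \<pi> \<Gamma>));
          Z = chain_complex_of (order_complex (rel_prod (\<subseteq>) (\<subseteq>)) (Z_poset scale R \<pi> \<Gamma>));
          T = chain_complex_of (tits_building scale)
      in homology_map Z T n (simplicial_chain_map snd)
         \<circ> inv_into (carrier (homology_group Z n)) (homology_map Z Y' n (simplicial_chain_map fst))
         \<circ> homology_map Y Y' n subdivision)"

text \<open>A map from \<^const>\<open>level_Steinberg\<close> to \<^const>\<open>Steinberg\<close>.\<close>

definition GQ ::
    "('k::field \<Rightarrow> 'w \<Rightarrow> 'w) \<Rightarrow> 'k set \<Rightarrow> 'k \<Rightarrow> ('w \<Rightarrow> 'w) set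
      \<Rightarrow> ('w::ab_group_add set set list \<Rightarrow>\<^sub>0 int) set set \<Rightarrow> ('w set list \<Rightarrow>\<^sub>0 int) set" where
  "GQ scale R \<pi> \<Gamma> = phi_map scale R \<pi> \<Gamma> \<circ> delta_map scale R \<pi> \<Gamma>"

end

theory Submission
  imports Defs
begin

text \<open>
  Sending an unstable simplex \<open>s\<close> to the space \<open>U(s)\<close> fixed by the pointwise stabilizer \<open>\<Gamma>\<^sub>s\<close> is a
  monotone map to the proper non-zero subspaces, so \<open>s \<mapsto> (s, U(s))\<close> is a section of \<open>p\<^sub>1\<close>. It is
  inverse to \<open>p\<^sub>1\<close> up to homotopy: \<open>(s, \<sigma>)\<close> and \<open>(s, U(s))\<close> both lie below \<open>(s, \<tau>)\<close>, where \<open>\<tau>\<close> is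
  fixed by those elements of \<open>\<Gamma>\<^sub>s\<close> that fix \<open>\<sigma>\<close> pointwise. Hence \<open>\<phi>\<^sub>I\<close> is induced by \<open>U\<close>. For
  \<open>\<Gamma>' \<subseteq> \<Gamma>\<close> we have \<open>U(s) \<subseteq> U'(s)\<close>, and comparable poset maps agree on homology.

  That \<open>U(s)\<close> is non-zero is arithmetic: \<open>P \<inter> L\<close> is finite for every lattice \<open>L\<close>, and \<open>g - 1\<close> strictly
  increases a valuation that is positive on \<open>I\<close>, for every \<open>g \<in> \<Gamma>\<close>. Finiteness rests on counting: the
  number of functions with poles of order at most \<open>m\<close> grows at most exponentially in \<open>m\<close>.
\<close>

section \<open>Homology of chain complexes and quotient complexes\<close>

text \<open>A class of level J is given by a chain x with J-unstable boundary. The same x represents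
  its image at level I, so both connecting maps yield the class of the one cycle
  \<open>simplicial_boundary x\<close>, and only the two maps to the Tits building remain to be
  compared. The map p_1 is inverted by \<open>inv_into\<close>, so a section gives its value only
  once p_1 is known to be injective on homology; this is what the homotopy through tau provides.
  Instability asks for an element that preserves a simplex as a set, whereas
  \<open>fixing_subcomplex\<close> asks for one that fixes every lattice of every class. That the
  two agree rests on counting: a homothety by a non-unit would change the number of points of P in
  some multiple of a lattice. The finiteness of \<open>P \<inter> L\<close> thus enters twice. The
  valuation that is positive on I comes from Chevalley's extension theorem, applied to A and I. The
  same theorem shows that a function without poles that vanishes at infinity is zero, which is what
  turns bounds on residues into finiteness.\<close>

lemma (in comm_group) coset_eq_iff:
  assumes "subgroup H G" "x \<in> carrier G" "y \<in> carrier G"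
  shows "H #> x = H #> y \<longleftrightarrow> (\<exists>h\<in>H. x = h \<otimes> y)"
proof
  assume "H #> x = H #> y"
  then have "x \<in> H #> y"
    using rcos_self[OF assms(2,1)] by simp
  then show "\<exists>h\<in>H. x = h \<otimes> y" by (auto simp: r_coset_def)
next
  assume "\<exists>h\<in>H. x = h \<otimes> y"
  then have "x \<in> H #> y" by (auto simp: r_coset_def)
  then show "H #> x = H #> y"
    using repr_independence[OF _ assms(3,1)] by simp
qed

lemma (in comm_group) coset_mult:
  assumes "subgroup H G" "x \<in> carrier G" "y \<in> carrier G"
  shows "(H #> x) <#> (H #> y) = H #> (x \<otimes> y)"
  using normal.rcos_sum[OF subgroup_imp_normal[OF assms(1)]] assms(2,3) by simp

lemma r_coset_carrier_update [simp]: "H #>\<^bsub>G\<lparr>carrier := S\<rparr>\<^esub> x = H #>\<^bsub>G\<^esub> x"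
  by (simp add: r_coset_def)

lemma set_mult_carrier_update [simp]: "A <#>\<^bsub>G\<lparr>carrier := S\<rparr>\<^esub> B = A <#>\<^bsub>G\<^esub> B"
  by (simp add: set_mult_def)

text \<open>\<open>quot_map\<close> and \<open>homology_map\<close> are the unique value taken on a
  coset, so computing them amounts to showing that the value is constant there.\<close>

lemma the_elem_image_eqI:
  assumes "U \<noteq> {}" "\<And>x. x \<in> U \<Longrightarrow> f x = y"
  shows "the_elem (f ` U) = y"
proof -
  have "f ` U = {y}" using assms by auto
  then show ?thesis by simp
qed

lemma quot_map_coset:
  assumes G: "comm_group G" "subgroup H G" and K: "comm_group (grp C n)" "subgroup (carrier (grp D n)) (grp C n)"
    and f: "f \<in> hom G (grp C n)" "f ` H \<subseteq> carrier (grp D n)" and x: "x \<in> carrier G"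
  shows "quot_map C D n f (H #>\<^bsub>G\<^esub> x) = carrier (grp D n) #>\<^bsub>grp C n\<^esub> f x"
  unfolding quot_map_def
proof (rule the_elem_image_eqI)
  interpret G: comm_group G by fact
  interpret K: comm_group "grp C n" by fact
  show "H #>\<^bsub>G\<^esub> x \<noteq> {}" using G.rcos_self[OF x G(2)] by auto
  fix y assume "y \<in> H #>\<^bsub>G\<^esub> x"
  then obtain h where h: "h \<in> H" "y = h \<otimes>\<^bsub>G\<^esub> x" by (auto simp: r_coset_def)
  have hc: "h \<in> carrier G" using h G(2) by (meson subgroup.mem_carrier)
  have "f y = f h \<otimes>\<^bsub>grp C n\<^esub> f x" using f(1) h hc x by (simp add: hom_mult)
  moreover have "f y \<in> carrier (grp C n)" "f x \<in> carrier (grp C n)"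
    using f(1) h hc x by (auto simp: hom_def)
  ultimately show "carrier (grp D n) #>\<^bsub>grp C n\<^esub> f y = carrier (grp D n) #>\<^bsub>grp C n\<^esub> f x"
    using K.coset_eq_iff[OF K(2)] f(2) h(1) by blast
qed

lemma quot_map_hom:
  assumes G: "comm_group G" "subgroup H G" and K: "comm_group (grp C n)" "subgroup (carrier (grp D n)) (grp C n)"
    and f: "f \<in> hom G (grp C n)" "f ` H \<subseteq> carrier (grp D n)"
  shows "quot_map C D n f \<in> hom (G Mod H) (grp C n Mod carrier (grp D n))"
proof (rule homI)
  interpret G: comm_group G by fact
  interpret K: comm_group "grp C n" by fact
  note * = quot_map_coset[OF assms]
  have fc: "x \<in> carrier G \<Longrightarrow> f x \<in> carrier (grp C n)" for x
    using f(1) by (auto simp: hom_def)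
  {
    fix U assume "U \<in> carrier (G Mod H)"
    then obtain x where x: "x \<in> carrier G" "U = H #>\<^bsub>G\<^esub> x" by (auto simp: carrier_FactGroup)
    then show "quot_map C D n f U \<in> carrier (grp C n Mod carrier (grp D n))"
      using *[of x] fc by (auto simp: carrier_FactGroup)
    fix V assume "V \<in> carrier (G Mod H)"
    then obtain y where y: "y \<in> carrier G" "V = H #>\<^bsub>G\<^esub> y" by (auto simp: carrier_FactGroup)
    show "quot_map C D n f (U \<otimes>\<^bsub>G Mod H\<^esub> V) =
      quot_map C D n f U \<otimes>\<^bsub>grp C n Mod carrier (grp D n)\<^esub> quot_map C D n f V"
      using x y fc f(1)
      by (simp add: G.coset_mult[OF G(2)] * K.coset_mult[OF K(2)] hom_mult)
  }
qed

section \<open>Cycles, boundaries and maps on homology\<close>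

locale chain_complex =
  fixes C :: "'c chain_cx"
  assumes comm_grp: "comm_group (grp C n)"
    and bd_hom: "bd C n \<in> hom (grp C n) (grp C (n - 1))"
    and bd_bd: "x \<in> carrier (grp C n) \<Longrightarrow> bd C (n - 1) (bd C n x) = \<one>\<^bsub>grp C (n - 1 - 1)\<^esub>"
begin

lemma bd_closed: "x \<in> carrier (grp C n) \<Longrightarrow> bd C n x \<in> carrier (grp C (n - 1))"
  using bd_hom[of n] by (auto simp: hom_def)

text \<open>The variants in degree \<open>n + 1\<close> absorb the target degree
  \<open>n + 1 - 1\<close> once and for all.\<close>

lemma bd_Suc_hom: "bd C (n + 1) \<in> hom (grp C (n + 1)) (grp C n)"
  using bd_hom[of "n + 1"] by simp

lemma bd_Suc_closed: "x \<in> carrier (grp C (n + 1)) \<Longrightarrow> bd C (n + 1) x \<in> carrier (grp C n)"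
  using bd_closed[of x "n + 1"] by simp

lemma bd_bd_Suc: "x \<in> carrier (grp C (n + 1)) \<Longrightarrow> bd C n (bd C (n + 1) x) = \<one>\<^bsub>grp C (n - 1)\<^esub>"
  using bd_bd[of x "n + 1"] by simp

definition cycles :: "int \<Rightarrow> 'c set" where
  "cycles n = kernel (grp C n) (grp C (n - 1)) (bd C n)"

definition boundaries :: "int \<Rightarrow> 'c set" where
  "boundaries n = bd C (n + 1) ` carrier (grp C (n + 1))"

lemma cycle_iff: "z \<in> cycles n \<longleftrightarrow> z \<in> carrier (grp C n) \<and> bd C n z = \<one>\<^bsub>grp C (n - 1)\<^esub>"
  by (auto simp: cycles_def kernel_def)

lemma subgroup_boundaries: "subgroup (boundaries n) (grp C n)"
proof -
  interpret group_hom "grp C (n + 1)" "grp C n" "bd C (n + 1)"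
    using comm_grp bd_Suc_hom by (auto simp: group_hom_def group_hom_axioms_def comm_group_def)
  show ?thesis unfolding boundaries_def by (rule img_is_subgroup)
qed

lemma homology_class_def': "homology_class C n z = boundaries n #>\<^bsub>grp C n\<^esub> z"
  by (simp add: homology_class_def boundaries_def)

lemma homology_class_eq_iff:
  assumes "z \<in> carrier (grp C n)" "z' \<in> carrier (grp C n)"
  shows "homology_class C n z = homology_class C n z' \<longleftrightarrow>
    (\<exists>b\<in>carrier (grp C (n + 1)). z = bd C (n + 1) b \<otimes>\<^bsub>grp C n\<^esub> z')"
  using comm_group.coset_eq_iff[OF comm_grp subgroup_boundaries assms]
  by (auto simp: homology_class_def' boundaries_def)

lemma carrier_homology_group:
  "carrier (homology_group C n) = homology_class C n ` cycles n"
  by (simp add: homology_group_def carrier_FactGroup cycles_def homology_class_def)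

lemma homology_class_mult:
  assumes "z \<in> carrier (grp C n)" "z' \<in> carrier (grp C n)"
  shows "homology_class C n z \<otimes>\<^bsub>homology_group C n\<^esub> homology_class C n z' =
    homology_class C n (z \<otimes>\<^bsub>grp C n\<^esub> z')"
  using comm_group.coset_mult[OF comm_grp subgroup_boundaries assms]
  by (simp add: homology_group_def homology_class_def')

end

text \<open>The map \<open>f\<close> lives in the single degree \<open>n\<close>, so compatibility
  with the differentials enters as preservation of boundaries: it makes the class of
  \<open>f z\<close> independent of the representative.\<close>

lemma homology_map_class:
  assumes "chain_complex C" "chain_complex D"
    and f: "f \<in> hom (grp C n) (grp D n)"
      "\<And>b. b \<in> carrier (grp C (n + 1)) \<Longrightarrow> f (bd C (n + 1) b) \<in> bd D (n + 1) ` carrier (grp D (n + 1))"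
    and z: "z \<in> carrier (grp C n)"
  shows "homology_map C D n f (homology_class C n z) = homology_class D n (f z)"
  unfolding homology_map_def
proof (rule the_elem_image_eqI)
  interpret C: chain_complex C by fact
  interpret D: chain_complex D by fact
  interpret Cn: comm_group "grp C n" by (rule C.comm_grp)
  show "homology_class C n z \<noteq> {}"
    using Cn.rcos_self[OF z C.subgroup_boundaries] by (auto simp: C.homology_class_def')
  fix y assume "y \<in> homology_class C n z"
  then obtain b where b: "b \<in> carrier (grp C (n + 1))" "y = bd C (n + 1) b \<otimes>\<^bsub>grp C n\<^esub> z"
    by (auto simp: homology_class_def r_coset_def)
  have c: "bd C (n + 1) b \<in> carrier (grp C n)" by (rule C.bd_Suc_closed[OF b(1)])
  interpret Dn: comm_group "grp D n" by (rule D.comm_grp)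
  have "f y = f (bd C (n + 1) b) \<otimes>\<^bsub>grp D n\<^esub> f z"
    using f(1) b z c by (simp add: hom_mult)
  moreover have "f y \<in> carrier (grp D n)" "f z \<in> carrier (grp D n)"
    using f(1) b z c by (auto simp: hom_def)
  ultimately show "homology_class D n (f y) = homology_class D n (f z)"
    using f(2)[OF b(1)] by (subst D.homology_class_eq_iff) auto
qed

lemma homology_map_hom:
  assumes C: "chain_complex C" and D: "chain_complex D"
    and f: "f \<in> hom (grp C n) (grp D n)"
      "\<And>b. b \<in> carrier (grp C (n + 1)) \<Longrightarrow> f (bd C (n + 1) b) \<in> bd D (n + 1) ` carrier (grp D (n + 1))"
    and cyc: "f ` chain_complex.cycles C n \<subseteq> chain_complex.cycles D n"
  shows "homology_map C D n f \<in> hom (homology_group C n) (homology_group D n)"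
proof (rule homI)
  interpret C: chain_complex C by fact
  interpret D: chain_complex D by fact
  interpret Cn: comm_group "grp C n" by (rule C.comm_grp)
  have *: "homology_map C D n f (homology_class C n z) = homology_class D n (f z)"
    if "z \<in> carrier (grp C n)" for z
    using homology_map_class[OF C D f(1) _ that] f(2) by blast
  have fc: "x \<in> carrier (grp C n) \<Longrightarrow> f x \<in> carrier (grp D n)" for x
    using f(1) by (auto simp: hom_def)
  {
    fix U assume "U \<in> carrier (homology_group C n)"
    then obtain x where x: "x \<in> C.cycles n" "U = homology_class C n x"
      by (auto simp: C.carrier_homology_group)
    then have xc: "x \<in> carrier (grp C n)" by (simp add: C.cycle_iff)
    show "homology_map C D n f U \<in> carrier (homology_group D n)"
      using x cyc *[OF xc] by (auto simp: D.carrier_homology_group)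
    fix V assume "V \<in> carrier (homology_group C n)"
    then obtain y where y: "y \<in> C.cycles n" "V = homology_class C n y"
      by (auto simp: C.carrier_homology_group)
    then have yc: "y \<in> carrier (grp C n)" by (simp add: C.cycle_iff)
    show "homology_map C D n f (U \<otimes>\<^bsub>homology_group C n\<^esub> V) =
      homology_map C D n f U \<otimes>\<^bsub>homology_group D n\<^esub> homology_map C D n f V"
      using x y xc yc fc f(1)
      by (simp add: C.homology_class_mult * D.homology_class_mult hom_mult)
  }
qed

section \<open>Subcomplexes, quotient complexes and the connecting map\<close>

locale chain_subcomplex = chain_complex C for C :: "'c chain_cx" +
  fixes D :: "'c chain_cx"
  assumes sub: "subgroup (carrier (grp D n)) (grp C n)"
    and grp_sub: "grp D n = (grp C n)\<lparr>carrier := carrier (grp D n)\<rparr>"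
    and bd_sub: "bd D n = bd C n"
    and bd_sub_closed: "x \<in> carrier (grp D n) \<Longrightarrow> bd C n x \<in> carrier (grp D (n - 1))"
begin

lemma sub_in: "x \<in> carrier (grp D n) \<Longrightarrow> x \<in> carrier (grp C n)"
  using sub by (meson subgroup.mem_carrier)

lemma mult_sub: "x \<otimes>\<^bsub>grp D n\<^esub> y = x \<otimes>\<^bsub>grp C n\<^esub> y"
  by (subst grp_sub) simp

lemma one_sub: "\<one>\<^bsub>grp D n\<^esub> = \<one>\<^bsub>grp C n\<^esub>"
  by (subst grp_sub) simp

lemma chain_complex_sub: "chain_complex D"
proof (rule chain_complex.intro)
  fix n
  interpret Cn: comm_group "grp C n" by (rule comm_grp)
  show "comm_group (grp D n)"
  proof (rule group.group_comm_groupI)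
    show "Group.group (grp D n)"
      using Cn.subgroup_imp_group[OF sub] grp_sub[of n] by simp
  qed (auto simp: mult_sub intro: Cn.m_comm sub_in)
  show "bd D n \<in> hom (grp D n) (grp D (n - 1))"
    using bd_hom[of n] bd_sub_closed[of _ n] sub_in[of _ n]
    by (auto simp: bd_sub hom_def mult_sub)
  fix x assume "x \<in> carrier (grp D n)"
  then show "bd D (n - 1) (bd D n x) = \<one>\<^bsub>grp D (n - 1 - 1)\<^esub>"
    using bd_bd sub_in by (simp add: bd_sub one_sub)
qed

definition proj :: "int \<Rightarrow> 'c \<Rightarrow> 'c set" where
  "proj n x = carrier (grp D n) #>\<^bsub>grp C n\<^esub> x"

lemma grp_quot: "grp (quot_cx C D) n = grp C n Mod carrier (grp D n)"
  by (simp add: quot_cx_def)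

lemma carrier_quot: "carrier (grp (quot_cx C D) n) = proj n ` carrier (grp C n)"
  by (auto simp: grp_quot carrier_FactGroup proj_def)

lemma one_quot: "\<one>\<^bsub>grp (quot_cx C D) n\<^esub> = carrier (grp D n)"
  by (simp add: grp_quot)

lemma bd_quot: "x \<in> carrier (grp C n) \<Longrightarrow> bd (quot_cx C D) n (proj n x) = proj (n - 1) (bd C n x)"
  unfolding quot_cx_def proj_def
  using quot_map_coset[OF comm_grp sub comm_grp sub bd_hom _ , of n] bd_sub_closed[of _ n] by auto

lemma proj_eq_iff:
  assumes "x \<in> carrier (grp C n)" "y \<in> carrier (grp C n)"
  shows "proj n x = proj n y \<longleftrightarrow> (\<exists>h\<in>carrier (grp D n). x = h \<otimes>\<^bsub>grp C n\<^esub> y)"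
  unfolding proj_def by (rule comm_group.coset_eq_iff[OF comm_grp sub assms])

lemma proj_mult:
  assumes "x \<in> carrier (grp C n)" "y \<in> carrier (grp C n)"
  shows "proj n x \<otimes>\<^bsub>grp (quot_cx C D) n\<^esub> proj n y = proj n (x \<otimes>\<^bsub>grp C n\<^esub> y)"
  using comm_group.coset_mult[OF comm_grp sub assms] by (simp add: grp_quot proj_def)

lemma proj_eq_one_iff:
  assumes "x \<in> carrier (grp C n)"
  shows "proj n x = carrier (grp D n) \<longleftrightarrow> x \<in> carrier (grp D n)"
proof -
  interpret Cn: comm_group "grp C n" by (rule comm_grp)
  show ?thesis
    using Cn.coset_join1[of "carrier (grp D n)" x] Cn.coset_join2[of x "carrier (grp D n)"] sub assms
    by (auto simp: proj_def subgroup.subset)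
qed

lemma chain_complex_quot: "chain_complex (quot_cx C D)"
proof (rule chain_complex.intro)
  fix n
  interpret Cn: comm_group "grp C n" by (rule comm_grp)
  show "comm_group (grp (quot_cx C D) n)"
    using Cn.abelian_FactGroup[OF sub] by (simp add: grp_quot)
  show "bd (quot_cx C D) n \<in> hom (grp (quot_cx C D) n) (grp (quot_cx C D) (n - 1))"
    using quot_map_hom[OF comm_grp sub comm_grp sub bd_hom, of n] bd_sub_closed[of _ n]
    by (auto simp: quot_cx_def)
  fix U assume "U \<in> carrier (grp (quot_cx C D) n)"
  then obtain x where x: "x \<in> carrier (grp C n)" "U = proj n x" by (auto simp: carrier_quot)
  have "bd C (n - 1) (bd C n x) \<in> carrier (grp D (n - 1 - 1))"
    using bd_bd[OF x(1)] sub[of "n - 1 - 1"] by (simp add: subgroup.one_closed)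
  then show "bd (quot_cx C D) (n - 1) (bd (quot_cx C D) n U) = \<one>\<^bsub>grp (quot_cx C D) (n - 1 - 1)\<^esub>"
    using x bd_closed[of x n] bd_closed[of "bd C n x" "n - 1"]
    by (simp only: bd_quot one_quot proj_eq_one_iff)
qed

lemma cycle_quot_iff:
  assumes "x \<in> carrier (grp C n)"
  shows "proj n x \<in> chain_complex.cycles (quot_cx C D) n \<longleftrightarrow> bd C n x \<in> carrier (grp D (n - 1))"
  using chain_complex.cycle_iff[OF chain_complex_quot] assms bd_closed[OF assms]
  by (auto simp: carrier_quot bd_quot one_quot proj_eq_one_iff)

lemma carrier_homology_quot:
  "carrier (homology_group (quot_cx C D) n) =
    {homology_class (quot_cx C D) n (proj n x) |x. x \<in> carrier (grp C n) \<and> bd C n x \<in> carrier (grp D (n - 1))}"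
proof -
  have "chain_complex.cycles (quot_cx C D) n = proj n ` {x \<in> carrier (grp C n). bd C n x \<in> carrier (grp D (n - 1))}"
    using cycle_quot_iff[of _ n] chain_complex.cycle_iff[OF chain_complex_quot, of _ n]
    by (auto simp: carrier_quot)
  then show ?thesis
    by (auto simp: chain_complex.carrier_homology_group[OF chain_complex_quot])
qed

text \<open>Two lifts of one class differ by \<open>h + bd b\<close> with \<open>h\<close> in
  \<open>D\<close>. Since \<open>bd bd b\<close> vanishes, their boundaries differ by
  \<open>bd h\<close>, which is a boundary of \<open>D\<close>.\<close>

lemma connecting_map_class:
  assumes c: "c \<in> carrier (grp C n)" "bd C n c \<in> carrier (grp D (n - 1))"
  shows "connecting_map C D n (homology_class (quot_cx C D) n (proj n c)) = homology_class D (n - 1) (bd C n c)"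
proof -
  interpret Q: chain_complex "quot_cx C D" by (rule chain_complex_quot)
  interpret D: chain_complex D by (rule chain_complex_sub)
  interpret Cn: comm_group "grp C n" by (rule comm_grp)
  interpret Cm: comm_group "grp C (n - 1)" by (rule comm_grp)
  have "homology_class D (n - 1) (bd C n c') = homology_class D (n - 1) (bd C n c)"
    if c': "c' \<in> carrier (grp C n)" "bd C n c' \<in> carrier (grp D (n - 1))"
      "homology_class (quot_cx C D) n (proj n c') = homology_class (quot_cx C D) n (proj n c)" for c'
  proof -
    have "\<exists>b\<in>carrier (grp (quot_cx C D) (n + 1)).
        proj n c' = bd (quot_cx C D) (n + 1) b \<otimes>\<^bsub>grp (quot_cx C D) n\<^esub> proj n c"
      using c'(3) c(1) c'(1) by (subst (asm) Q.homology_class_eq_iff) (auto simp: carrier_quot)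
    then obtain b where b: "b \<in> carrier (grp C (n + 1))"
      "proj n c' = bd (quot_cx C D) (n + 1) (proj (n + 1) b) \<otimes>\<^bsub>grp (quot_cx C D) n\<^esub> proj n c"
      by (auto simp: carrier_quot)
    have bb: "bd C (n + 1) b \<in> carrier (grp C n)" by (rule bd_Suc_closed[OF b(1)])
    have "proj n c' = proj n (bd C (n + 1) b \<otimes>\<^bsub>grp C n\<^esub> c)"
      using b bb c(1) bd_quot[OF b(1)] by (simp add: proj_mult)
    then obtain h where h: "h \<in> carrier (grp D n)" "c' = h \<otimes>\<^bsub>grp C n\<^esub> (bd C (n + 1) b \<otimes>\<^bsub>grp C n\<^esub> c)"
      using c'(1) c(1) bb by (subst (asm) proj_eq_iff) auto
    have "bd C n c' = bd C n h \<otimes>\<^bsub>grp C (n - 1)\<^esub> (bd C n (bd C (n + 1) b) \<otimes>\<^bsub>grp C (n - 1)\<^esub> bd C n c)"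
      using h bb c(1) sub_in[OF h(1)] bd_hom[of n] by (simp add: hom_mult)
    also have "\<dots> = bd C n h \<otimes>\<^bsub>grp C (n - 1)\<^esub> bd C n c"
      using bd_bd_Suc[OF b(1)] bd_closed[OF c(1)] by simp
    finally have "bd C n c' = bd D n h \<otimes>\<^bsub>grp D (n - 1)\<^esub> bd C n c" by (simp add: bd_sub mult_sub)
    then show ?thesis
      using D.homology_class_eq_iff[OF c'(2) c(2)] h(1) by simp blast
  qed
  then have "{homology_class D (n - 1) (bd C n c') | c'.
        c' \<in> carrier (grp C n) \<and> bd C n c' \<in> carrier (grp D (n - 1)) \<and>
        homology_class (quot_cx C D) n (carrier (grp D n) #>\<^bsub>grp C n\<^esub> c') =
        homology_class (quot_cx C D) n (proj n c)} = {homology_class D (n - 1) (bd C n c)}"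
    using c unfolding proj_def[symmetric] by blast
  then show ?thesis unfolding connecting_map_def by simp
qed

text \<open>In the application \<open>f\<close> is the chain map of an automorphism acting on the
  building; the second conclusion says that relative cycles go to relative cycles.\<close>

lemma quot_map_chain_map:
  assumes f: "\<And>n. f \<in> hom (grp C n) (grp C n)" "\<And>n. f ` carrier (grp D n) \<subseteq> carrier (grp D n)"
    and comm: "\<And>n x. x \<in> carrier (grp C n) \<Longrightarrow> f (bd C n x) = bd C n (f x)"
    and x: "x \<in> carrier (grp C n)" "bd C n x \<in> carrier (grp D (n - 1))"
  shows "homology_map (quot_cx C D) (quot_cx C D) n (quot_map C D n f)
      (homology_class (quot_cx C D) n (proj n x)) = homology_class (quot_cx C D) n (proj n (f x))"
    and "bd C n (f x) \<in> carrier (grp D (n - 1))"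
proof -
  have fp: "quot_map C D n f (proj n x) = proj n (f x)" if "x \<in> carrier (grp C n)" for x n
    using quot_map_coset[OF comm_grp sub comm_grp sub f that] by (simp add: proj_def)
  have fc: "f x \<in> carrier (grp C n)" if "x \<in> carrier (grp C n)" for x n
    using f(1)[of n] that by (auto simp: hom_def)
  have "quot_map C D n f (bd (quot_cx C D) (n + 1) b) \<in>
      bd (quot_cx C D) (n + 1) ` carrier (grp (quot_cx C D) (n + 1))"
    if "b \<in> carrier (grp (quot_cx C D) (n + 1))" for b
  proof -
    from that obtain y where y: "y \<in> carrier (grp C (n + 1))" "b = proj (n + 1) y"
      by (auto simp: carrier_quot)
    have "quot_map C D n f (bd (quot_cx C D) (n + 1) b) = proj n (f (bd C (n + 1) y))"
      using bd_quot[OF y(1)] bd_Suc_closed[OF y(1)] y by (simp add: fp)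
    also have "\<dots> = bd (quot_cx C D) (n + 1) (proj (n + 1) (f y))"
      using bd_quot[OF fc[OF y(1)]] comm[OF y(1)] by simp
    finally show ?thesis using fc[OF y(1)] by (simp add: carrier_quot)
  qed
  moreover have "quot_map C D n f \<in> hom (grp (quot_cx C D) n) (grp (quot_cx C D) n)"
    using quot_map_hom[OF comm_grp sub comm_grp sub f] by (simp add: grp_quot)
  ultimately show "homology_map (quot_cx C D) (quot_cx C D) n (quot_map C D n f)
      (homology_class (quot_cx C D) n (proj n x)) = homology_class (quot_cx C D) n (proj n (f x))"
    using homology_map_class[OF chain_complex_quot chain_complex_quot, of "quot_map C D n f" n "proj n x"]
      x fp[OF x(1)] by (simp add: carrier_quot)
  show "bd C n (f x) \<in> carrier (grp D (n - 1))"
    using f(2)[of "n - 1"] x comm[OF x(1)] by auto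
qed

end

text \<open>In the application \<open>C\<close> belongs to the building, \<open>D\<close> to the
  unstable simplices of the larger group and \<open>E\<close> to those of the smaller one.\<close>

locale nested_subcomplexes = chain_subcomplex C D + small: chain_subcomplex C E
  for C D E :: "'c chain_cx" +
  assumes nested: "carrier (grp E n) \<subseteq> carrier (grp D n)"
begin

abbreviation change :: "int \<Rightarrow> 'c set \<Rightarrow> 'c set" where
  "change n \<equiv> quot_map C D n (\<lambda>c. c)"

lemma change_proj: "x \<in> carrier (grp C n) \<Longrightarrow> change n (small.proj n x) = proj n x"
  using quot_map_coset[OF comm_grp small.sub comm_grp sub, of "\<lambda>c. c" n n x] nested[of n]
  by (simp add: proj_def small.proj_def hom_def)

lemma change_epi: "change n \<in> epi (grp (quot_cx C E) n) (grp (quot_cx C D) n)"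
proof -
  have "change n \<in> hom (grp (quot_cx C E) n) (grp (quot_cx C D) n)"
    using quot_map_hom[OF comm_grp small.sub comm_grp sub, of "\<lambda>c. c" n n] nested[of n]
    by (simp add: grp_quot small.grp_quot hom_def)
  moreover have "change n ` carrier (grp (quot_cx C E) n) = carrier (grp (quot_cx C D) n)"
    by (auto simp: carrier_quot small.carrier_quot change_proj image_image cong: image_cong)
  ultimately show ?thesis by (simp add: epi_def)
qed

lemma change_bd:
  assumes "c \<in> carrier (grp (quot_cx C E) n)"
  shows "change (n - 1) (bd (quot_cx C E) n c) = bd (quot_cx C D) n (change n c)"
  using assms by (auto simp: small.carrier_quot change_proj small.bd_quot bd_quot bd_closed)

lemma change_boundary:
  assumes "b \<in> carrier (grp (quot_cx C E) (n + 1))"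
  shows "change n (bd (quot_cx C E) (n + 1) b) \<in> bd (quot_cx C D) (n + 1) ` carrier (grp (quot_cx C D) (n + 1))"
  using change_bd[OF assms] change_epi[of "n + 1"] assms by (auto simp: epi_def hom_def)

lemma change_homology_class:
  assumes "x \<in> carrier (grp C n)"
  shows "homology_map (quot_cx C E) (quot_cx C D) n (change n) (homology_class (quot_cx C E) n (small.proj n x))
    = homology_class (quot_cx C D) n (proj n x)"
proof -
  have "change n \<in> hom (grp (quot_cx C E) n) (grp (quot_cx C D) n)"
    using change_epi by (simp add: epi_def)
  from homology_map_class[OF small.chain_complex_quot chain_complex_quot this change_boundary, of "small.proj n x"]
  show ?thesis using assms by (simp add: change_proj small.carrier_quot)
qed

lemma change_homology_hom:
  "homology_map (quot_cx C E) (quot_cx C D) n (change n)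
    \<in> hom (homology_group (quot_cx C E) n) (homology_group (quot_cx C D) n)"
proof (rule homology_map_hom[OF small.chain_complex_quot chain_complex_quot])
  show "change n (bd (quot_cx C E) (n + 1) b) \<in> bd (quot_cx C D) (n + 1) ` carrier (grp (quot_cx C D) (n + 1))"
    if "b \<in> carrier (grp (quot_cx C E) (n + 1))" for b
    using that by (rule change_boundary)
  show "change n \<in> hom (grp (quot_cx C E) n) (grp (quot_cx C D) n)"
    using change_epi by (simp add: epi_def)
  show "change n ` chain_complex.cycles (quot_cx C E) n \<subseteq> chain_complex.cycles (quot_cx C D) n"
  proof (rule image_subsetI)
    fix U assume U: "U \<in> chain_complex.cycles (quot_cx C E) n"
    then obtain x where x: "x \<in> carrier (grp C n)" "U = small.proj n x"
      by (auto simp: chain_complex.cycle_iff[OF small.chain_complex_quot] small.carrier_quot)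
    then show "change n U \<in> chain_complex.cycles (quot_cx C D) n"
      using U nested[of "n - 1"] by (auto simp: change_proj small.cycle_quot_iff cycle_quot_iff)
  qed
qed

end


section \<open>Oriented simplicial chains\<close>

lemma frag_extend_frag_extend:
  "frag_extend f (frag_extend g c) = frag_extend (\<lambda>x. frag_extend f (g x)) c"
  by (induction c rule: frag_induction[OF subset_UNIV]) (auto simp: frag_extend_diff)

lemma frag_extend_fun_diff: "frag_extend (\<lambda>x. f x - g x) c = frag_extend f c - frag_extend g c"
  by (induction c rule: frag_induction[OF subset_UNIV]) (auto simp: frag_extend_diff)

lemma lookup_frag_extend:
  "Poly_Mapping.lookup (frag_extend f c) x =
    (\<Sum>y\<in>Poly_Mapping.keys c. Poly_Mapping.lookup c y * Poly_Mapping.lookup (f y) x)"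
  by (simp add: frag_extend_def lookup_sum)

section \<open>Elementary chains as generators of the oriented chains\<close>

lemma permute_list_inj_on_perms:
  assumes "distinct vs" "p permutes {..<length vs}" "q permutes {..<length vs}"
    "permute_list p vs = permute_list q vs"
  shows "p = q"
proof
  fix i
  show "p i = q i"
  proof (cases "i < length vs")
    case True
    then have "p i < length vs" "q i < length vs"
      using permutes_in_image[OF assms(2), of i] permutes_in_image[OF assms(3), of i] by auto
    moreover have "vs ! p i = vs ! q i"
      using permute_list_nth[OF assms(2) True] permute_list_nth[OF assms(3) True] assms(4) by simp
    ultimately show ?thesis using assms(1) by (simp add: nth_eq_iff_index_eq)
  next
    case False
    then show ?thesis using assms(2,3) by (simp add: permutes_def)
  qed
qed

lemma permute_list_inv:
  assumes "p permutes {..<length vs}"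
  shows "permute_list (inv_into UNIV p) (permute_list p vs) = vs"
  using permute_list_compose[of "inv_into UNIV p" vs p] permutes_inv[OF assms] permutes_inv_o[OF assms] by simp

lemma lookup_oriented_simplex:
  "Poly_Mapping.lookup (oriented_simplex vs) ws =
    (\<Sum>p | p permutes {..<length vs}. sign p * (if permute_list p vs = ws then 1 else 0))"
  by (auto simp: oriented_simplex_def lookup_sum when_def lookup_single intro!: sum.cong)

lemma lookup_oriented_simplex_perm:
  assumes "distinct vs" "q permutes {..<length vs}"
  shows "Poly_Mapping.lookup (oriented_simplex vs) (permute_list q vs) = sign q"
proof -
  have "Poly_Mapping.lookup (oriented_simplex vs) (permute_list q vs) =
      (\<Sum>p | p permutes {..<length vs}. if p = q then sign p else 0)"
    unfolding lookup_oriented_simplex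
    by (rule sum.cong) (use permute_list_inj_on_perms[OF assms(1) _ assms(2)] in auto)
  also have "\<dots> = sign q"
    using assms(2) by (simp add: finite_permutations)
  finally show ?thesis .
qed

lemma keys_oriented_simplex:
  assumes "ws \<in> Poly_Mapping.keys (oriented_simplex vs)"
  shows "\<exists>p. p permutes {..<length vs} \<and> ws = permute_list p vs"
proof -
  have "ws \<in> (\<Union>p\<in>{p. p permutes {..<length vs}}.
      Poly_Mapping.keys (frag_cmul (sign p) (frag_of (permute_list p vs))))"
    using assms unfolding oriented_simplex_def by (rule subsetD[OF keys_sum])
  then show ?thesis by (auto simp: keys_frag_of)
qed

lemma oriented_simplex_permute:
  assumes "q permutes {..<length vs}"
  shows "oriented_simplex (permute_list q vs) = frag_cmul (sign q) (oriented_simplex vs)"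
proof -
  let ?S = "{p. p permutes {..<length vs}}"
  have bij: "bij_betw (\<lambda>p. q \<circ> p) ?S ?S"
    by (rule bij_betwI[where g = "\<lambda>p. inv_into UNIV q \<circ> p"])
      (use assms in \<open>auto simp: permutes_compose permutes_inv comp_assoc[symmetric] permutes_inv_o\<close>)
  have "frag_cmul (sign q) (oriented_simplex vs) =
      (\<Sum>p\<in>?S. frag_cmul (sign q * sign p) (frag_of (permute_list p vs)))"
    by (simp add: oriented_simplex_def frag_cmul_sum)
  also have "\<dots> = (\<Sum>p\<in>?S. frag_cmul (sign q * sign (q \<circ> p)) (frag_of (permute_list (q \<circ> p) vs)))"
    by (rule sum.reindex_bij_betw[OF bij, symmetric])
  also have "\<dots> = (\<Sum>p\<in>?S. frag_cmul (sign p) (frag_of (permute_list p (permute_list q vs))))"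
  proof (rule sum.cong[OF refl])
    fix p assume "p \<in> ?S"
    then have p: "p permutes {..<length vs}" by simp
    have "permutation p" "permutation q"
      using p assms by (auto simp: permutation_permutes)
    then have "sign q * sign (q \<circ> p) = sign p"
      by (simp add: sign_compose mult.assoc[symmetric] sign_idempotent)
    then show "frag_cmul (sign q * sign (q \<circ> p)) (frag_of (permute_list (q \<circ> p) vs)) =
        frag_cmul (sign p) (frag_of (permute_list p (permute_list q vs)))"
      using permute_list_compose[OF p] by simp
  qed
  finally show ?thesis by (simp add: oriented_simplex_def)
qed

text \<open>The integers have no 2-torsion. Every cancellation below is of this kind: a symmetry
  turns a chain into its negative.\<close>

lemma frag_eq_minus_imp_0: "(x :: 'a \<Rightarrow>\<^sub>0 int) = - x \<Longrightarrow> x = 0"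
proof (rule poly_mapping_eqI)
  fix k assume "x = - x"
  then have "Poly_Mapping.lookup x k = Poly_Mapping.lookup (- x) k" by simp
  then show "Poly_Mapping.lookup x k = Poly_Mapping.lookup 0 k" by simp
qed

text \<open>Swapping two equal entries fixes the list and reverses the sign. Degenerate lists
  therefore drop out when ordered chains are antisymmetrised.\<close>

lemma oriented_simplex_not_distinct:
  assumes "\<not> distinct vs"
  shows "oriented_simplex vs = 0"
proof -
  obtain i j where ij: "i < length vs" "j < length vs" "i \<noteq> j" "vs ! i = vs ! j"
    using assms by (auto simp: distinct_conv_nth)
  have p: "transpose i j permutes {..<length vs}"
    using ij by (intro permutes_swap_id) auto
  have "permute_list (transpose i j) vs = vs"
    by (rule nth_equalityI) (use ij in \<open>auto simp: permute_list_nth[OF p] transpose_def\<close>)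
  then have "oriented_simplex vs = - oriented_simplex vs"
    using oriented_simplex_permute[OF p] ij by (simp add: sign_swap_id)
  then show ?thesis by (rule frag_eq_minus_imp_0)
qed

definition ordered_simplices :: "'v set set \<Rightarrow> int \<Rightarrow> 'v list set" where
  "ordered_simplices Y n = {vs. distinct vs \<and> int (length vs) = n + 1 \<and> (vs = [] \<or> set vs \<in> Y)}"

lemma ordered_simplices_permute:
  assumes "vs \<in> ordered_simplices Y n" "p permutes {..<length vs}"
  shows "permute_list p vs \<in> ordered_simplices Y n"
  using assms by (auto simp: ordered_simplices_def)

lemma oriented_chains_altdef:
  "oriented_chains Y n = {c. Poly_Mapping.keys c \<subseteq> ordered_simplices Y n \<and>
     (\<forall>vs p. p permutes {..<length vs} \<longrightarrow>
        Poly_Mapping.lookup c (permute_list p vs) = sign p * Poly_Mapping.lookup c vs)}"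
  by (auto simp: oriented_chains_def ordered_simplices_def)

lemma oriented_chains_zero: "0 \<in> oriented_chains Y n"
  by (simp add: oriented_chains_altdef)

lemma oriented_chains_add:
  "c \<in> oriented_chains Y n \<Longrightarrow> d \<in> oriented_chains Y n \<Longrightarrow> c + d \<in> oriented_chains Y n"
  using keys_add[of c d] by (auto simp: oriented_chains_altdef lookup_add algebra_simps)

lemma oriented_chains_minus: "c \<in> oriented_chains Y n \<Longrightarrow> - c \<in> oriented_chains Y n"
  by (auto simp: oriented_chains_altdef)

lemma oriented_chains_diff:
  "c \<in> oriented_chains Y n \<Longrightarrow> d \<in> oriented_chains Y n \<Longrightarrow> c - d \<in> oriented_chains Y n"
  using oriented_chains_add[OF _ oriented_chains_minus] by fastforce

lemma oriented_simplex_in: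
  fixes vs :: "'v list"
  assumes "vs \<in> ordered_simplices Y n"
  shows "oriented_simplex vs \<in> oriented_chains Y n"
  unfolding oriented_chains_altdef
proof (intro CollectI conjI allI impI subsetI)
  fix ws assume "ws \<in> Poly_Mapping.keys (oriented_simplex vs)"
  then show "ws \<in> ordered_simplices Y n"
    using keys_oriented_simplex ordered_simplices_permute[OF assms] by blast
next
  fix ws :: "'v list" and r :: "nat \<Rightarrow> nat" assume r: "r permutes {..<length ws}"
  let ?S = "{p. p permutes {..<length vs}}"
  show "Poly_Mapping.lookup (oriented_simplex vs) (permute_list r ws) =
      sign r * Poly_Mapping.lookup (oriented_simplex vs) ws"
  proof (cases "length ws = length vs")
    case True
    have bij: "bij_betw (\<lambda>p. p \<circ> r) ?S ?S"
      by (rule bij_betwI[where g = "\<lambda>p. p \<circ> inv_into UNIV r"])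
        (use r True in \<open>auto simp: permutes_compose permutes_inv comp_assoc permutes_inv_o\<close>)
    have "Poly_Mapping.lookup (oriented_simplex vs) (permute_list r ws) =
      (\<Sum>p\<in>?S. sign (p \<circ> r) * (if permute_list (p \<circ> r) vs = permute_list r ws then 1 else 0))"
      unfolding lookup_oriented_simplex by (rule sum.reindex_bij_betw[OF bij, symmetric])
    also have "\<dots> = (\<Sum>p\<in>?S. sign r * (sign p * (if permute_list p vs = ws then 1 else 0)))"
    proof (rule sum.cong[OF refl])
      fix p assume "p \<in> ?S"
      then have p: "p permutes {..<length vs}" by simp
      have "permutation p" "permutation r"
        using p r by (auto simp: permutation_permutes)
      then have "sign (p \<circ> r) = sign r * sign p" by (simp add: sign_compose)
      moreover have "permute_list (p \<circ> r) vs = permute_list r (permute_list p vs)"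
        using permute_list_compose[of r vs p] r True by simp
      moreover have "permute_list p vs = ws" if "permute_list r (permute_list p vs) = permute_list r ws"
      proof -
        have "permute_list (inv_into UNIV r) (permute_list r (permute_list p vs)) = permute_list p vs"
          using r True by (intro permute_list_inv) simp
        then show ?thesis unfolding that permute_list_inv[OF r] by (rule sym)
      qed
      then have "permute_list r (permute_list p vs) = permute_list r ws \<longleftrightarrow> permute_list p vs = ws"
        by blast
      ultimately show "sign (p \<circ> r) * (if permute_list (p \<circ> r) vs = permute_list r ws then 1 else 0) =
          sign r * (sign p * (if permute_list p vs = ws then 1 else 0))"
        by simp
    qed
    finally show ?thesis by (simp add: lookup_oriented_simplex sum_distrib_left)
  next
    case False
    have "permute_list p vs \<noteq> ws" "permute_list p vs \<noteq> permute_list r ws" for p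
      using False by (metis length_permute_list)+
    then show ?thesis by (simp add: lookup_oriented_simplex)
  qed
qed

lemma oriented_chains_extend:
  assumes "\<And>x. x \<in> Poly_Mapping.keys y \<Longrightarrow> f x \<in> oriented_chains Y n"
  shows "frag_extend f y \<in> oriented_chains Y n"
proof -
  have "Poly_Mapping.keys y \<subseteq> {x. f x \<in> oriented_chains Y n}" using assms by auto
  then show ?thesis
    by (induction y rule: frag_induction)
      (auto simp: frag_extend_diff oriented_chains_zero oriented_chains_diff)
qed

lemma frag_extend_oriented_simplex_in:
  "Poly_Mapping.keys y \<subseteq> ordered_simplices Y n \<Longrightarrow> frag_extend oriented_simplex y \<in> oriented_chains Y n"
  by (rule oriented_chains_extend) (auto intro: oriented_simplex_in)

text \<open>Used with a \<open>Q\<close> that selects one ordering of each simplex; it then undoes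
  the antisymmetrisation \<open>frag_extend oriented_simplex\<close>.\<close>

definition restrict_frag :: "('a \<Rightarrow> bool) \<Rightarrow> ('a \<Rightarrow>\<^sub>0 int) \<Rightarrow> ('a \<Rightarrow>\<^sub>0 int)" where
  "restrict_frag Q = frag_extend (\<lambda>x. if Q x then frag_of x else 0)"

lemma lookup_restrict_frag:
  "Poly_Mapping.lookup (restrict_frag Q c) x = (if Q x then Poly_Mapping.lookup c x else 0)"
proof -
  have "Poly_Mapping.lookup (restrict_frag Q c) x =
      (\<Sum>y\<in>Poly_Mapping.keys c. if y = x then (if Q x then Poly_Mapping.lookup c x else 0) else 0)"
    unfolding restrict_frag_def lookup_frag_extend by (rule sum.cong) (auto simp: lookup_single)
  also have "\<dots> = (if Q x then Poly_Mapping.lookup c x else 0)"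
    by (auto simp: sum.delta in_keys_iff)
  finally show ?thesis .
qed

lemma keys_restrict_frag: "Poly_Mapping.keys (restrict_frag Q c) = {x \<in> Poly_Mapping.keys c. Q x}"
  by (auto simp: in_keys_iff lookup_restrict_frag split: if_splits)

lemma restrict_oriented_simplex:
  assumes "distinct vs" "Q vs" "\<And>p. p permutes {..<length vs} \<Longrightarrow> Q (permute_list p vs) \<Longrightarrow> p = id"
  shows "restrict_frag Q (oriented_simplex vs) = frag_of vs"
proof (rule poly_mapping_eqI)
  fix ws
  show "Poly_Mapping.lookup (restrict_frag Q (oriented_simplex vs)) ws = Poly_Mapping.lookup (frag_of vs) ws"
  proof (cases "ws = vs")
    case True
    then show ?thesis
      using lookup_oriented_simplex_perm[OF assms(1), of id] assms(2)
      by (simp add: lookup_restrict_frag permutes_id)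
  next
    case False
    have "ws \<notin> Poly_Mapping.keys (oriented_simplex vs)" if "Q ws"
      using keys_oriented_simplex[of ws vs] assms(3) that False permute_list_id by metis
    then show ?thesis
      using False by (auto simp: lookup_restrict_frag lookup_single in_keys_iff)
  qed
qed

text \<open>Both sides are alternating, hence determined by their values on the ordering that
  \<open>Q\<close> selects for each simplex, and there they agree by
  \<open>restrict_oriented_simplex\<close>.\<close>

lemma oriented_chain_eq_extend_restrict:
  assumes c: "c \<in> oriented_chains Y n"
    and Q: "\<And>ws. ws \<in> ordered_simplices Y n \<Longrightarrow> \<exists>p. p permutes {..<length ws} \<and> Q (permute_list p ws)"
    and uniq: "\<And>vs p. vs \<in> ordered_simplices Y n \<Longrightarrow> Q vs \<Longrightarrow> p permutes {..<length vs} \<Longrightarrow>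
      Q (permute_list p vs) \<Longrightarrow> p = id"
  shows "frag_extend oriented_simplex (restrict_frag Q c) = c" (is "?d = c")
proof -
  have keys: "Poly_Mapping.keys c \<subseteq> ordered_simplices Y n"
    using c by (simp add: oriented_chains_altdef)
  then have d: "?d \<in> oriented_chains Y n"
    by (intro frag_extend_oriented_simplex_in) (auto simp: keys_restrict_frag)
  have agree: "Poly_Mapping.lookup ?d vs = Poly_Mapping.lookup c vs"
    if "vs \<in> ordered_simplices Y n" "Q vs" for vs
  proof -
    have "restrict_frag Q ?d = frag_extend (\<lambda>x. restrict_frag Q (oriented_simplex x)) (restrict_frag Q c)"
      unfolding restrict_frag_def by (simp add: frag_extend_frag_extend)
    also have "\<dots> = frag_extend frag_of (restrict_frag Q c)"
      by (rule frag_extend_eq)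
        (use keys uniq in \<open>auto simp: keys_restrict_frag ordered_simplices_def intro!: restrict_oriented_simplex\<close>)
    also have "\<dots> = restrict_frag Q c" by (rule frag_expansion[symmetric])
    finally have "Poly_Mapping.lookup (restrict_frag Q ?d) vs = Poly_Mapping.lookup (restrict_frag Q c) vs"
      by simp
    then show ?thesis using that(2) by (simp add: lookup_restrict_frag)
  qed
  show ?thesis
  proof (rule poly_mapping_eqI)
    fix ws
    show "Poly_Mapping.lookup ?d ws = Poly_Mapping.lookup c ws"
    proof (cases "ws \<in> ordered_simplices Y n")
      case True
      then obtain p where p: "p permutes {..<length ws}" "Q (permute_list p ws)" using Q by blast
      have "sign p * Poly_Mapping.lookup ?d ws = sign p * Poly_Mapping.lookup c ws"
        using agree[OF ordered_simplices_permute[OF True p(1)] p(2)] d c p(1)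
        by (simp add: oriented_chains_altdef)
      then show ?thesis by simp
    next
      case False
      then have "ws \<notin> Poly_Mapping.keys ?d" "ws \<notin> Poly_Mapping.keys c"
        using c d by (auto simp: oriented_chains_altdef)
      then show ?thesis by (simp add: in_keys_iff)
    qed
  qed
qed

lemma mset_eq_permute_list:
  assumes "distinct ws" "distinct vs" "set ws = set vs"
  shows "\<exists>p. p permutes {..<length ws} \<and> permute_list p ws = vs"
proof -
  have "mset vs = mset ws" using assms by (simp add: set_eq_iff_mset_eq_distinct)
  from mset_eq_permutation[OF this] show ?thesis by blast
qed

text \<open>Any choice of one ordering per vertex set serves as \<open>Q\<close>. The result reduces
  identities between linear operators on oriented chains to elementary chains.\<close>

lemma oriented_chains_span:
  assumes c: "c \<in> oriented_chains Y n"
  obtains y where "Poly_Mapping.keys y \<subseteq> ordered_simplices Y n" "c = frag_extend oriented_simplex y"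
proof -
  define rep where "rep s = (SOME vs. distinct vs \<and> set vs = s)" for s :: "'a set"
  have rep: "distinct (rep (set vs))" "set (rep (set vs)) = set vs" if "distinct vs" for vs :: "'a list"
    using someI[of "\<lambda>ws. distinct ws \<and> set ws = set vs" vs] that by (auto simp: rep_def)
  let ?Q = "\<lambda>vs. vs = rep (set vs)"
  have "frag_extend oriented_simplex (restrict_frag ?Q c) = c"
  proof (rule oriented_chain_eq_extend_restrict[OF c])
    fix ws assume "ws \<in> ordered_simplices Y n"
    then have d: "distinct ws" by (simp add: ordered_simplices_def)
    from mset_eq_permute_list[OF d rep(1)[OF d]] rep(2)[OF d]
    obtain p where "p permutes {..<length ws}" "permute_list p ws = rep (set ws)" by auto
    moreover from this rep(2)[OF d] have "rep (set (permute_list p ws)) = rep (set ws)"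
      by (simp only: set_permute_list)
    ultimately show "\<exists>p. p permutes {..<length ws} \<and> ?Q (permute_list p ws)" by metis
  next
    fix vs p assume vs: "vs \<in> ordered_simplices Y n" "?Q vs" "p permutes {..<length vs}" "?Q (permute_list p vs)"
    then have "permute_list p vs = permute_list id vs"
      by (metis set_permute_list permute_list_id)
    then show "p = id"
      using vs by (intro permute_list_inj_on_perms) (auto simp: ordered_simplices_def permutes_id)
  qed
  moreover have "Poly_Mapping.keys (restrict_frag ?Q c) \<subseteq> ordered_simplices Y n"
    using c by (auto simp: keys_restrict_frag oriented_chains_altdef)
  ultimately show ?thesis using that by metis
qed

text \<open>The alternating sum over the faces, in the cone form d(v c) = c - v dc, which suits
  induction on the list. A single vertex goes to the empty list; this is the augmentation.\<close>

fun ordered_boundary :: "'v list \<Rightarrow> ('v list \<Rightarrow>\<^sub>0 int)" where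
  "ordered_boundary [] = 0"
| "ordered_boundary (v # vs) = frag_of vs - frag_extend (\<lambda>ws. frag_of (v # ws)) (ordered_boundary vs)"

lemma ordered_boundary_sum:
  "ordered_boundary vs = (\<Sum>i<length vs. frag_cmul ((-1) ^ i) (frag_of (take i vs @ drop (Suc i) vs)))"
proof (induction vs)
  case (Cons v vs)
  have "ordered_boundary (v # vs) = frag_of vs -
      (\<Sum>i<length vs. frag_cmul ((-1) ^ i) (frag_of (v # (take i vs @ drop (Suc i) vs))))"
    by (simp add: Cons.IH frag_extend_sum o_def frag_extend_cmul)
  also have "\<dots> = (\<Sum>i<length (v # vs). frag_cmul ((-1) ^ i) (frag_of (take i (v # vs) @ drop (Suc i) (v # vs))))"
    by (simp add: sum.lessThan_Suc_shift sum_negf[symmetric] del: sum.lessThan_Suc)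
  finally show ?case .
qed simp

lemma simplicial_boundary_oriented_simplex:
  "simplicial_boundary (oriented_simplex vs) = frag_extend oriented_simplex (ordered_boundary vs)"
  by (simp add: boundary_oriented_simplex ordered_boundary_sum frag_extend_sum o_def frag_extend_cmul)

text \<open>This lets homotopies be computed with ordered chains, where repeated vertices are
  allowed, and then be carried over by antisymmetrisation.\<close>

lemma simplicial_boundary_extend:
  "simplicial_boundary (frag_extend oriented_simplex y) =
    frag_extend oriented_simplex (frag_extend ordered_boundary y)"
proof -
  have "simplicial_boundary (frag_extend oriented_simplex y) =
      frag_extend (\<lambda>x. simplicial_boundary (oriented_simplex x)) y"
    unfolding simplicial_boundary_def by (simp add: frag_extend_frag_extend)
  then show ?thesis by (simp add: simplicial_boundary_oriented_simplex frag_extend_frag_extend)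
qed

lemma ordered_boundary_Cons_extend:
  "frag_extend ordered_boundary (frag_extend (\<lambda>ws. frag_of (v # ws)) c) =
    c - frag_extend (\<lambda>ws. frag_of (v # ws)) (frag_extend ordered_boundary c)"
  by (simp add: frag_extend_frag_extend frag_extend_fun_diff flip: frag_expansion)

lemma ordered_boundary_boundary: "frag_extend ordered_boundary (ordered_boundary vs) = 0"
  by (induction vs) (simp_all add: frag_extend_diff ordered_boundary_Cons_extend)

lemma keys_ordered_boundary:
  assumes "ws \<in> Poly_Mapping.keys (ordered_boundary vs)"
  shows "\<exists>i<length vs. ws = take i vs @ drop (Suc i) vs"
proof -
  have "ws \<in> (\<Union>i\<in>{..<length vs}.
      Poly_Mapping.keys (frag_cmul ((-1) ^ i) (frag_of (take i vs @ drop (Suc i) vs))))"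
    using assms unfolding ordered_boundary_sum by (rule subsetD[OF keys_sum])
  then show ?thesis by (auto simp: keys_frag_of)
qed

definition face_closed :: "'v set set \<Rightarrow> bool" where
  "face_closed Y \<longleftrightarrow> (\<forall>s\<in>Y. \<forall>t. t \<subseteq> s \<longrightarrow> t \<noteq> {} \<longrightarrow> t \<in> Y)"

lemma ordered_simplices_face:
  assumes "face_closed Y" "vs \<in> ordered_simplices Y n" "i < length vs"
  shows "take i vs @ drop (Suc i) vs \<in> ordered_simplices Y (n - 1)"
proof -
  have d: "distinct (take i vs @ vs ! i # drop (Suc i) vs)"
    using assms(2,3) id_take_nth_drop[OF assms(3)] by (simp add: ordered_simplices_def)
  have sub: "set (take i vs @ drop (Suc i) vs) \<subseteq> set vs"
    by (auto dest: in_set_takeD in_set_dropD)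
  have "vs \<noteq> []" using assms(3) by auto
  then have "set vs \<in> Y" using assms(2) by (simp add: ordered_simplices_def)
  then have "set (take i vs @ drop (Suc i) vs) \<in> Y" if "take i vs @ drop (Suc i) vs \<noteq> []"
    using assms(1) sub that unfolding face_closed_def by (metis set_empty)
  then show ?thesis
    using d assms(2,3) by (auto simp: ordered_simplices_def)
qed

lemma simplicial_boundary_add:
  "simplicial_boundary (c + d) = simplicial_boundary c + simplicial_boundary d"
  by (simp add: simplicial_boundary_def frag_extend_add)

lemma simplicial_boundary_closed:
  assumes "face_closed Y" "c \<in> oriented_chains Y n"
  shows "simplicial_boundary c \<in> oriented_chains Y (n - 1)"
proof -
  obtain y where y: "Poly_Mapping.keys y \<subseteq> ordered_simplices Y n" "c = frag_extend oriented_simplex y"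
    using oriented_chains_span[OF assms(2)] .
  show ?thesis
    unfolding y(2) simplicial_boundary_extend frag_extend_frag_extend[of oriented_simplex ordered_boundary]
  proof (intro oriented_chains_extend)
    fix vs ws assume "vs \<in> Poly_Mapping.keys y" "ws \<in> Poly_Mapping.keys (ordered_boundary vs)"
    then show "oriented_simplex ws \<in> oriented_chains Y (n - 1)"
      using y(1) ordered_simplices_face[OF assms(1)] keys_ordered_boundary oriented_simplex_in by blast
  qed
qed

lemma simplicial_boundary_boundary:
  assumes "c \<in> oriented_chains Y n"
  shows "simplicial_boundary (simplicial_boundary c) = 0"
  using oriented_chains_span[OF assms]
  by (metis simplicial_boundary_extend frag_extend_frag_extend ordered_boundary_boundary
      frag_extend_eq_0 frag_extend_0)

lemma grp_chain_complex_of: "grp (chain_complex_of Y) n = (free_Abelian_group UNIV)\<lparr>carrier := oriented_chains Y n\<rparr>"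
  and bd_chain_complex_of [simp]: "bd (chain_complex_of Y) n = simplicial_boundary"
  by (simp_all add: chain_complex_of_def)

lemma carrier_chain_complex_of [simp]: "carrier (grp (chain_complex_of Y) n) = oriented_chains Y n"
  and mult_chain_complex_of [simp]: "x \<otimes>\<^bsub>grp (chain_complex_of Y) n\<^esub> y = x + y"
  and one_chain_complex_of [simp]: "\<one>\<^bsub>grp (chain_complex_of Y) n\<^esub> = 0"
  by (simp_all add: chain_complex_of_def)

lemma subgroup_oriented_chains: "subgroup (oriented_chains Y n) (free_Abelian_group UNIV)"
  by (rule subgroup.intro) (auto simp: oriented_chains_zero oriented_chains_add oriented_chains_minus)

lemma chain_complex_chain_complex_of:
  assumes "face_closed Y"
  shows "chain_complex (chain_complex_of Y)"
proof (rule chain_complex.intro)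
  fix n
  have "Group.group (grp (chain_complex_of Y) n)"
    unfolding grp_chain_complex_of
    by (rule group.subgroup_imp_group[OF group_free_Abelian_group subgroup_oriented_chains])
  then show "comm_group (grp (chain_complex_of Y) n)"
    by (rule group.group_comm_groupI) (simp add: add.commute)
  show "bd (chain_complex_of Y) n \<in> hom (grp (chain_complex_of Y) n) (grp (chain_complex_of Y) (n - 1))"
    using simplicial_boundary_closed[OF assms] by (auto simp: hom_def simplicial_boundary_add)
qed (simp add: simplicial_boundary_boundary)

lemma oriented_chains_mono: "Y \<subseteq> Y' \<Longrightarrow> oriented_chains Y n \<subseteq> oriented_chains Y' n"
  by (auto simp: oriented_chains_altdef ordered_simplices_def)

lemma chain_subcomplex_chain_complex_of:
  assumes "face_closed Y" "face_closed Y'" "Y' \<subseteq> Y"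
  shows "chain_subcomplex (chain_complex_of Y) (chain_complex_of Y')"
proof (rule chain_subcomplex.intro[OF chain_complex_chain_complex_of[OF assms(1)]], rule chain_subcomplex_axioms.intro)
  fix n
  interpret chain_complex "chain_complex_of Y" by (rule chain_complex_chain_complex_of[OF assms(1)])
  interpret G: comm_group "grp (chain_complex_of Y) n" by (rule comm_grp)
  show "subgroup (carrier (grp (chain_complex_of Y') n)) (grp (chain_complex_of Y) n)"
  proof (rule G.subgroupI)
    fix a assume a: "a \<in> carrier (grp (chain_complex_of Y') n)"
    then have "a \<in> oriented_chains Y n" using oriented_chains_mono[OF assms(3)] by auto
    then have "inv\<^bsub>grp (chain_complex_of Y) n\<^esub> a = - a"
      by (intro G.inv_equality) (auto simp: oriented_chains_minus)
    then show "inv\<^bsub>grp (chain_complex_of Y) n\<^esub> a \<in> carrier (grp (chain_complex_of Y') n)"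
      using a by (simp add: oriented_chains_minus)
  qed (use oriented_chains_mono[OF assms(3)] oriented_chains_zero[of Y' n] in \<open>auto simp: oriented_chains_add\<close>)
qed (simp_all add: simplicial_boundary_closed[OF assms(2)] grp_chain_complex_of)

section \<open>Chain maps induced by maps of vertices\<close>

lemma map_permute_list_distinct:
  assumes "p permutes {..<length vs}"
  shows "distinct (map f (permute_list p vs)) \<longleftrightarrow> distinct (map f vs)"
  using assms permute_list_map[of p vs f] distinct_permute_list[of p "map f vs"] by simp

text \<open>If \<open>f\<close> identifies two vertices, the left side vanishes by definition and
  the right side by \<open>oriented_simplex_not_distinct\<close>; afterwards collapsed simplices
  need no separate case.\<close>

lemma simplicial_chain_map_oriented_simplex:
  "simplicial_chain_map f (oriented_simplex vs) = oriented_simplex (map f vs)"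
proof -
  have "simplicial_chain_map f (oriented_simplex vs) = (\<Sum>p | p permutes {..<length vs}.
      frag_cmul (sign p) (if distinct (map f vs) then frag_of (permute_list p (map f vs)) else 0))"
    unfolding simplicial_chain_map_def oriented_simplex_def
    by (subst frag_extend_sum) (auto simp: finite_permutations frag_extend_cmul map_permute_list_distinct
        permute_list_map intro!: sum.cong)
  also have "\<dots> = oriented_simplex (map f vs)"
  proof (cases "distinct (map f vs)")
    case True
    then show ?thesis by (simp only: if_True oriented_simplex_def length_map)
  next
    case False
    then show ?thesis
      by (simp only: False if_False frag_cmul_zero2 sum.neutral_const oriented_simplex_not_distinct)
  qed
  finally show ?thesis .
qed

lemma simplicial_chain_map_extend:
  "simplicial_chain_map f (frag_extend oriented_simplex y) = frag_extend (\<lambda>vs. oriented_simplex (map f vs)) y"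
proof -
  have "simplicial_chain_map f (frag_extend oriented_simplex y) =
      frag_extend (\<lambda>x. simplicial_chain_map f (oriented_simplex x)) y"
    unfolding simplicial_chain_map_def by (simp add: frag_extend_frag_extend)
  then show ?thesis by (simp add: simplicial_chain_map_oriented_simplex)
qed

lemma simplicial_chain_map_add:
  "simplicial_chain_map f (c + d) = simplicial_chain_map f c + simplicial_chain_map f d"
  by (simp add: simplicial_chain_map_def frag_extend_add)

lemma simplicial_chain_map_closed:
  assumes "\<And>s. s \<in> Y \<Longrightarrow> f ` s \<in> Y'" "c \<in> oriented_chains Y n"
  shows "simplicial_chain_map f c \<in> oriented_chains Y' n"
proof -
  obtain y where y: "Poly_Mapping.keys y \<subseteq> ordered_simplices Y n" "c = frag_extend oriented_simplex y"
    using oriented_chains_span[OF assms(2)] .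
  show ?thesis unfolding y(2) simplicial_chain_map_extend
  proof (rule oriented_chains_extend)
    fix vs assume "vs \<in> Poly_Mapping.keys y"
    then have vs: "vs \<in> ordered_simplices Y n" using y(1) by auto
    show "oriented_simplex (map f vs) \<in> oriented_chains Y' n"
    proof (cases "distinct (map f vs)")
      case True
      then show ?thesis
        using vs assms(1) by (intro oriented_simplex_in) (auto simp: ordered_simplices_def)
    next
      case False
      show ?thesis unfolding oriented_simplex_not_distinct[OF False] by (rule oriented_chains_zero)
    qed
  qed
qed

lemma ordered_boundary_map:
  "ordered_boundary (map f vs) = frag_extend (\<lambda>ws. frag_of (map f ws)) (ordered_boundary vs)"
  by (induction vs) (simp_all add: frag_extend_diff frag_extend_frag_extend)

lemma simplicial_boundary_chain_map:
  assumes "c \<in> oriented_chains Y n"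
  shows "simplicial_chain_map f (simplicial_boundary c) = simplicial_boundary (simplicial_chain_map f c)"
proof -
  obtain y where y: "Poly_Mapping.keys y \<subseteq> ordered_simplices Y n" "c = frag_extend oriented_simplex y"
    using oriented_chains_span[OF assms] .
  have "simplicial_boundary (simplicial_chain_map f c) =
      frag_extend (\<lambda>x. simplicial_boundary (oriented_simplex (map f x))) y"
    unfolding y(2) simplicial_chain_map_extend simplicial_boundary_def by (simp add: frag_extend_frag_extend)
  also have "\<dots> = frag_extend (\<lambda>x. frag_extend (\<lambda>vs. oriented_simplex (map f vs)) (ordered_boundary x)) y"
    by (simp add: simplicial_boundary_oriented_simplex ordered_boundary_map frag_extend_frag_extend)
  also have "\<dots> = simplicial_chain_map f (simplicial_boundary c)"
    unfolding y(2) simplicial_boundary_extend simplicial_chain_map_extend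
    by (simp add: frag_extend_frag_extend)
  finally show ?thesis ..
qed

text \<open>Reindexing by the swap of positions i and i + 1 leaves \<open>F\<close> unchanged and
  reverses the coefficients of the alternating chain, so the sum equals its negative. The bound on
  \<open>i\<close> keeps both positions inside lists of length \<open>n + 1\<close>.\<close>

lemma oriented_chain_cancel:
  assumes c: "c \<in> oriented_chains Y n"
    and F: "\<And>vs. vs \<in> ordered_simplices Y n \<Longrightarrow>
      F (permute_list (transpose i (Suc i)) vs) = (F vs :: 'b \<Rightarrow>\<^sub>0 int)"
    and i: "int i < n"
  shows "frag_extend F c = 0"
proof -
  let ?t = "permute_list (transpose i (Suc i))"
  let ?K = "Poly_Mapping.keys c"
  have keys: "?K \<subseteq> ordered_simplices Y n"
    using c by (simp add: oriented_chains_altdef)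
  have perm: "transpose i (Suc i) permutes {..<length vs}" if "vs \<in> ordered_simplices Y n" for vs
    using that i by (intro permutes_swap_id) (auto simp: ordered_simplices_def)
  have sgn: "Poly_Mapping.lookup c (?t vs) = - Poly_Mapping.lookup c vs" if "vs \<in> ordered_simplices Y n" for vs
    using c perm[OF that] by (simp add: oriented_chains_altdef sign_swap_id)
  have mem: "?t vs \<in> ?K" if "vs \<in> ?K" for vs
  proof -
    have "Poly_Mapping.lookup c (?t vs) \<noteq> 0" using sgn[of vs] that keys by (auto simp: in_keys_iff)
    then show ?thesis by (simp add: in_keys_iff)
  qed
  have invol: "?t (?t vs) = vs" if "vs \<in> ?K" for vs
    using permute_list_compose[of "transpose i (Suc i)" vs "transpose i (Suc i)"] perm[of vs] that keys
    by auto
  have bij: "bij_betw ?t ?K ?K"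
    by (rule bij_betwI[where g = ?t]) (use mem invol in auto)
  have "frag_extend F c = (\<Sum>vs\<in>?K. frag_cmul (Poly_Mapping.lookup c (?t vs)) (F (?t vs)))"
    unfolding frag_extend_def by (rule sum.reindex_bij_betw[OF bij, symmetric])
  also have "\<dots> = (\<Sum>vs\<in>?K. - frag_cmul (Poly_Mapping.lookup c vs) (F vs))"
    by (rule sum.cong[OF refl]) (use keys sgn F in auto)
  also have "\<dots> = - frag_extend F c"
    by (simp only: frag_extend_def sum_negf)
  finally show ?thesis by (rule frag_eq_minus_imp_0)
qed


section \<open>Homotopies of poset maps\<close>

locale poset =
  fixes ord :: "'a \<Rightarrow> 'a \<Rightarrow> bool"
  assumes ord_refl: "ord x x"
    and ord_antisym: "ord x y \<Longrightarrow> ord y x \<Longrightarrow> x = y"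
    and ord_trans: "ord x y \<Longrightarrow> ord y z \<Longrightarrow> ord x z"
begin

text \<open>The increasing enumeration is the canonical ordering of a simplex of the order complex,
  and serves as the selection for \<open>restrict_frag\<close>.\<close>

definition strict_chain :: "'a list \<Rightarrow> bool" where
  "strict_chain = sorted_wrt (\<lambda>x y. ord x y \<and> x \<noteq> y)"

lemma strict_chain_Cons: "strict_chain (v # vs) \<longleftrightarrow> (\<forall>x\<in>set vs. ord v x \<and> v \<noteq> x) \<and> strict_chain vs"
  by (simp add: strict_chain_def)

lemma strict_chain_distinct: "strict_chain vs \<Longrightarrow> distinct vs"
  by (induction vs) (auto simp: strict_chain_Cons)

lemma strict_chain_sorted: "strict_chain vs \<Longrightarrow> sorted_wrt ord vs"
  unfolding strict_chain_def by (rule sorted_wrt_mono_rel) auto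

lemma strict_chain_unique: "strict_chain vs \<Longrightarrow> strict_chain ws \<Longrightarrow> set vs = set ws \<Longrightarrow> vs = ws"
proof (induction vs arbitrary: ws)
  case (Cons v vs)
  then obtain w ws' where ws: "ws = w # ws'" by (cases ws) auto
  have "v = w"
  proof (rule ccontr)
    assume "v \<noteq> w"
    then have "v \<in> set ws'" "w \<in> set vs" using Cons.prems(3) ws by auto
    then have "ord w v" "ord v w" using Cons.prems ws by (auto simp: strict_chain_Cons)
    then show False using ord_antisym \<open>v \<noteq> w\<close> by blast
  qed
  moreover have "set vs = set ws'"
  proof -
    have "v \<notin> set vs" "w \<notin> set ws'" using Cons.prems ws by (auto simp: strict_chain_Cons)
    then show ?thesis using Cons.prems(3) ws \<open>v = w\<close> by auto
  qed
  ultimately show ?case using Cons ws by (auto simp: strict_chain_Cons)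
qed simp

lemma strict_chain_exists:
  assumes "finite s" "Complete_Partial_Order.chain ord s"
  shows "\<exists>vs. strict_chain vs \<and> set vs = s"
  using assms
proof (induction s rule: finite_induct)
  case empty
  show ?case by (auto simp: strict_chain_def)
next
  case (insert x s)
  then obtain vs where vs: "strict_chain vs" "set vs = s"
    by (auto simp: Complete_Partial_Order.chain_def)
  \<comment> \<open>The new element goes between the elements below it and the rest, which lie above
    it because the set is a chain.\<close>
  let ?ws = "filter (\<lambda>y. ord y x) vs @ x # filter (\<lambda>y. \<not> ord y x) vs"
  have above: "ord x y \<and> x \<noteq> y" if "y \<in> s" "\<not> ord y x" for y
    using insert.prems insert.hyps that ord_refl by (auto simp: Complete_Partial_Order.chain_def)
  have "strict_chain ?ws"
    unfolding strict_chain_def sorted_wrt_append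
  proof (intro conjI ballI)
    show "sorted_wrt (\<lambda>x y. ord x y \<and> x \<noteq> y) (filter (\<lambda>y. ord y x) vs)"
      using vs by (auto simp: strict_chain_def intro: sorted_wrt_filter)
    show "sorted_wrt (\<lambda>x y. ord x y \<and> x \<noteq> y) (x # filter (\<lambda>y. \<not> ord y x) vs)"
      using vs above by (auto simp: strict_chain_def intro: sorted_wrt_filter)
    fix a b assume "a \<in> set (filter (\<lambda>y. ord y x) vs)" "b \<in> set (x # filter (\<lambda>y. \<not> ord y x) vs)"
    then have ab: "a \<in> s" "ord a x" "b = x \<or> b \<in> s \<and> \<not> ord b x" using vs by auto
    then have "ord x b" using above ord_refl by auto
    then show "ord a b" by (rule ord_trans[OF ab(2)])
    show "a \<noteq> b" using ab insert.hyps by auto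
  qed
  moreover have "set ?ws = insert x s" using vs by auto
  ultimately show ?case by blast
qed

lemma sorted_imp_chain: "sorted_wrt ord vs \<Longrightarrow> Complete_Partial_Order.chain ord (set vs)"
  by (induction vs) (auto simp: Complete_Partial_Order.chain_def ord_refl)

lemma face_closed_order_complex: "face_closed (order_complex ord S)"
  by (auto simp: face_closed_def order_complex_def Complete_Partial_Order.chain_def intro: finite_subset)

lemma ordered_simplices_order_complex:
  "ordered_simplices (order_complex ord S) n =
    {vs. distinct vs \<and> int (length vs) = n + 1 \<and> set vs \<subseteq> S \<and> Complete_Partial_Order.chain ord (set vs)}"
  by (auto simp: ordered_simplices_def order_complex_def Complete_Partial_Order.chain_def)

lemma strict_chain_perm_id:
  assumes "strict_chain vs" "p permutes {..<length vs}" "strict_chain (permute_list p vs)"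
  shows "p = id"
proof -
  have "permute_list p vs = permute_list id vs"
    using strict_chain_unique[OF assms(3,1)] set_permute_list[OF assms(2)] by simp
  then show ?thesis
    using assms strict_chain_distinct by (intro permute_list_inj_on_perms) (auto simp: permutes_id)
qed

lemma extend_restrict_strict_chain:
  assumes "c \<in> oriented_chains (order_complex ord S) n"
  shows "frag_extend oriented_simplex (restrict_frag strict_chain c) = c"
proof (rule oriented_chain_eq_extend_restrict[OF assms])
  fix ws assume "ws \<in> ordered_simplices (order_complex ord S) n"
  then have ws: "distinct ws" "Complete_Partial_Order.chain ord (set ws)"
    by (auto simp: ordered_simplices_order_complex)
  then obtain vs where vs: "strict_chain vs" "set vs = set ws"
    using strict_chain_exists[of "set ws"] by auto
  with mset_eq_permute_list[OF ws(1) strict_chain_distinct[OF vs(1)]]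
  show "\<exists>p. p permutes {..<length ws} \<and> strict_chain (permute_list p ws)" by metis
qed (rule strict_chain_perm_id)

lemma restrict_extend_strict_chain:
  assumes "\<And>vs. vs \<in> Poly_Mapping.keys y \<Longrightarrow> strict_chain vs"
  shows "restrict_frag strict_chain (frag_extend oriented_simplex y) = y"
proof -
  have "restrict_frag strict_chain (frag_extend oriented_simplex y) =
      frag_extend (\<lambda>x. restrict_frag strict_chain (oriented_simplex x)) y"
    unfolding restrict_frag_def by (rule frag_extend_frag_extend)
  also have "\<dots> = frag_extend frag_of y"
    by (rule frag_extend_eq)
      (use assms strict_chain_distinct strict_chain_perm_id in \<open>auto intro!: restrict_oriented_simplex\<close>)
  finally show ?thesis by (simp flip: frag_expansion)
qed

text \<open>Faces of an increasing list are increasing, and antisymmetrisation is injective on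
  chains of such lists. The increasing lift of an oriented cycle is therefore already a cycle of
  ordered chains.\<close>

lemma sorted_cycle:
  assumes c: "c \<in> oriented_chains (order_complex ord S) n" "simplicial_boundary c = 0"
  obtains y where "c = frag_extend oriented_simplex y" "frag_extend ordered_boundary y = 0"
    "\<And>vs. vs \<in> Poly_Mapping.keys y \<Longrightarrow> strict_chain vs \<and> set vs \<subseteq> S \<and> int (length vs) = n + 1"
proof
  define y where "y = restrict_frag strict_chain c"
  show cy: "c = frag_extend oriented_simplex y"
    using extend_restrict_strict_chain[OF c(1)] by (simp add: y_def)
  show y: "strict_chain vs \<and> set vs \<subseteq> S \<and> int (length vs) = n + 1" if "vs \<in> Poly_Mapping.keys y" for vs
    using that c(1) by (auto simp: y_def keys_restrict_frag oriented_chains_altdef ordered_simplices_order_complex)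
  have "strict_chain ws" if "ws \<in> Poly_Mapping.keys (frag_extend ordered_boundary y)" for ws
  proof -
    have "ws \<in> (\<Union>vs\<in>Poly_Mapping.keys y. Poly_Mapping.keys (ordered_boundary vs))"
      using that by (rule subsetD[OF keys_frag_extend])
    then obtain vs where vs: "vs \<in> Poly_Mapping.keys y" "ws \<in> Poly_Mapping.keys (ordered_boundary vs)"
      by blast
    then obtain i where i: "i < length vs" "ws = take i vs @ drop (Suc i) vs"
      using keys_ordered_boundary by blast
    have "sorted_wrt (\<lambda>x y. ord x y \<and> x \<noteq> y) (take i vs @ vs ! i # drop (Suc i) vs)"
      using y[OF vs(1)] id_take_nth_drop[OF i(1)] by (simp add: strict_chain_def)
    then show ?thesis unfolding i(2) strict_chain_def sorted_wrt_append by auto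
  qed
  from restrict_extend_strict_chain[OF this]
  have "frag_extend ordered_boundary y = restrict_frag strict_chain (simplicial_boundary c)"
    unfolding cy simplicial_boundary_extend by simp
  then show "frag_extend ordered_boundary y = 0"
    by (simp add: c(2) restrict_frag_def)
qed

end

text \<open>Unfolds to the alternating sum of the lists [f v_0, ..., f v_i, g v_i, ..., g v_n], the
  usual triangulation of the prism over a simplex.\<close>

fun prism :: "('a \<Rightarrow> 'b) \<Rightarrow> ('a \<Rightarrow> 'b) \<Rightarrow> 'a list \<Rightarrow> ('b list \<Rightarrow>\<^sub>0 int)" where
  "prism f g [] = 0"
| "prism f g (v # vs) = frag_of (f v # g v # map g vs) - frag_extend (\<lambda>ws. frag_of (f v # ws)) (prism f g vs)"

text \<open>The cone form of \<open>ordered_boundary\<close> turns the homotopy formula into an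
  induction. The identity is purely formal: ordered chains may repeat vertices, and no order on the
  values is involved.\<close>

lemma ordered_boundary_prism:
  "frag_extend ordered_boundary (prism f g vs) =
    frag_of (map g vs) - frag_of (map f vs) - frag_extend (prism f g) (ordered_boundary vs)"
proof (induction vs)
  case (Cons v vs)
  let ?c = "\<lambda>x. frag_extend (\<lambda>ws. frag_of (x # ws))"
  have "frag_extend (prism f g) (?c v (ordered_boundary vs)) =
      ?c (f v) (?c (g v) (ordered_boundary (map g vs))) - ?c (f v) (frag_extend (prism f g) (ordered_boundary vs))"
    by (simp add: frag_extend_frag_extend frag_extend_fun_diff ordered_boundary_map)
  moreover have "frag_extend ordered_boundary (prism f g (v # vs)) =
      ordered_boundary (f v # g v # map g vs) -
      (prism f g vs - ?c (f v) (frag_extend ordered_boundary (prism f g vs)))"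
    by (simp only: prism.simps frag_extend_diff frag_extend_of ordered_boundary_Cons_extend)
  ultimately show ?case
    by (simp add: Cons.IH frag_extend_diff)
qed simp

text \<open>Here the comparison of the two maps enters: for v below x one has f v <= f x <= g x, so
  the lists of the prism are weakly increasing.\<close>

lemma keys_prism:
  assumes "poset ord'" "sorted_wrt ord vs" "set vs \<subseteq> S"
    and mono: "\<And>x y. x \<in> S \<Longrightarrow> y \<in> S \<Longrightarrow> ord x y \<Longrightarrow> ord' (f x) (f y) \<and> ord' (g x) (g y)"
    and le: "\<And>x. x \<in> S \<Longrightarrow> ord' (f x) (g x)"
    and "ws \<in> Poly_Mapping.keys (prism f g vs)"
  shows "sorted_wrt ord' ws \<and> set ws \<subseteq> f ` set vs \<union> g ` set vs \<and> length ws = Suc (length vs)"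
  using assms(2,3,6)
proof (induction vs arbitrary: ws)
  case (Cons v vs)
  interpret poset ord' by fact
  have *: "ord' (f v) (f x)" "ord' (f v) (g x)" "ord' (g v) (g x)" if "x \<in> set vs" for x
  proof -
    have v: "v \<in> S" "x \<in> S" "ord v x" using that Cons.prems by auto
    show "ord' (f v) (f x)" "ord' (g v) (g x)" using mono[OF v] by auto
    with le[OF v(1)] show "ord' (f v) (g x)" using ord_trans by blast
  qed
  have "ws \<in> Poly_Mapping.keys (frag_of (f v # g v # map g vs)) \<union>
      Poly_Mapping.keys (frag_extend (\<lambda>ws. frag_of (f v # ws)) (prism f g vs))"
    using Cons.prems(3) subsetD[OF keys_diff] by (metis prism.simps(2))
  then consider "ws = f v # g v # map g vs"
    | ws' where "ws = f v # ws'" "ws' \<in> Poly_Mapping.keys (prism f g vs)"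
    using subsetD[OF keys_frag_extend] by (fastforce simp: keys_frag_of)
  then show ?case
  proof cases
    case 1
    have "sorted_wrt ord' (map g vs)"
      unfolding sorted_wrt_map
      by (rule sorted_wrt_mono_rel[of _ ord]) (use Cons.prems mono in auto)
    then show ?thesis using 1 * le[of v] Cons.prems by auto
  next
    case 2
    with Cons.IH[of ws'] Cons.prems
    have "sorted_wrt ord' ws'" "set ws' \<subseteq> f ` set vs \<union> g ` set vs" "length ws' = Suc (length vs)" by auto
    then show ?thesis using 2 * by auto
  qed
qed simp

text \<open>The bounding chain is the antisymmetrised prism over the increasing lift of
  \<open>c\<close>. That lift is an ordered cycle, which kills the term of the prism identity that
  contains its boundary.\<close>

lemma poset_homotopy:
  assumes S: "poset ord" and T: "poset ord'"
    and mono: "\<And>x y. x \<in> S \<Longrightarrow> y \<in> S \<Longrightarrow> ord x y \<Longrightarrow> ord' (f x) (f y) \<and> ord' (g x) (g y)"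
    and le: "\<And>x. x \<in> S \<Longrightarrow> ord' (f x) (g x)"
    and maps: "f ` S \<subseteq> T" "g ` S \<subseteq> T"
    and c: "c \<in> oriented_chains (order_complex ord S) n" "simplicial_boundary c = 0"
  shows "\<exists>b\<in>oriented_chains (order_complex ord' T) (n + 1).
    simplicial_boundary b = simplicial_chain_map g c - simplicial_chain_map f c"
proof -
  interpret S: poset ord by fact
  interpret T: poset ord' by fact
  obtain y where y: "c = frag_extend oriented_simplex y" "frag_extend ordered_boundary y = 0"
    "\<And>vs. vs \<in> Poly_Mapping.keys y \<Longrightarrow> S.strict_chain vs \<and> set vs \<subseteq> S \<and> int (length vs) = n + 1"
    using S.sorted_cycle[OF c] by metis
  define b where "b = frag_extend oriented_simplex (frag_extend (prism f g) y)"
  have "simplicial_boundary b =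
      frag_extend oriented_simplex (frag_extend (\<lambda>vs. frag_extend ordered_boundary (prism f g vs)) y)"
    unfolding b_def simplicial_boundary_extend by (simp only: frag_extend_frag_extend)
  also have "frag_extend (\<lambda>vs. frag_extend ordered_boundary (prism f g vs)) y =
      frag_extend (\<lambda>vs. frag_of (map g vs)) y - frag_extend (\<lambda>vs. frag_of (map f vs)) y
      - frag_extend (prism f g) (frag_extend ordered_boundary y)"
    by (simp only: ordered_boundary_prism frag_extend_fun_diff frag_extend_frag_extend)
  also have "frag_extend oriented_simplex \<dots> = simplicial_chain_map g c - simplicial_chain_map f c"
    by (simp add: y(1,2) simplicial_chain_map_extend frag_extend_diff frag_extend_frag_extend)
  finally have "simplicial_boundary b = simplicial_chain_map g c - simplicial_chain_map f c" .
  moreover have "b \<in> oriented_chains (order_complex ord' T) (n + 1)"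
    unfolding b_def frag_extend_frag_extend[of oriented_simplex "prism f g"]
  proof (intro oriented_chains_extend)
    fix vs ws assume vs: "vs \<in> Poly_Mapping.keys y" and ws: "ws \<in> Poly_Mapping.keys (prism f g vs)"
    have v: "sorted_wrt ord vs" "set vs \<subseteq> S" "int (length vs) = n + 1"
      using y(3)[OF vs] S.strict_chain_sorted by auto
    have w: "sorted_wrt ord' ws" "set ws \<subseteq> f ` set vs \<union> g ` set vs" "length ws = Suc (length vs)"
      using keys_prism[OF T v(1,2) mono le ws] by auto
    show "oriented_simplex ws \<in> oriented_chains (order_complex ord' T) (n + 1)"
    proof (cases "distinct ws")
      case True
      have "f ` set vs \<union> g ` set vs \<subseteq> T" using v(2) maps by blast
      with True have "ws \<in> ordered_simplices (order_complex ord' T) (n + 1)"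
        using w v(3) T.sorted_imp_chain[OF w(1)] order_trans[OF w(2)]
        by (simp add: T.ordered_simplices_order_complex)
      then show ?thesis by (rule oriented_simplex_in)
    next
      case False
      show ?thesis unfolding oriented_simplex_not_distinct[OF False] by (rule oriented_chains_zero)
    qed
  qed
  ultimately show ?thesis by blast
qed

lemma homology_class_chain_complex_of_eqI:
  assumes "face_closed Y" "c \<in> oriented_chains Y n" "d \<in> oriented_chains Y n"
    "b \<in> oriented_chains Y (n + 1)" "simplicial_boundary b = c - d"
  shows "homology_class (chain_complex_of Y) n c = homology_class (chain_complex_of Y) n d"
  using chain_complex.homology_class_eq_iff[OF chain_complex_chain_complex_of[OF assms(1)], of c n d] assms(2-5)
  by force

lemma order_complex_image:
  assumes "\<And>x y. x \<in> S \<Longrightarrow> y \<in> S \<Longrightarrow> ord x y \<Longrightarrow> ord' (f x) (f y)" "f ` S \<subseteq> T"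
    "s \<in> order_complex ord S"
  shows "f ` s \<in> order_complex ord' T"
  using assms unfolding order_complex_def Complete_Partial_Order.chain_def by blast

lemma poset_homotopy_class:
  assumes S: "poset ord" and T: "poset ord'"
    and mono: "\<And>x y. x \<in> S \<Longrightarrow> y \<in> S \<Longrightarrow> ord x y \<Longrightarrow> ord' (f x) (f y) \<and> ord' (g x) (g y)"
    and le: "\<And>x. x \<in> S \<Longrightarrow> ord' (f x) (g x)"
    and maps: "f ` S \<subseteq> T" "g ` S \<subseteq> T"
    and c: "c \<in> oriented_chains (order_complex ord S) n" "simplicial_boundary c = 0"
  shows "homology_class (chain_complex_of (order_complex ord' T)) n (simplicial_chain_map g c) =
    homology_class (chain_complex_of (order_complex ord' T)) n (simplicial_chain_map f c)"
proof -
  obtain b where b: "b \<in> oriented_chains (order_complex ord' T) (n + 1)"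
    "simplicial_boundary b = simplicial_chain_map g c - simplicial_chain_map f c"
    using poset_homotopy[OF assms] by blast
  have "simplicial_chain_map h c \<in> oriented_chains (order_complex ord' T) n"
    if "h = f \<or> h = g" for h
    by (rule simplicial_chain_map_closed[OF _ c(1)], rule order_complex_image[of S ord ord'])
      (use that mono maps in auto)
  then show ?thesis
    using homology_class_chain_complex_of_eqI[OF poset.face_closed_order_complex[OF T] _ _ b(1)] b(2) by blast
qed

lemma simplicial_chain_map_comp:
  assumes "c \<in> oriented_chains Y n"
  shows "simplicial_chain_map f (simplicial_chain_map g c) = simplicial_chain_map (f \<circ> g) c"
proof -
  obtain y where y: "Poly_Mapping.keys y \<subseteq> ordered_simplices Y n" "c = frag_extend oriented_simplex y"
    using oriented_chains_span[OF assms] .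
  have "simplicial_chain_map f (simplicial_chain_map g c) =
      frag_extend (\<lambda>x. simplicial_chain_map f (oriented_simplex (map g x))) y"
    unfolding y(2) simplicial_chain_map_extend unfolding simplicial_chain_map_def
    by (rule frag_extend_frag_extend)
  then show ?thesis
    unfolding y(2) simplicial_chain_map_extend by (simp add: simplicial_chain_map_oriented_simplex)
qed

lemma simplicial_chain_map_cong:
  assumes "c \<in> oriented_chains Y n" "\<And>x. x \<in> \<Union>Y \<Longrightarrow> f x = g x"
  shows "simplicial_chain_map f c = simplicial_chain_map g c"
  unfolding simplicial_chain_map_def
proof (rule frag_extend_eq)
  fix vs assume "vs \<in> Poly_Mapping.keys c"
  then have "vs \<in> ordered_simplices Y n" using assms(1) by (auto simp: oriented_chains_altdef)
  then have eq: "map f vs = map g vs" using assms(2) by (auto simp: ordered_simplices_def)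
  show "(if distinct (map f vs) then frag_of (map f vs) else 0) =
      (if distinct (map g vs) then frag_of (map g vs) else 0)" unfolding eq ..
qed

lemma simplicial_chain_map_id:
  assumes "c \<in> oriented_chains Y n"
  shows "simplicial_chain_map (\<lambda>x. x) c = c"
proof -
  have "simplicial_chain_map (\<lambda>x. x) c = frag_extend frag_of c"
    unfolding simplicial_chain_map_def
    by (rule frag_extend_eq) (use assms in \<open>auto simp: oriented_chains_altdef ordered_simplices_def\<close>)
  then show ?thesis by (simp flip: frag_expansion)
qed


section \<open>Barycentric subdivision\<close>

lemma poset_subset: "poset (\<subseteq>)"
  by unfold_locales auto

lemma flag_of_conv: "flag_of vs = map (\<lambda>k. set (drop k vs)) [0..<length vs]"
proof (induction vs)
  case (Cons v vs)
  have "[0..<length (v # vs)] = 0 # map Suc [0..<length vs]"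
    by (simp add: map_Suc_upt upt_conv_Cons del: upt_Suc)
  then show ?case by (simp add: Cons.IH)
qed simp

lemma length_flag_of [simp]: "length (flag_of vs) = length vs"
  by (simp add: flag_of_conv)

lemma flag_of_elem_subset: "s \<in> set (flag_of vs) \<Longrightarrow> s \<subseteq> set vs \<and> s \<noteq> {}"
  by (induction vs) auto

lemma chain_flag_of: "Complete_Partial_Order.chain (\<subseteq>) (set (flag_of vs))"
proof (induction vs)
  case (Cons v vs)
  then show ?case
    using flag_of_elem_subset[of _ vs] by (auto simp: Complete_Partial_Order.chain_def)
qed (simp add: Complete_Partial_Order.chain_def)

lemma distinct_flag_of: "distinct vs \<Longrightarrow> distinct (flag_of vs)"
  by (induction vs) (auto dest: flag_of_elem_subset)

lemma flag_of_ordered_simplices: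
  assumes "face_closed Y" "vs \<in> ordered_simplices Y n"
  shows "flag_of vs \<in> ordered_simplices (order_complex (\<subseteq>) Y) n"
proof -
  have "set (flag_of vs) \<subseteq> Y"
  proof
    fix s assume s: "s \<in> set (flag_of vs)"
    then have "set vs \<in> Y" using assms(2) by (auto simp: ordered_simplices_def)
    then show "s \<in> Y" using flag_of_elem_subset[OF s] assms(1) unfolding face_closed_def by blast
  qed
  then show ?thesis
    unfolding poset.ordered_simplices_order_complex[OF poset_subset]
    using assms(2) distinct_flag_of[of vs] chain_flag_of[of vs] by (auto simp: ordered_simplices_def)
qed

lemma subdivision_closed:
  assumes "face_closed Y" "c \<in> oriented_chains Y n"
  shows "subdivision c \<in> oriented_chains (order_complex (\<subseteq>) Y) n"
  unfolding subdivision_def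
  by (rule oriented_chains_extend, rule oriented_simplex_in, rule flag_of_ordered_simplices[OF assms(1)])
    (use assms(2) in \<open>auto simp: oriented_chains_altdef\<close>)

lemma subdivision_add: "subdivision (c + d) = subdivision c + subdivision d"
  by (simp add: subdivision_def frag_extend_add)

lemma set_drop_conv: "set (drop k xs) = (\<lambda>m. xs ! m) ` {k..<length xs}"
proof -
  have "drop k xs = map (\<lambda>m. xs ! m) [k..<length xs]"
    by (rule nth_equalityI) auto
  then show ?thesis by simp
qed

text \<open>The swap permutes the positions from \<open>k\<close> on, unless the cut at
  \<open>k\<close> separates position \<open>j\<close> from \<open>j + 1\<close>.\<close>

lemma set_drop_permute_swap:
  assumes "Suc j < length vs" "k \<noteq> Suc j"
  shows "set (drop k (permute_list (transpose j (Suc j)) vs)) = set (drop k vs)"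
proof -
  let ?t = "transpose j (Suc j)"
  have p: "?t permutes {..<length vs}" using assms(1) by (intro permutes_swap_id) auto
  have "?t ` {k..<length vs} = {k..<length vs}"
  proof (cases "k \<le> j")
    case True
    then show ?thesis using assms(1) by (intro permutes_image permutes_swap_id) auto
  next
    case False
    then have "?t ` {k..<length vs} = (\<lambda>m. m) ` {k..<length vs}"
      using assms(2) by (intro image_cong) (auto simp: transpose_def)
    then show ?thesis by simp
  qed
  have "set (drop k (permute_list ?t vs)) = (\<lambda>m. permute_list ?t vs ! m) ` {k..<length vs}"
    by (simp add: set_drop_conv)
  also have "\<dots> = (\<lambda>m. vs ! ?t m) ` {k..<length vs}"
    by (rule image_cong) (auto simp: permute_list_nth[OF p])
  also have "\<dots> = (\<lambda>m. vs ! m) ` (?t ` {k..<length vs})"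
    by (simp add: image_image)
  finally show ?thesis
    using \<open>?t ` {k..<length vs} = {k..<length vs}\<close> by (simp add: set_drop_conv)
qed

text \<open>Only the flag member of index j + 1, the tail that starts at position j + 1, notices the
  swap, and this member is deleted.\<close>

lemma delete_flag_of_swap:
  assumes "Suc j < length vs"
  shows "take (Suc j) (flag_of (permute_list (transpose j (Suc j)) vs)) @
      drop (Suc (Suc j)) (flag_of (permute_list (transpose j (Suc j)) vs)) =
    take (Suc j) (flag_of vs) @ drop (Suc (Suc j)) (flag_of vs)"
proof -
  have "take (Suc j) (flag_of (permute_list (transpose j (Suc j)) vs)) = take (Suc j) (flag_of vs)"
    using assms set_drop_permute_swap[OF assms]
    by (intro nth_equalityI) (auto simp: flag_of_conv)
  moreover have "drop (Suc (Suc j)) (flag_of (permute_list (transpose j (Suc j)) vs)) = drop (Suc (Suc j)) (flag_of vs)"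
    using assms set_drop_permute_swap[OF assms]
    by (intro nth_equalityI) (auto simp: flag_of_conv)
  ultimately show ?thesis by simp
qed

text \<open>The faces of a flag other than the one opposite to the barycentre of the whole simplex are
  shared by two orderings of opposite sign.\<close>

lemma subdivision_boundary:
  assumes c: "c \<in> oriented_chains Y n"
  shows "simplicial_boundary (subdivision c) = subdivision (simplicial_boundary c)"
proof (cases "n < 0")
  case True
  \<comment> \<open>In negative degrees only the empty list occurs, which has no first vertex to
    remove; both sides are zero.\<close>
  have "vs = []" if "vs \<in> Poly_Mapping.keys c" for vs
  proof -
    have "vs \<in> ordered_simplices Y n" using that c by (auto simp: oriented_chains_altdef)
    then have "int (length vs) = n + 1" by (simp add: ordered_simplices_def)
    then have "length vs = 0" using True by linarith
    then show ?thesis by simp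
  qed
  note nil = this
  have "frag_extend (\<lambda>vs. simplicial_boundary (oriented_simplex (flag_of vs))) c = 0"
  proof (rule frag_extend_eq_0)
    fix vs assume "vs \<in> Poly_Mapping.keys c"
    then have "vs = []" by (rule nil)
    then show "simplicial_boundary (oriented_simplex (flag_of vs)) = 0"
      by (simp add: boundary_oriented_simplex)
  qed
  moreover have "simplicial_boundary c = 0"
    unfolding simplicial_boundary_def by (rule frag_extend_eq_0) (auto dest: nil)
  moreover have "simplicial_boundary (subdivision c) =
      frag_extend (\<lambda>vs. simplicial_boundary (oriented_simplex (flag_of vs))) c"
    unfolding subdivision_def simplicial_boundary_def by (rule frag_extend_frag_extend)
  ultimately show ?thesis by (simp add: subdivision_def)
next
  case False
  let ?F = "\<lambda>i vs. oriented_simplex (take i (flag_of vs) @ drop (Suc i) (flag_of vs))"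
  have len: "length vs = Suc (nat n)" if "vs \<in> Poly_Mapping.keys c" for vs
    using that c False by (auto simp: oriented_chains_altdef ordered_simplices_def)
  have "simplicial_boundary (subdivision c) = frag_extend (\<lambda>vs. simplicial_boundary (oriented_simplex (flag_of vs))) c"
    unfolding subdivision_def simplicial_boundary_def by (simp add: frag_extend_frag_extend)
  also have "\<dots> = frag_extend (\<lambda>vs. \<Sum>i<Suc (nat n). frag_cmul ((-1) ^ i) (?F i vs)) c"
    by (rule frag_extend_eq) (simp only: boundary_oriented_simplex length_flag_of len)
  also have "\<dots> = (\<Sum>i<Suc (nat n). frag_cmul ((-1) ^ i) (frag_extend (?F i) c))"
    by (simp add: frag_extend_def frag_cmul_sum sum.swap[of _ "Poly_Mapping.keys c"] mult.commute
        del: sum.lessThan_Suc)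
  also have "\<dots> = frag_extend (?F 0) c"
  proof -
    \<comment> \<open>The face that omits the flag member of index j + 1 is invariant under swapping
      the vertices at positions j and j + 1.\<close>
    have "frag_extend (?F (Suc j)) c = 0" if "j < nat n" for j
    proof (rule oriented_chain_cancel[OF c, where i = j])
      fix vs assume "vs \<in> ordered_simplices Y n"
      then have "Suc j < length vs" using that by (auto simp: ordered_simplices_def)
      from delete_flag_of_swap[OF this]
      show "?F (Suc j) (permute_list (transpose j (Suc j)) vs) = ?F (Suc j) vs"
        by (rule arg_cong)
    qed (use that in simp)
    then show ?thesis by (simp add: sum.lessThan_Suc_shift del: sum.lessThan_Suc)
  qed
  \<comment> \<open>Omitting the largest member of a flag leaves the flag of the tail, just as the
    boundary removes the first vertex.\<close>
  also have "\<dots> = frag_extend (\<lambda>vs. frag_extend (\<lambda>vs. oriented_simplex (flag_of vs)) (case vs of [] \<Rightarrow> 0 | v # ws \<Rightarrow> frag_of ws)) c"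
  proof (rule frag_extend_eq)
    fix vs assume "vs \<in> Poly_Mapping.keys c"
    then have "length vs = Suc (nat n)" by (rule len)
    then obtain v ws where "vs = v # ws" by (cases vs) auto
    then show "?F 0 vs = frag_extend (\<lambda>vs. oriented_simplex (flag_of vs)) (case vs of [] \<Rightarrow> 0 | v # ws \<Rightarrow> frag_of ws)"
      by simp
  qed
  also have "\<dots> = subdivision (simplicial_boundary c)"
    unfolding subdivision_def simplicial_boundary_def by (simp only: frag_extend_frag_extend)
  finally show ?thesis .
qed

lemma subdivision_homology_class:
  assumes "face_closed Y" "z \<in> oriented_chains Y n"
  shows "homology_map (chain_complex_of Y) (chain_complex_of (order_complex (\<subseteq>) Y)) n subdivision
      (homology_class (chain_complex_of Y) n z) =
    homology_class (chain_complex_of (order_complex (\<subseteq>) Y)) n (subdivision z)"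
proof (rule homology_map_class[OF chain_complex_chain_complex_of[OF assms(1)]
      chain_complex_chain_complex_of[OF poset.face_closed_order_complex[OF poset_subset]]])
  show "subdivision \<in> hom (grp (chain_complex_of Y) n) (grp (chain_complex_of (order_complex (\<subseteq>) Y)) n)"
    using subdivision_closed[OF assms(1)] by (auto simp: hom_def subdivision_add)
  fix b assume "b \<in> carrier (grp (chain_complex_of Y) (n + 1))"
  then show "subdivision (bd (chain_complex_of Y) (n + 1) b)
      \<in> bd (chain_complex_of (order_complex (\<subseteq>) Y)) (n + 1) `
        carrier (grp (chain_complex_of (order_complex (\<subseteq>) Y)) (n + 1))"
    using subdivision_closed[OF assms(1), of b "n + 1"] subdivision_boundary[of b Y "n + 1"] by force
qed (use assms(2) in simp)

lemma simplicial_homology_class: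
  assumes "face_closed Y" "face_closed Y'" "\<And>s. s \<in> Y \<Longrightarrow> f ` s \<in> Y'" "z \<in> oriented_chains Y n"
  shows "homology_map (chain_complex_of Y) (chain_complex_of Y') n (simplicial_chain_map f)
      (homology_class (chain_complex_of Y) n z) =
    homology_class (chain_complex_of Y') n (simplicial_chain_map f z)"
proof (rule homology_map_class[OF chain_complex_chain_complex_of[OF assms(1)] chain_complex_chain_complex_of[OF assms(2)]])
  note closed = simplicial_chain_map_closed[of Y f Y', OF assms(3)]
  show "simplicial_chain_map f \<in> hom (grp (chain_complex_of Y) n) (grp (chain_complex_of Y') n)"
    using closed by (auto simp: hom_def simplicial_chain_map_add)
  fix b assume "b \<in> carrier (grp (chain_complex_of Y) (n + 1))"
  then show "simplicial_chain_map f (bd (chain_complex_of Y) (n + 1) b)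
      \<in> bd (chain_complex_of Y') (n + 1) ` carrier (grp (chain_complex_of Y') (n + 1))"
    using closed[of b "n + 1"] simplicial_boundary_chain_map[of b Y "n + 1"] by force
qed (use assms(4) in simp)

lemma cycles_chain_complex_of:
  assumes "face_closed Y"
  shows "chain_complex.cycles (chain_complex_of Y) n = {z \<in> oriented_chains Y n. simplicial_boundary z = 0}"
  by (auto simp: chain_complex.cycle_iff[OF chain_complex_chain_complex_of[OF assms]])

lemma poset_homology_class:
  assumes "poset ord" "poset ord'" "\<And>x y. x \<in> S \<Longrightarrow> y \<in> S \<Longrightarrow> ord x y \<Longrightarrow> ord' (f x) (f y)" "f ` S \<subseteq> T"
    "z \<in> oriented_chains (order_complex ord S) n"
  shows "homology_map (chain_complex_of (order_complex ord S)) (chain_complex_of (order_complex ord' T)) n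
      (simplicial_chain_map f) (homology_class (chain_complex_of (order_complex ord S)) n z) =
    homology_class (chain_complex_of (order_complex ord' T)) n (simplicial_chain_map f z)"
    and "simplicial_chain_map f z \<in> oriented_chains (order_complex ord' T) n"
    and "simplicial_boundary z = 0 \<Longrightarrow> simplicial_boundary (simplicial_chain_map f z) = 0"
proof -
  have *: "f ` s \<in> order_complex ord' T" if "s \<in> order_complex ord S" for s
    using order_complex_image[of S ord ord' f T s] assms that by blast
  show "homology_map (chain_complex_of (order_complex ord S)) (chain_complex_of (order_complex ord' T)) n
      (simplicial_chain_map f) (homology_class (chain_complex_of (order_complex ord S)) n z) =
    homology_class (chain_complex_of (order_complex ord' T)) n (simplicial_chain_map f z)"
    by (rule simplicial_homology_class[OF poset.face_closed_order_complex[OF assms(1)]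
          poset.face_closed_order_complex[OF assms(2)] * assms(5)])
  show "simplicial_chain_map f z \<in> oriented_chains (order_complex ord' T) n"
    by (rule simplicial_chain_map_closed[OF * assms(5)])
  show "simplicial_boundary (simplicial_chain_map f z) = 0" if "simplicial_boundary z = 0"
    using simplicial_boundary_chain_map[OF assms(5), of f] that by (simp add: simplicial_chain_map_def)
qed

text \<open>The identity and the composite of \<open>p\<close> with \<open>s\<close> both lie below
  \<open>F\<close>, so this composite induces the identity on homology. That makes \<open>p\<close>
  injective on classes, which is what \<open>inv_into\<close> requires in order to return the class
  obtained from \<open>s\<close>.\<close>

lemma poset_section_inverse:
  assumes Z: "poset ordZ" and X: "poset ordX"
    and p: "\<And>x y. x \<in> Z \<Longrightarrow> y \<in> Z \<Longrightarrow> ordZ x y \<Longrightarrow> ordX (p x) (p y)" "p ` Z \<subseteq> X'"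
    and s: "\<And>x y. x \<in> X' \<Longrightarrow> y \<in> X' \<Longrightarrow> ordX x y \<Longrightarrow> ordZ (s x) (s y)" "s ` X' \<subseteq> Z"
    and ps: "\<And>x. x \<in> X' \<Longrightarrow> p (s x) = x"
    and F: "\<And>x y. x \<in> Z \<Longrightarrow> y \<in> Z \<Longrightarrow> ordZ x y \<Longrightarrow> ordZ (F x) (F y)" "F ` Z \<subseteq> Z"
    and le: "\<And>x. x \<in> Z \<Longrightarrow> ordZ x (F x)" "\<And>x. x \<in> Z \<Longrightarrow> ordZ (s (p x)) (F x)"
    and z: "z \<in> oriented_chains (order_complex ordX X') n" "simplicial_boundary z = 0"
  defines "CZ \<equiv> chain_complex_of (order_complex ordZ Z)" and "CX \<equiv> chain_complex_of (order_complex ordX X')"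
  shows "inv_into (carrier (homology_group CZ n)) (homology_map CZ CX n (simplicial_chain_map p))
      (homology_class CX n z) = homology_class CZ n (simplicial_chain_map s z)"
proof -
  note Xfc = poset.face_closed_order_complex[OF X, of X']
  note Zfc = poset.face_closed_order_complex[OF Z, of Z]
  interpret CX: chain_complex CX unfolding CX_def by (rule chain_complex_chain_complex_of[OF Xfc])
  interpret CZ: chain_complex CZ unfolding CZ_def by (rule chain_complex_chain_complex_of[OF Zfc])
  have cycZ: "CZ.cycles n = {z \<in> oriented_chains (order_complex ordZ Z) n. simplicial_boundary z = 0}"
    unfolding CZ_def by (rule cycles_chain_complex_of[OF Zfc])
  have sp: "homology_class CZ n (simplicial_chain_map s (simplicial_chain_map p w)) = homology_class CZ n w"
    if w: "w \<in> oriented_chains (order_complex ordZ Z) n" "simplicial_boundary w = 0" for w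
  proof -
    have "homology_class CZ n (simplicial_chain_map F w) = homology_class CZ n (simplicial_chain_map (\<lambda>x. x) w)"
      unfolding CZ_def by (rule poset_homotopy_class[OF Z Z _ _ _ _ w]) (use F le in auto)
    moreover have "homology_class CZ n (simplicial_chain_map F w) = homology_class CZ n (simplicial_chain_map (s \<circ> p) w)"
      unfolding CZ_def
    proof (rule poset_homotopy_class[OF Z Z _ _ _ _ w])
      fix x y assume "x \<in> Z" "y \<in> Z" "ordZ x y"
      then show "ordZ ((s \<circ> p) x) ((s \<circ> p) y) \<and> ordZ (F x) (F y)"
        using F(1) s(1) p by (auto simp: image_subset_iff)
    qed (use F le s p in \<open>auto simp: image_subset_iff\<close>)
    ultimately show ?thesis
      by (simp add: simplicial_chain_map_comp[OF w(1)] simplicial_chain_map_id[OF w(1)])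
  qed
  let ?H = "homology_map CZ CX n (simplicial_chain_map p)"
  have H: "?H (homology_class CZ n w) = homology_class CX n (simplicial_chain_map p w)"
    if "w \<in> oriented_chains (order_complex ordZ Z) n" for w
    unfolding CZ_def CX_def by (rule poset_homology_class(1)[OF Z X p that])
  have inj: "inj_on ?H (carrier (homology_group CZ n))"
  proof (rule inj_onI)
    fix a b assume "a \<in> carrier (homology_group CZ n)" "b \<in> carrier (homology_group CZ n)" "?H a = ?H b"
    then obtain u v where uv: "u \<in> CZ.cycles n" "v \<in> CZ.cycles n"
      "a = homology_class CZ n u" "b = homology_class CZ n v"
      by (auto simp: CZ.carrier_homology_group)
    let ?S = "homology_map CX CZ n (simplicial_chain_map s)"
    have S: "?S (?H (homology_class CZ n w)) = homology_class CZ n w" if "w \<in> CZ.cycles n" for w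
    proof -
      have w: "w \<in> oriented_chains (order_complex ordZ Z) n" "simplicial_boundary w = 0"
        using that by (auto simp: cycZ)
      have "?S (homology_class CX n (simplicial_chain_map p w)) =
          homology_class CZ n (simplicial_chain_map s (simplicial_chain_map p w))"
        unfolding CZ_def CX_def
        by (rule poset_homology_class(1)[OF X Z s poset_homology_class(2)[OF Z X p w(1)]])
      then show ?thesis using sp[OF w] H[OF w(1)] by simp
    qed
    have "a = ?S (?H a)" unfolding uv(3) by (rule S[OF uv(1), symmetric])
    also have "\<dots> = ?S (?H b)" unfolding \<open>?H a = ?H b\<close> ..
    also have "\<dots> = b" unfolding uv(4) by (rule S[OF uv(2)])
    finally show "a = b" .
  qed
  have sz: "simplicial_chain_map s z \<in> oriented_chains (order_complex ordZ Z) n"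
    "simplicial_boundary (simplicial_chain_map s z) = 0"
    using poset_homology_class(2,3)[OF X Z s z(1)] z(2) by auto
  have "simplicial_chain_map p (simplicial_chain_map s z) = simplicial_chain_map (\<lambda>x. x) z"
    unfolding simplicial_chain_map_comp[OF z(1)]
    by (rule simplicial_chain_map_cong[OF z(1)]) (use ps in \<open>auto simp: order_complex_def\<close>)
  then have "?H (homology_class CZ n (simplicial_chain_map s z)) = homology_class CX n z"
    using H[OF sz(1)] simplicial_chain_map_id[OF z(1)] by simp
  moreover have "homology_class CZ n (simplicial_chain_map s z) \<in> carrier (homology_group CZ n)"
    using sz by (simp add: CZ.carrier_homology_group cycZ)
  ultimately show ?thesis using inv_into_f_f[OF inj] by metis
qed


section \<open>Growth of function fields\<close>

definition subring_set :: "'k::field set \<Rightarrow> bool" where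
  "subring_set Q \<longleftrightarrow> 1 \<in> Q \<and> (\<forall>x\<in>Q. \<forall>y\<in>Q. x - y \<in> Q \<and> x * y \<in> Q)"

lemma subring_setD:
  assumes "subring_set Q"
  shows "1 \<in> Q" "0 \<in> Q" "x \<in> Q \<Longrightarrow> y \<in> Q \<Longrightarrow> x + y \<in> Q" "x \<in> Q \<Longrightarrow> y \<in> Q \<Longrightarrow> x - y \<in> Q"
    "x \<in> Q \<Longrightarrow> y \<in> Q \<Longrightarrow> x * y \<in> Q" "x \<in> Q \<Longrightarrow> - x \<in> Q"
proof -
  show 1: "1 \<in> Q" and diff: "x \<in> Q \<Longrightarrow> y \<in> Q \<Longrightarrow> x - y \<in> Q" and "x \<in> Q \<Longrightarrow> y \<in> Q \<Longrightarrow> x * y \<in> Q" for x y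
    using assms by (auto simp: subring_set_def)
  from diff[OF 1 1] show 0: "0 \<in> Q" by simp
  from diff[OF 0] show neg: "x \<in> Q \<Longrightarrow> - x \<in> Q" for x by fastforce
  show "x \<in> Q \<Longrightarrow> y \<in> Q \<Longrightarrow> x + y \<in> Q"
    using diff[OF _ neg, of x y] by simp
qed

lemma subring_set_power: "subring_set Q \<Longrightarrow> x \<in> Q \<Longrightarrow> x ^ n \<in> Q"
  by (induction n) (auto intro: subring_setD)

lemma subring_set_sum: "subring_set Q \<Longrightarrow> (\<And>i. i \<in> S \<Longrightarrow> f i \<in> Q) \<Longrightarrow> sum f S \<in> Q"
  by (induction S rule: infinite_finite_induct) (auto intro: subring_setD)

text \<open>If N exceeded B, the powers of N / B would outgrow the constant M. For B = 0, where the
  quotient says nothing, the case D = 1 suffices.\<close>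

lemma power_growth:
  assumes "\<And>D::nat. N ^ D \<le> M * B ^ D"
  shows "N \<le> (B::nat)"
proof (rule ccontr)
  assume "\<not> N \<le> B"
  show False
  proof (cases "B = 0")
    case True
    then have "N ^ 1 \<le> M * 0 ^ 1" using assms[of 1] by simp
    then show False using \<open>\<not> N \<le> B\<close> by simp
  next
    case False
    then have "1 < real N / real B" using \<open>\<not> N \<le> B\<close> by (simp add: field_simps)
    then obtain D where "real M < (real N / real B) ^ D" using real_arch_pow by blast
    then have "real M * real B ^ D < real N ^ D"
      using False by (simp add: power_divide field_simps)
    then have "real (M * B ^ D) < real (N ^ D)" by simp
    then have "M * B ^ D < N ^ D" by (simp only: of_nat_less_iff)
    then show False using assms[of D] by simp
  qed
qed

text \<open>The sets \<open>E m\<close> play the role of the spaces of functions with poles bounded by \<open>m\<close>.\<close>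

locale linear_growth =
  fixes k :: "'k::field set" and E :: "nat \<Rightarrow> 'k set" and q :: nat
  assumes k_subring: "subring_set k" and k_inverse: "x \<in> k \<Longrightarrow> inverse x \<in> k" and k_finite: "finite k"
    and E_finite: "finite (E m)" and E_card: "card (E m) \<le> q ^ (m + 1)"
    and E_mono: "m \<le> n \<Longrightarrow> E m \<subseteq> E n"
    and E_zero: "0 \<in> E m" and E_add: "x \<in> E m \<Longrightarrow> y \<in> E m \<Longrightarrow> x + y \<in> E m"
    and E_scale: "a \<in> k \<Longrightarrow> x \<in> E m \<Longrightarrow> a * x \<in> E m"
    and E_nonzero: "\<exists>e\<in>E 0. e \<noteq> 0"
    and E_shift: "\<exists>h c. h \<noteq> 0 \<and> (\<forall>m. \<forall>x\<in>E m. h * x \<in> E (m + c) \<and> h * s * x \<in> E (m + c))"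
begin

lemma E_sum: "(\<And>i. i \<in> S \<Longrightarrow> f i \<in> E m) \<Longrightarrow> sum f S \<in> E m"
  by (induction S rule: infinite_finite_induct) (auto simp: E_zero E_add)

text \<open>The product of denominators for the single elements is a common one, and the shifts add
  up. That the same \<open>h\<close> keeps \<open>h * x\<close> bounded is what allows the factors
  to be combined.\<close>

lemma shift_finite:
  assumes "finite S"
  shows "\<exists>h c. h \<noteq> 0 \<and> (\<forall>m. \<forall>x\<in>E m. h * x \<in> E (m + c) \<and> (\<forall>s\<in>S. h * s * x \<in> E (m + c)))"
  using assms
proof (induction S rule: finite_induct)
  case empty
  have "(1::'k) \<noteq> 0 \<and> (\<forall>m. \<forall>x\<in>E m. 1 * x \<in> E (m + 0) \<and> (\<forall>s\<in>{}. 1 * s * x \<in> E (m + 0)))" by simp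
  then show ?case by blast
next
  case (insert s S)
  then obtain h c where h: "h \<noteq> 0" "\<And>m x. x \<in> E m \<Longrightarrow> h * x \<in> E (m + c)"
    "\<And>m x s. x \<in> E m \<Longrightarrow> s \<in> S \<Longrightarrow> h * s * x \<in> E (m + c)" by blast
  obtain h' c' where h': "h' \<noteq> 0" "\<And>m x. x \<in> E m \<Longrightarrow> h' * x \<in> E (m + c')"
    "\<And>m x. x \<in> E m \<Longrightarrow> h' * s * x \<in> E (m + c')" using E_shift[of s] by blast
  have 1: "h' * h * x \<in> E (m + (c + c'))" if "x \<in> E m" for x m
    using h'(2)[OF h(2)[OF that]] by (simp add: ac_simps)
  have 2: "h' * h * s * x \<in> E (m + (c + c'))" if "x \<in> E m" for x m
    using h'(3)[OF h(2)[OF that]] by (simp add: ac_simps)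
  have 3: "h' * h * u * x \<in> E (m + (c + c'))" if "x \<in> E m" "u \<in> S" for x m u
    using h'(2)[OF h(3)[OF that]] by (simp add: ac_simps)
  have "h' * h \<noteq> 0 \<and> (\<forall>m. \<forall>x\<in>E m. h' * h * x \<in> E (m + (c + c')) \<and>
      (\<forall>u\<in>insert s S. h' * h * u * x \<in> E (m + (c + c'))))"
    using h(1) h'(1) 1 2 3 by auto
  then show ?case by blast
qed

definition horner :: "'k \<Rightarrow> 'k list \<Rightarrow> 'k" where
  "horner z xs = foldr (\<lambda>x y. x + z * y) xs 0"

lemma horner_simps [simp]: "horner z [] = 0" "horner z (x # xs) = x + z * horner z xs"
  by (simp_all add: horner_def)

lemma horner_in: "subring_set Q \<Longrightarrow> z \<in> Q \<Longrightarrow> set xs \<subseteq> Q \<Longrightarrow> horner z xs \<in> Q"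
  by (induction xs) (auto intro: subring_setD)

text \<open>The digits are read off from the lowest one: equal values make the first digits
  congruent modulo \<open>z\<close>, hence equal, and then \<open>z\<close> can be
  cancelled.\<close>

lemma horner_inj:
  assumes Q: "subring_set Q" "z \<in> Q" "z \<noteq> 0"
    and T: "T \<subseteq> Q" "\<And>x y. x \<in> T \<Longrightarrow> y \<in> T \<Longrightarrow> (x - y) / z \<in> Q \<Longrightarrow> x = y"
    and "set xs \<subseteq> T" "set ys \<subseteq> T" "length xs = length ys" "horner z xs = horner z ys"
  shows "xs = ys"
  using assms(6-)
proof (induction xs arbitrary: ys)
  case (Cons x xs)
  then obtain y ys' where ys: "ys = y # ys'" by (cases ys) auto
  then have eq: "x - y = z * (horner z ys' - horner z xs)"
    using Cons.prems(4) by (simp add: algebra_simps)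
  have "horner z ys' - horner z xs \<in> Q"
    using horner_in[OF Q(1,2)] Cons.prems T(1) ys by (intro subring_setD(4)[OF Q(1)]) auto
  then have "(x - y) / z \<in> Q" using eq Q(3) by simp
  then have "x = y" using T(2) Cons.prems ys by auto
  moreover from this have "horner z xs = horner z ys'" using eq Q(3) by simp
  ultimately show ?case using Cons.IH[of ys'] Cons.prems ys by auto
qed simp

text \<open>A subring containing \<open>N\<close> elements that are incongruent modulo \<open>z\<close> contains \<open>N\<^sup>D\<close> elements
  \<open>x\<^sub>0 + x\<^sub>1 z + \<dots> + x\<^sub>D\<^sub>-\<^sub>1 z\<^sup>D\<^sup>-\<^sup>1\<close>, while the growth of \<open>E\<close> is only exponential with a base depending
  on \<open>z\<close> alone.\<close>

lemma residues_bounded: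
  fixes z :: 'k
  assumes "z \<noteq> 0"
  shows "\<exists>n. \<forall>Q T. subring_set Q \<longrightarrow> z \<in> Q \<longrightarrow> T \<subseteq> Q \<longrightarrow> finite T \<longrightarrow>
    (\<forall>x\<in>T. \<forall>y\<in>T. (x - y) / z \<in> Q \<longrightarrow> x = y) \<longrightarrow> card T \<le> n"
proof -
  obtain h c where h: "h \<noteq> 0" "\<And>m x. x \<in> E m \<Longrightarrow> h * x \<in> E (m + c)" "\<And>m x. x \<in> E m \<Longrightarrow> h * z * x \<in> E (m + c)"
    using E_shift[of z] by blast
  obtain e where e: "e \<in> E 0" "e \<noteq> 0" using E_nonzero by blast
  \<comment> \<open>The exponent \<open>c\<close> belongs to \<open>z\<close> alone. The
    denominators of all elements of \<open>T\<close> are cleared by one factor \<open>h'\<close>,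
    whatever the length of the expansion, and so affect only the constant in
    \<open>power_growth\<close>.\<close>
  have "card T \<le> q ^ c" if Q: "subring_set Q" "z \<in> Q" and T: "T \<subseteq> Q" "finite T"
    and incong: "\<forall>x\<in>T. \<forall>y\<in>T. (x - y) / z \<in> Q \<longrightarrow> x = y" for Q T
  proof -
    obtain h' c' where h': "h' \<noteq> 0" "\<And>m x s. x \<in> E m \<Longrightarrow> s \<in> T \<Longrightarrow> h' * s * x \<in> E (m + c')"
      using shift_finite[OF T(2)] by blast
    have hp: "h ^ D * u \<in> E (m + c * D)" if "u \<in> E m" for u m D
    proof (induction D)
      case (Suc D)
      from h(2)[OF Suc] show ?case by (simp add: algebra_simps)
    qed (use that in simp)
    \<comment> \<open>Each further digit costs one factor \<open>h\<close>, which accommodates one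
      factor \<open>z\<close>; in the induction \<open>u\<close> carries the factors used so
      far.\<close>
    have mem: "h' * h ^ length xs * u * horner z xs \<in> E (m + c' + c * length xs)"
      if "set xs \<subseteq> T" "u \<in> E m" for xs u m
      using that
    proof (induction xs arbitrary: u m)
      case (Cons x xs)
      have "h' * x * (h ^ Suc (length xs) * u) \<in> E (m + c * Suc (length xs) + c')"
        using Cons.prems by (intro h'(2) hp) auto
      moreover have "h' * h ^ length xs * (h * z * u) * horner z xs \<in> E (m + c + c' + c * length xs)"
        using Cons.prems by (intro Cons.IH h(3)) auto
      ultimately have "h' * x * (h ^ Suc (length xs) * u) + h' * h ^ length xs * (h * z * u) * horner z xs
          \<in> E (m + c' + c * length (x # xs))"
        by (intro E_add) (simp_all add: algebra_simps)
      then show ?case by (simp add: algebra_simps)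
    qed (simp add: E_zero)
    have "card T ^ D \<le> q ^ (c' + 1) * (q ^ c) ^ D" for D
    proof -
      let ?L = "{xs. set xs \<subseteq> T \<and> length xs = D}"
      let ?f = "\<lambda>xs. h' * h ^ D * e * horner z xs"
      have inj: "inj_on ?f ?L"
      proof (rule inj_onI)
        fix xs ys assume *: "xs \<in> ?L" "ys \<in> ?L" "?f xs = ?f ys"
        then have "horner z xs = horner z ys" using h(1) h'(1) e(2) by simp
        moreover have "set xs \<subseteq> T" "set ys \<subseteq> T" "length xs = length ys" using * by auto
        ultimately show "xs = ys" using incong by (intro horner_inj[OF Q assms T(1)]) auto
      qed
      have "?f ` ?L \<subseteq> E (c' + c * D)"
      proof (rule image_subsetI)
        fix xs assume "xs \<in> ?L"
        then show "?f xs \<in> E (c' + c * D)" using mem[OF _ e(1), of xs] by simp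
      qed
      then have "card ?L \<le> card (E (c' + c * D))"
        by (rule card_inj_on_le[OF inj _ E_finite])
      also have "\<dots> \<le> q ^ (c' + c * D + 1)" by (rule E_card)
      also have "\<dots> = q ^ (c' + 1) * (q ^ c) ^ D" by (simp add: power_add power_mult)
      finally show ?thesis by (simp only: card_lists_length_eq[OF T(2)])
    qed
    then show ?thesis by (rule power_growth)
  qed
  then show ?thesis by blast
qed

text \<open>For i < j, a congruence of z^i and z^j modulo \<open>w\<close>, multiplied by w /
  z^(i+1), would put 1/z into \<open>Q\<close>. So if \<open>w\<close> were non-zero, all powers of
  \<open>z\<close> would be pairwise incongruent modulo \<open>w\<close>, against
  \<open>residues_bounded\<close>.\<close>

lemma separated:
  fixes z :: 'k
  assumes Q: "subring_set Q" "z \<in> Q" "inverse z \<notin> Q" and w: "\<And>j. w / z ^ j \<in> Q"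
  shows "w = 0"
proof (rule ccontr)
  assume w0: "w \<noteq> 0"
  have z0: "z \<noteq> 0" using Q subring_setD(2)[OF Q(1)] by auto
  have wQ: "w \<in> Q" using w[of 0] by simp
  obtain n where n: "\<And>T. T \<subseteq> Q \<Longrightarrow> finite T \<Longrightarrow> \<forall>x\<in>T. \<forall>y\<in>T. (x - y) / w \<in> Q \<longrightarrow> x = y \<Longrightarrow> card T \<le> n"
  proof -
    from residues_bounded[OF w0] obtain n where *: "\<forall>Q T. subring_set Q \<longrightarrow> w \<in> Q \<longrightarrow> T \<subseteq> Q \<longrightarrow> finite T \<longrightarrow>
      (\<forall>x\<in>T. \<forall>y\<in>T. (x - y) / w \<in> Q \<longrightarrow> x = y) \<longrightarrow> card T \<le> n" ..
    show ?thesis by (rule that[of n]) (rule *[rule_format, OF Q(1) wQ], simp_all)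
  qed
  have lt: False if "i < j" "(z ^ i - z ^ j) / w \<in> Q \<or> (z ^ j - z ^ i) / w \<in> Q" for i j :: nat
  proof -
    have "(z ^ i - z ^ j) / w \<in> Q"
    proof (rule disjE[OF that(2)])
      assume "(z ^ j - z ^ i) / w \<in> Q"
      then have "- ((z ^ j - z ^ i) / w) \<in> Q" by (rule subring_setD(6)[OF Q(1)])
      then show ?thesis by (simp add: minus_divide_left)
    qed
    then have "(z ^ i - z ^ j) / w * (w / z ^ Suc i) \<in> Q" using w by (rule subring_setD(5)[OF Q(1)])
    moreover have "(z ^ i - z ^ j) / w * (w / z ^ Suc i) = inverse z - z ^ (j - Suc i)"
    proof -
      have "Suc i + (j - Suc i) = j" using that(1) by simp
      then have "z ^ j = z ^ Suc i * z ^ (j - Suc i)" by (metis power_add)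
      then have "(z ^ i - z ^ j) / w * (w / z ^ Suc i) = z ^ i / z ^ Suc i - z ^ Suc i * z ^ (j - Suc i) / z ^ Suc i"
        using w0 by (simp only: times_divide_times_eq diff_divide_distrib[symmetric]) simp
      also have "\<dots> = inverse z - z ^ (j - Suc i)"
        using z0 by (simp add: field_simps)
      finally show ?thesis .
    qed
    ultimately have "inverse z - z ^ (j - Suc i) + z ^ (j - Suc i) \<in> Q"
      using subring_set_power[OF Q(1,2)] by (intro subring_setD(3)[OF Q(1)]) auto
    then show False using Q(3) by simp
  qed
  have inj: "inj_on (\<lambda>i. z ^ i) {..n}"
  proof (rule inj_onI)
    fix i j assume "z ^ i = z ^ j"
    then show "i = j" using lt[of i j] lt[of j i] subring_setD(2)[OF Q(1)] by (cases i j rule: linorder_cases) auto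
  qed
  have "card ((\<lambda>i. z ^ i) ` {..n}) \<le> n"
  proof (rule n)
    show "(\<lambda>i. z ^ i) ` {..n} \<subseteq> Q" using subring_set_power[OF Q(1,2)] by auto
    show "\<forall>x\<in>(\<lambda>i. z ^ i) ` {..n}. \<forall>y\<in>(\<lambda>i. z ^ i) ` {..n}. (x - y) / w \<in> Q \<longrightarrow> x = y"
    proof (intro ballI impI)
      fix x y assume "x \<in> (\<lambda>i. z ^ i) ` {..n}" "y \<in> (\<lambda>i. z ^ i) ` {..n}" "(x - y) / w \<in> Q"
      then obtain i j where "x = z ^ i" "y = z ^ j" "(z ^ i - z ^ j) / w \<in> Q" by auto
      then show "x = y" using lt[of i j] lt[of j i] by (cases i j rule: linorder_cases) auto
    qed
  qed simp
  then show False by (simp add: card_image[OF inj])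
qed

text \<open>The number of polynomials of degree
  below \<open>n\<close> in each variable is exponential in \<open>n\<^sup>2\<close>, that of their possible values only in \<open>n\<close>.\<close>

lemma algebraically_dependent:
  fixes t x :: 'k
  shows "\<exists>n a. (\<forall>i j. a i j \<in> k) \<and> (\<exists>i<n. \<exists>j<n. a i j \<noteq> 0) \<and> (\<Sum>i<n. (\<Sum>j<n. a i j * t ^ j) * x ^ i) = (0::'k)"
proof -
  obtain h c where h: "h \<noteq> 0" "\<And>m y. y \<in> E m \<Longrightarrow> h * y \<in> E (m + c)" "\<And>m y. y \<in> E m \<Longrightarrow> h * t * y \<in> E (m + c)"
    "\<And>m y. y \<in> E m \<Longrightarrow> h * x * y \<in> E (m + c)"
    using shift_finite[of "{t, x}"] by auto
  obtain e where e: "e \<in> E 0" "e \<noteq> 0" using E_nonzero by blast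
  have pow: "u ^ D * y \<in> E (m + c * D)" if "y \<in> E m" "\<And>m y. y \<in> E m \<Longrightarrow> u * y \<in> E (m + c)" for u y m D
  proof (induction D)
    case (Suc D)
    from that(2)[OF Suc] show ?case by (simp add: algebra_simps)
  qed (use that in simp)
  have k2: "2 \<le> card k"
  proof -
    have "{0, 1} \<subseteq> k" using subring_setD(1,2)[OF k_subring] by auto
    then have "card {0::'k, 1} \<le> card k" by (rule card_mono[OF k_finite])
    then show ?thesis by simp
  qed
  have q_le: "q \<le> 2 ^ q" using less_exp[of q] by simp
  \<comment> \<open>The values number at most 2^(q (2 n c + 1)) and the coefficient families at
    least 2^(n^2). This \<open>n\<close> makes the first exponent, which is linear in n, smaller
    than the second.\<close>
  define n where "n = q * (2 * c + 1) + 1"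
  have n_large: "q * (2 * n * c + 1) < n * n"
  proof -
    have "q * (2 * n * c + 1) \<le> n * (q * (2 * c + 1))"
      by (simp add: algebra_simps n_def)
    also have "\<dots> < n * n" unfolding n_def by simp
    finally show ?thesis .
  qed
  let ?I = "{..<n} \<times> {..<n}"
  let ?S = "?I \<rightarrow>\<^sub>E k"
  let ?v = "\<lambda>a. \<Sum>(i, j)\<in>?I. a (i, j) * (t ^ j * x ^ i)"
  \<comment> \<open>The factor h^(2n) clears the denominators of all monomials with both exponents
    below \<open>n\<close>, and the non-zero \<open>e\<close> moves the values into
    \<open>E (2 * n * c)\<close>.\<close>
  let ?f = "\<lambda>a. h ^ (2 * n) * e * ?v a"
  have mono: "h ^ (2 * n) * e * (t ^ j * x ^ i) \<in> E (2 * n * c)" if "i < n" "j < n" for i j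
  proof -
    have "h ^ (2 * n) * e * (t ^ j * x ^ i) = (h * t) ^ j * ((h * x) ^ i * (h ^ (2 * n - i - j) * e))"
    proof -
      have "2 * n = j + (i + (2 * n - i - j))" using that by simp
      then have "h ^ (2 * n) = h ^ j * (h ^ i * h ^ (2 * n - i - j))" by (metis power_add)
      then show ?thesis by (simp add: power_mult_distrib algebra_simps)
    qed
    also have "\<dots> \<in> E (0 + c * (2 * n - i - j) + c * i + c * j)"
      by (intro pow e h)
    also have "0 + c * (2 * n - i - j) + c * i + c * j = 2 * n * c"
    proof -
      have "c * (2 * n - i - j) + c * i + c * j = c * (2 * n - i - j + i + j)" by (simp add: algebra_simps)
      also have "2 * n - i - j + i + j = 2 * n" using that by simp
      finally show ?thesis by simp
    qed
    finally show ?thesis .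
  qed
  have "?f ` ?S \<subseteq> E (2 * n * c)"
  proof (rule image_subsetI)
    fix a assume a: "a \<in> ?S"
    have "?f a = (\<Sum>(i, j)\<in>?I. a (i, j) * (h ^ (2 * n) * e * (t ^ j * x ^ i)))"
      unfolding sum_distrib_left by (rule sum.cong) (auto simp: algebra_simps)
    also have "\<dots> \<in> E (2 * n * c)"
    proof (rule E_sum)
      fix p assume "p \<in> ?I"
      then obtain i j where p: "p = (i, j)" "i < n" "j < n" by auto
      have "a (i, j) * (h ^ (2 * n) * e * (t ^ j * x ^ i)) \<in> E (2 * n * c)"
        using a p by (intro E_scale mono) (auto simp: PiE_iff)
      then show "(case p of (i, j) \<Rightarrow> a (i, j) * (h ^ (2 * n) * e * (t ^ j * x ^ i))) \<in> E (2 * n * c)"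
        by (simp add: p(1))
    qed
    finally show "?f a \<in> E (2 * n * c)" .
  qed
  then have "card (?f ` ?S) \<le> q ^ (2 * n * c + 1)"
    by (rule order_trans[OF card_mono[OF E_finite] E_card])
  also have "\<dots> \<le> (2 ^ q) ^ (2 * n * c + 1)" using q_le by (rule power_mono) simp
  also have "\<dots> = 2 ^ (q * (2 * n * c + 1))" by (simp only: power_mult)
  also have "\<dots> < 2 ^ (n * n)" using n_large by (intro power_strict_increasing) auto
  also have "\<dots> \<le> card k ^ (n * n)" using k2 by (rule power_mono) simp
  also have "\<dots> = card ?S" by (simp add: card_PiE card_cartesian_product)
  finally have "\<not> inj_on ?f ?S" using card_image[of ?f ?S] by auto
  then obtain a b where ab: "a \<in> ?S" "b \<in> ?S" "a \<noteq> b" "?f a = ?f b" by (auto simp: inj_on_def)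
  \<comment> \<open>Two different coefficient families with the same value exist by counting; their
    difference, extended by zero, is the relation.\<close>
  define d where "d i j = (if i < n \<and> j < n then a (i, j) - b (i, j) else 0)" for i j
  have "?v a = ?v b" using ab(4) h(1) e(2) by simp
  moreover have "(\<Sum>i<n. (\<Sum>j<n. d i j * t ^ j) * x ^ i) = ?v a - ?v b"
  proof -
    have "(\<Sum>i<n. (\<Sum>j<n. d i j * t ^ j) * x ^ i) = (\<Sum>i<n. \<Sum>j<n. (a (i, j) - b (i, j)) * (t ^ j * x ^ i))"
      unfolding sum_distrib_right by (intro sum.cong refl) (simp add: d_def mult.assoc)
    also have "\<dots> = (\<Sum>(i, j)\<in>?I. a (i, j) * (t ^ j * x ^ i) - b (i, j) * (t ^ j * x ^ i))"
      by (simp add: sum.cartesian_product algebra_simps)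
    also have "\<dots> = ?v a - ?v b"
      by (simp add: sum_subtractf case_prod_unfold)
    finally show ?thesis .
  qed
  moreover have "\<forall>i j. d i j \<in> k"
    using ab(1,2) subring_setD(2,4)[OF k_subring] by (auto simp: d_def PiE_iff)
  moreover have "\<exists>i<n. \<exists>j<n. d i j \<noteq> 0"
  proof (rule ccontr)
    assume "\<not> (\<exists>i<n. \<exists>j<n. d i j \<noteq> 0)"
    then have "a p = b p" if "p \<in> ?I" for p using that by (auto simp: d_def)
    then have "a = b" using ab(1,2) by (intro PiE_ext[of a ?I "\<lambda>_. k" b]) auto
    then show False using ab(3) by simp
  qed
  ultimately show ?thesis by (intro exI[of _ n] exI[of _ d]) auto
qed

end


section \<open>The function field\<close>

lemma univ_ring_simps [simp]:
  "carrier (univ_ring :: 'k::field ring) = UNIV" "x \<otimes>\<^bsub>univ_ring\<^esub> y = x * y" "\<one>\<^bsub>univ_ring\<^esub> = (1::'k)"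
  "\<zero>\<^bsub>univ_ring\<^esub> = (0::'k)" "x \<oplus>\<^bsub>univ_ring\<^esub> y = x + y"
  by (simp_all add: ring_of_type_algebra_def)

lemma univ_ring_a_inv [simp]: "\<ominus>\<^bsub>univ_ring\<^esub> x = - (x::'k::field)"
proof -
  interpret U: ring "univ_ring :: 'k ring" by (rule ring_from_type_algebra)
  show ?thesis by (rule U.minus_equality) simp_all
qed

lemma univ_ring_m_inv [simp]: "x \<noteq> 0 \<Longrightarrow> inv\<^bsub>univ_ring\<^esub> x = inverse (x::'k::field)"
proof -
  assume x: "x \<noteq> 0"
  interpret U: cring "univ_ring :: 'k ring" by (rule cring_from_type_algebra)
  show ?thesis by (rule U.inv_unique'[symmetric]) (simp_all add: x)
qed

lemma univ_ring_pow [simp]: "x [^]\<^bsub>univ_ring\<^esub> (n::nat) = (x::'k::field) ^ n"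
proof -
  interpret U: ring "univ_ring :: 'k ring" by (rule ring_from_type_algebra)
  show ?thesis by (induction n) (simp_all add: mult.commute)
qed

lemma subring_set_if_subring:
  assumes "subring Q univ_ring"
  shows "subring_set Q"
  unfolding subring_set_def
proof (intro conjI ballI)
  show "1 \<in> Q" using subringE(3)[OF assms] by simp
  fix x y assume xy: "x \<in> Q" "y \<in> Q"
  have "- y \<in> Q" using subringE(5)[OF assms xy(2)] by simp
  from subringE(7)[OF assms xy(1) this] show "x - y \<in> Q" by simp
  from subringE(6)[OF assms xy] show "x * y \<in> Q" by simp
qed

text \<open>\<open>eval\<close> expects the leading coefficient first, hence the reversal.\<close>

lemma eval_univ_ring_rev:
  "ring.eval univ_ring (rev as) x = (\<Sum>i<length as. as ! i * (x::'k::field) ^ i)"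
proof -
  interpret U: ring "univ_ring :: 'k ring" by (rule ring_from_type_algebra)
  show ?thesis
    by (induction as rule: rev_induct) (simp_all add: nth_append)
qed

text \<open>\<open>V\<close> may be any set, so that the coefficients can be taken from a field,
  from the fractions that describe it, or from the polynomials of bounded degree.\<close>

fun lincombs :: "'k::field set \<Rightarrow> 'k list \<Rightarrow> 'k set" where
  "lincombs V [] = {0}"
| "lincombs V (u # us) = (\<lambda>(v, w). v * u + w) ` (V \<times> lincombs V us)"

lemma lincombs_mono: "F \<subseteq> G \<Longrightarrow> lincombs F us \<subseteq> lincombs G us"
proof (induction us)
  case (Cons u us)
  then show ?case unfolding lincombs.simps by (intro image_mono Sigma_mono) simp_all
qed simp

lemma dimension_lincombs:
  "ring.dimension univ_ring n F S \<Longrightarrow> \<exists>us. lincombs F us = S"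
proof -
  interpret U: ring "univ_ring :: 'k::field ring" by (rule ring_from_type_algebra)
  show "U.dimension n F S \<Longrightarrow> \<exists>us. lincombs F us = S"
  proof (induction rule: U.dimension.induct)
    case zero_dim
    show ?case by (rule exI[of _ "[]"]) simp
  next
    case (Suc_dim v S n F)
    then obtain us where "lincombs F us = S" by blast
    then have "lincombs F (v # us) = U.line_extension F v S"
      by (auto simp: U.line_extension_mem_iff set_eq_iff image_iff)
    then show ?case by blast
  qed
qed

text \<open>Polynomials in \<open>t\<close> of degree at most \<open>m\<close>, in Horner form. In
  Chevalley's theorem the coefficients range over an ideal.\<close>

fun bounded_polys :: "'k::field set \<Rightarrow> 'k \<Rightarrow> nat \<Rightarrow> 'k set" where
  "bounded_polys k t 0 = k"
| "bounded_polys k t (Suc m) = (\<lambda>(a, v). a + t * v) ` (k \<times> bounded_polys k t m)"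

text \<open>Separating the scalars \<open>k\<close> from the coefficients \<open>N\<close> covers
  the polynomials over the constants as well as a ring Q[y] and the extended ideal N Q[y].\<close>

locale poly_module =
  fixes k N :: "'k::field set" and t :: 'k
  assumes k_subring: "subring_set k" and N_zero: "0 \<in> N" and N_add: "x \<in> N \<Longrightarrow> y \<in> N \<Longrightarrow> x + y \<in> N"
    and N_scale: "a \<in> k \<Longrightarrow> x \<in> N \<Longrightarrow> a * x \<in> N"
begin

abbreviation "V \<equiv> bounded_polys N t"

lemma V_I: "a \<in> N \<Longrightarrow> v \<in> V m \<Longrightarrow> a + t * v \<in> V (Suc m)"
  unfolding bounded_polys.simps by (rule image_eqI[of _ _ "(a, v)"]) simp_all

lemma V_SucE:
  assumes "x \<in> V (Suc m)" obtains a v where "x = a + t * v" "a \<in> N" "v \<in> V m"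
  using assms by auto

lemma V_zero [simp]: "0 \<in> V m"
proof (induction m)
  case (Suc m)
  from V_I[OF N_zero this] show ?case by (simp del: bounded_polys.simps)
qed (simp add: N_zero)

lemma V_Suc_mono: "V m \<subseteq> V (Suc m)"
proof (induction m)
  case 0
  show ?case using V_I[OF _ V_zero[of 0]] by auto
next
  case (Suc m)
  show ?case
  proof
    fix x assume "x \<in> V (Suc m)"
    then obtain a v where "x = a + t * v" "a \<in> N" "v \<in> V m" by (rule V_SucE)
    then show "x \<in> V (Suc (Suc m))" using V_I[of a v "Suc m"] Suc.IH by blast
  qed
qed

lemma V_mono: "m \<le> n \<Longrightarrow> V m \<subseteq> V n"
  by (rule lift_Suc_mono_le[of V, OF V_Suc_mono])

lemma N_in_V: "a \<in> N \<Longrightarrow> a \<in> V m"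
  using V_mono[of 0 m] by auto

lemma V_add: "x \<in> V m \<Longrightarrow> y \<in> V m \<Longrightarrow> x + y \<in> V m"
proof (induction m arbitrary: x y)
  case 0
  then show ?case using N_add by simp
next
  case (Suc m)
  from Suc.prems(1) obtain a v where 1: "x = a + t * v" "a \<in> N" "v \<in> V m" by (rule V_SucE)
  from Suc.prems(2) obtain b w where 2: "y = b + t * w" "b \<in> N" "w \<in> V m" by (rule V_SucE)
  have "(a + b) + t * (v + w) \<in> V (Suc m)"
    using 1 2 by (intro V_I Suc.IH N_add)
  then show ?case using 1 2 by (simp add: algebra_simps del: bounded_polys.simps(2))
qed

lemma V_scale: "a \<in> k \<Longrightarrow> x \<in> V m \<Longrightarrow> a * x \<in> V m"
proof (induction m arbitrary: x)
  case 0
  then show ?case using N_scale by simp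
next
  case (Suc m)
  from Suc.prems(2) obtain b v where 1: "x = b + t * v" "b \<in> N" "v \<in> V m" by (rule V_SucE)
  have "a * b + t * (a * v) \<in> V (Suc m)"
    using 1 Suc.prems by (intro V_I Suc.IH N_scale)
  then show ?case using 1 by (simp add: algebra_simps del: bounded_polys.simps(2))
qed

lemma V_mult: "x \<in> bounded_polys k t m \<Longrightarrow> y \<in> V n \<Longrightarrow> x * y \<in> V (m + n)"
proof (induction m arbitrary: x)
  case 0
  then show ?case using V_scale by simp
next
  case (Suc m)
  from Suc.prems(1) obtain a v where 1: "x = a + t * v" "a \<in> k" "v \<in> bounded_polys k t m" by auto
  have "a * y \<in> V (Suc (m + n))"
    using V_scale[OF 1(2) Suc.prems(2)] V_mono[of n "Suc (m + n)"] by auto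
  moreover have "0 + t * (v * y) \<in> V (Suc (m + n))"
    using 1 Suc by (intro V_I N_zero) auto
  ultimately have "a * y + (0 + t * (v * y)) \<in> V (Suc (m + n))" by (rule V_add)
  then show ?case using 1 by (simp add: algebra_simps del: bounded_polys.simps(2))
qed

end

locale curve_field =
  fixes k :: "'k::field set" and t :: 'k
  assumes k_ring: "subring_set k" and k_inverse: "x \<in> k \<Longrightarrow> inverse x \<in> k" and k_finite: "finite k"

sublocale curve_field \<subseteq> poly_module k k t
  using k_ring subring_setD[OF k_ring] by unfold_locales

context curve_field
begin

lemma k1 [simp]: "1 \<in> k"
  by (rule subring_setD(1)[OF k_ring])

lemma t_in_V: "t \<in> V (Suc 0)"
  using V_I[OF N_zero, of 1 0] by (simp del: bounded_polys.simps(2))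

lemma V_finite: "finite (V m)"
  by (induction m) (auto simp: k_finite)

lemma V_card: "card (V m) \<le> card k ^ (m + 1)"
proof (induction m)
  case (Suc m)
  have "card (V (Suc m)) \<le> card (k \<times> V m)"
    unfolding bounded_polys.simps by (rule card_image_le) (simp add: k_finite V_finite)
  also have "\<dots> \<le> card k * card k ^ (m + 1)"
    unfolding card_cartesian_product by (rule mult_le_mono2[OF Suc])
  finally show ?case by simp
qed simp

text \<open>The field k(t). Numerator and denominator share one degree bound, which
  \<open>fractionsI\<close> relaxes.\<close>

definition fractions :: "'k set" where
  "fractions = {x. \<exists>h m. h \<noteq> 0 \<and> h \<in> V m \<and> h * x \<in> V m}"

lemma fractionsI: "h \<noteq> 0 \<Longrightarrow> h \<in> V m \<Longrightarrow> h * x \<in> V n \<Longrightarrow> x \<in> fractions"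
  unfolding fractions_def using V_mono[of m "max m n"] V_mono[of n "max m n"] by auto

lemma V_in_fractions: "x \<in> V m \<Longrightarrow> x \<in> fractions"
  using fractionsI[of 1 0 x m] by simp

lemma generate_field_fractions: "generate_field univ_ring (insert t k) \<subseteq> fractions"
proof
  fix x assume "x \<in> generate_field univ_ring (insert t k)"
  then show "x \<in> fractions"
  proof (induction rule: generate_field.induct)
    case one
    show ?case using V_in_fractions[of 1 0] by simp
  next
    case (incl h)
    then show ?case using V_in_fractions[of h 0] V_in_fractions[OF t_in_V] by auto
  next
    case (a_inv x)
    then obtain h m where h: "h \<noteq> 0" "h \<in> V m" "h * x \<in> V m" by (auto simp: fractions_def)
    have "- 1 * (h * x) \<in> V m" using subring_setD(6)[OF k_subring k1] h(3) by (rule V_scale)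
    then show ?case using fractionsI[OF h(1,2), of "- x" m] by simp
  next
    case (m_inv x)
    then obtain h m where h: "h \<noteq> 0" "h \<in> V m" "h * x \<in> V m" by (auto simp: fractions_def)
    have x: "x \<noteq> 0" using m_inv.hyps by simp
    then have "h * x * inverse x = h" by simp
    with h(2) have "h * x * inverse x \<in> V m" by metis
    then have "inverse x \<in> fractions" using h x by (intro fractionsI[of "h * x" m _ m]) simp_all
    then show ?case using x by simp
  next
    case (eng_add x y)
    then obtain h m h' m' where h: "h \<noteq> 0" "h \<in> V m" "h * x \<in> V m" "h' \<noteq> 0" "h' \<in> V m'" "h' * y \<in> V m'"
      by (auto simp: fractions_def)
    have "h' * (h * x) + h * (h' * y) \<in> V (m + m')"
      using V_mult[OF h(5,3)] V_mult[OF h(2,6)] by (intro V_add) (simp_all add: add.commute)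
    then show ?case
      using fractionsI[of "h * h'" "m + m'" "x + y" "m + m'"] V_mult[OF h(2,5)] h(1,4)
      by (simp add: algebra_simps)
  next
    case (eng_mult x y)
    then obtain h m h' m' where h: "h \<noteq> 0" "h \<in> V m" "h * x \<in> V m" "h' \<noteq> 0" "h' \<in> V m'" "h' * y \<in> V m'"
      by (auto simp: fractions_def)
    then show ?case
      using fractionsI[of "h * h'" "m + m'" "x * y" "m + m'"] V_mult[OF h(2,5)] V_mult[OF h(3,6)]
      by (simp add: algebra_simps)
  qed
qed

text \<open>With \<open>us\<close> spanning K over k(t), every element of K lies in one of these
  finite sets after clearing a denominator, and their size grows at most exponentially in
  \<open>m\<close>.\<close>

abbreviation "E us m \<equiv> lincombs (V m) us"

lemma E_mono: "m \<le> n \<Longrightarrow> E us m \<subseteq> E us n"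
  by (rule lincombs_mono[OF V_mono])

lemma E_I: "v \<in> V m \<Longrightarrow> w \<in> E us m \<Longrightarrow> v * u + w \<in> E (u # us) m"
  unfolding lincombs.simps by (rule image_eqI[of _ _ "(v, w)"]) simp_all

lemma E_zero: "0 \<in> E us m"
proof (induction us)
  case (Cons u us)
  from E_I[OF V_zero this] show ?case by (simp del: lincombs.simps)
qed simp

lemma E_ConsE:
  assumes "x \<in> E (u # us) m" obtains v w where "x = v * u + w" "v \<in> V m" "w \<in> E us m"
  using assms by auto

lemma E_add: "x \<in> E us m \<Longrightarrow> y \<in> E us m \<Longrightarrow> x + y \<in> E us m"
proof (induction us arbitrary: x y)
  case (Cons u us)
  from Cons.prems(1) obtain v w where 1: "x = v * u + w" "v \<in> V m" "w \<in> E us m" by (rule E_ConsE)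
  from Cons.prems(2) obtain v' w' where 2: "y = v' * u + w'" "v' \<in> V m" "w' \<in> E us m" by (rule E_ConsE)
  have "(v + v') * u + (w + w') \<in> E (u # us) m"
    using 1 2 by (intro E_I V_add Cons.IH)
  then show ?case using 1 2 by (simp add: algebra_simps del: lincombs.simps)
qed simp

lemma E_mult: "a \<in> V n \<Longrightarrow> x \<in> E us m \<Longrightarrow> a * x \<in> E us (n + m)"
proof (induction us arbitrary: x)
  case (Cons u us)
  from Cons.prems(2) obtain v w where 1: "x = v * u + w" "v \<in> V m" "w \<in> E us m" by (rule E_ConsE)
  have "(a * v) * u + a * w \<in> E (u # us) (n + m)"
    using 1 Cons.prems by (intro E_I V_mult Cons.IH)
  then show ?case using 1 by (simp add: algebra_simps del: lincombs.simps)
qed simp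

lemma E_finite: "finite (E us m)"
  by (induction us) (auto simp: V_finite)

lemma E_card: "card (E us m) \<le> (card k ^ length us) ^ (m + 1)"
proof (induction us)
  case (Cons u us)
  have "card (E (u # us) m) \<le> card (V m \<times> E us m)"
    unfolding lincombs.simps by (rule card_image_le) (simp add: V_finite E_finite)
  also have "\<dots> \<le> card k ^ (m + 1) * (card k ^ length us) ^ (m + 1)"
    unfolding card_cartesian_product by (rule mult_le_mono[OF V_card Cons])
  also have "\<dots> = (card k ^ length (u # us)) ^ (m + 1)"
    by (simp only: power_mult_distrib length_Cons power_Suc)
  finally show ?case .
qed simp

lemma E_elem: "u \<in> set us \<Longrightarrow> u \<in> E us m"
proof (induction us)
  case (Cons u' us)
  show ?case
  proof (cases "u = u'")
    case True
    then show ?thesis using E_I[OF N_in_V[OF k1] E_zero, where m = m and us = us and u = u] by simp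
  next
    case False
    then show ?thesis using E_I[OF V_zero, where m = m and w = u and us = us and u = u'] Cons by simp
  qed
qed simp

lemma fraction_lincomb_in_E:
  "x \<in> lincombs fractions us \<Longrightarrow> \<exists>h c. h \<noteq> 0 \<and> h \<in> V c \<and> h * x \<in> E us c"
proof (induction us arbitrary: x)
  case Nil
  then show ?case using k1 by (intro exI[of _ 1] exI[of _ 0]) simp
next
  case (Cons u us)
  then obtain v w where x: "x = v * u + w" "v \<in> fractions" "w \<in> lincombs fractions us" by auto
  then obtain h c h' c' where h: "h \<noteq> 0" "h \<in> V c" "h * w \<in> E us c" "h' \<noteq> 0" "h' \<in> V c'" "h' * v \<in> V c'"
    using Cons.IH[of w] by (auto simp: fractions_def)
  have "(h * (h' * v)) * u + h' * (h * w) \<in> E (u # us) (c + c')"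
    using V_mult[OF h(2,6)] E_mult[OF h(5,3)] by (intro E_I) (simp_all add: add.commute)
  then have "h * h' * x \<in> E (u # us) (c + c')"
    using x by (simp add: algebra_simps del: lincombs.simps)
  then show ?case using V_mult[OF h(2,5)] h(1,4) by (intro exI[of _ "h * h'"] exI[of _ "c + c'"]) simp
qed

lemma common_shift:
  assumes "\<And>x. x \<in> lincombs fractions us" "finite S"
  shows "\<exists>h c. h \<noteq> 0 \<and> h \<in> V c \<and> (\<forall>x\<in>S. h * x \<in> E us c)"
  using assms(2)
proof (induction S rule: finite_induct)
  case empty
  then show ?case using k1 by (intro exI[of _ 1] exI[of _ 0]) simp
next
  case (insert x S)
  then obtain h c where h: "h \<noteq> 0" "h \<in> V c" "\<And>x. x \<in> S \<Longrightarrow> h * x \<in> E us c" by blast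
  obtain h' c' where h': "h' \<noteq> 0" "h' \<in> V c'" "h' * x \<in> E us c'"
    using fraction_lincomb_in_E[OF assms(1)] by blast
  have "h' * h * y \<in> E us (c' + c)" if "y \<in> S" for y
    using E_mult[OF h'(2) h(3)[OF that]] by (simp add: mult.assoc)
  moreover have "h' * h * x \<in> E us (c' + c)"
    using E_mult[OF h(2) h'(3)] by (simp add: ac_simps)
  ultimately show ?case
    using V_mult[OF h'(2) h(2)] h(1) h'(1) by (intro exI[of _ "h' * h"] exI[of _ "c' + c"]) auto
qed

lemma linear_growth:
  assumes "\<And>x. x \<in> lincombs fractions us"
  shows "linear_growth k (E us) (card k ^ length us)"
proof
  show "\<exists>e\<in>E us 0. e \<noteq> 0"
  proof (rule ccontr)
    assume none: "\<not> (\<exists>e\<in>E us 0. e \<noteq> 0)"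
    obtain h c where h: "h \<noteq> 0" "h * 1 \<in> E us c"
      using fraction_lincomb_in_E[OF assms, of 1] by blast
    have "u = 0" if "u \<in> set us" for u using none E_elem[OF that] by blast
    then have "E us c \<subseteq> {0}" by (induction us) auto
    then show False using h by auto
  qed
  show "\<exists>h c. h \<noteq> 0 \<and> (\<forall>m. \<forall>x\<in>E us m. h * x \<in> E us (m + c) \<and> h * s * x \<in> E us (m + c))" for s
  proof -
    \<comment> \<open>Multiplication by \<open>s\<close> is controlled on the finitely many
      generators: a common denominator of the products \<open>s * u\<close> gives one shift that is
      valid for every \<open>m\<close>.\<close>
    obtain h c where h: "h \<noteq> 0" "h \<in> V c" "\<And>x. x \<in> (\<lambda>u. s * u) ` set us \<Longrightarrow> h * x \<in> E us c"
      using common_shift[OF assms, of "(\<lambda>u. s * u) ` set us"] by blast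
    have "h * s * x \<in> E us (m + c)" if "x \<in> E ws m" "set ws \<subseteq> set us" for x m ws
      using that
    proof (induction ws arbitrary: x)
      case (Cons u ws)
      from Cons.prems(1) obtain v w where 1: "x = v * u + w" "v \<in> V m" "w \<in> E ws m" by (rule E_ConsE)
      have "v * (h * (s * u)) + h * s * w \<in> E us (m + c)"
        using 1 Cons.prems h(3) by (intro E_add E_mult Cons.IH) auto
      then show ?case using 1 by (simp add: algebra_simps)
    qed (simp add: E_zero)
    moreover have "h * x \<in> E us (m + c)" if "x \<in> E us m" for x m
      using E_mult[OF h(2) that] by (simp add: add.commute)
    ultimately show ?thesis using h(1) by blast
  qed
  show "a * x \<in> E us m" if "a \<in> k" "x \<in> E us m" for a x m
    using E_mult[where n = 0 and a = a and x = x and us = us and m = m] that by simp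
qed (fact k_subring k_inverse k_finite E_finite E_card E_mono E_zero E_add)+

end

lemma function_field_constants:
  assumes "function_field_of_curve k"
  shows "subring_set k" "x \<in> k \<Longrightarrow> inverse x \<in> k" "finite k"
proof -
  interpret U: field "univ_ring :: 'a ring" by (rule field_from_type_algebra)
  have k: "subfield k univ_ring" "finite k" using assms by (auto simp: function_field_of_curve_def)
  show "subring_set k" "finite k" using k subfieldE(1) by (auto intro: subring_set_if_subring)
  show "inverse x \<in> k" if "x \<in> k"
    using U.subfield_m_inv(1)[OF k(1), of x] that by (cases "x = 0") auto
qed

lemma function_field_linear_growth:
  assumes "function_field_of_curve (k :: 'k::field set)"
  shows "\<exists>E q. linear_growth k E q"
proof -
  interpret U: field "univ_ring :: 'k ring" by (rule field_from_type_algebra)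
  obtain t where "U.finite_dimension (generate_field univ_ring (insert t k)) UNIV"
    using assms by (auto simp: function_field_of_curve_def)
  then obtain n where "U.dimension n (generate_field univ_ring (insert t k)) UNIV"
    unfolding U.finite_dimension_def ..
  from dimension_lincombs[OF this] obtain us where us: "lincombs (generate_field univ_ring (insert t k)) us = UNIV" ..
  interpret curve_field k t
    using function_field_constants[OF assms] by unfold_locales
  have "x \<in> lincombs fractions us" for x
    using lincombs_mono[OF generate_field_fractions, of us] us by auto
  then show ?thesis using linear_growth by blast
qed

text \<open>A non-trivial relation makes \<open>x\<close> algebraic over \<open>k\<close>, and
  \<open>k\<close> is algebraically closed in K.\<close>

lemma function_field_transcendental:
  assumes "function_field_of_curve k" "\<And>i. a i \<in> k" "(\<Sum>i<n. a i * x ^ i) = 0" "j < n" "a j \<noteq> (0::'k::field)"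
  shows "x \<in> k"
proof -
  interpret U: field "univ_ring :: 'k ring" by (rule field_from_type_algebra)
  \<comment> \<open>Polynomials are lists with non-zero leading coefficient, so the relation is cut
    off at its last non-zero term.\<close>
  define m where "m = Max {i. i < n \<and> a i \<noteq> 0}"
  have "m \<in> {i. i < n \<and> a i \<noteq> 0}" unfolding m_def using assms by (intro Max_in) auto
  then have m: "m < n" "a m \<noteq> 0" by auto
  have top: "a i = 0" if "m < i" "i < n" for i
  proof (rule ccontr)
    assume "a i \<noteq> 0"
    then have "i \<le> m" unfolding m_def using that by (intro Max_ge) auto
    then show False using that by simp
  qed
  let ?as = "map a [0..<Suc m]"
  have "U.eval (rev ?as) x = (\<Sum>i<Suc m. a i * x ^ i)"
    unfolding eval_univ_ring_rev by (rule sum.cong) (auto simp del: upt_Suc)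
  also have "\<dots> = (\<Sum>i<n. a i * x ^ i)"
    using m(1) top by (intro sum.mono_neutral_left) auto
  finally have "U.eval (rev ?as) x = 0" using assms(3) by simp
  moreover have "rev ?as \<in> carrier (univ_poly univ_ring k)"
    using assms(2) m(2) by (auto simp: univ_poly_def polynomial_def)
  ultimately have "U.algebraic k x"
    using U.algebraicI[of "rev ?as" k x] by (simp add: over_def)
  then show ?thesis using assms(1) by (auto simp: function_field_of_curve_def)
qed


section \<open>Valuation rings\<close>

definition valuation_set :: "'k::field set \<Rightarrow> bool" where
  "valuation_set Q \<longleftrightarrow> subring_set Q \<and> (\<forall>x. x \<in> Q \<or> inverse x \<in> Q)"

definition ring_ideal :: "'k::field set \<Rightarrow> 'k set \<Rightarrow> bool" where
  "ring_ideal Q N \<longleftrightarrow> subring_set Q \<and> N \<subseteq> Q \<and> 0 \<in> N \<and> 1 \<notin> N \<and>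
    (\<forall>x\<in>N. \<forall>y\<in>N. x + y \<in> N) \<and> (\<forall>a\<in>Q. \<forall>x\<in>N. a * x \<in> N)"

lemma ring_idealD:
  assumes "ring_ideal Q N"
  shows "subring_set Q" "N \<subseteq> Q" "0 \<in> N" "1 \<notin> N" "x \<in> N \<Longrightarrow> y \<in> N \<Longrightarrow> x + y \<in> N" "a \<in> Q \<Longrightarrow> x \<in> N \<Longrightarrow> a * x \<in> N"
    "x \<in> N \<Longrightarrow> x \<in> Q" "x \<in> N \<Longrightarrow> - x \<in> N"
proof -
  show sr: "subring_set Q" and "N \<subseteq> Q" "0 \<in> N" "1 \<notin> N"
    using assms by (auto simp: ring_ideal_def)
  show "x \<in> N \<Longrightarrow> y \<in> N \<Longrightarrow> x + y \<in> N" using assms by (auto simp: ring_ideal_def)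
  have *: "\<And>a x. a \<in> Q \<Longrightarrow> x \<in> N \<Longrightarrow> a * x \<in> N" using assms by (auto simp: ring_ideal_def)
  then show "a \<in> Q \<Longrightarrow> x \<in> N \<Longrightarrow> a * x \<in> N" by blast
  show "x \<in> N \<Longrightarrow> x \<in> Q" using assms by (auto simp: ring_ideal_def)
  show "- x \<in> N" if "x \<in> N"
    using *[OF subring_setD(6)[OF sr subring_setD(1)[OF sr]] that] by simp
qed

lemma ring_ideal_poly_module:
  assumes "ring_ideal Q N"
  shows "poly_module Q N" "poly_module Q Q"
  using ring_idealD[OF assms] subring_setD[OF ring_idealD(1)[OF assms]] by unfold_locales auto

text \<open>Passing to Q[y] and the extended ideal can destroy only properness, and
  \<open>no1\<close> excludes this.\<close>

lemma ring_ideal_adjoin: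
  assumes QN: "ring_ideal Q N" and no1: "\<And>n. 1 \<notin> bounded_polys N y n"
  shows "ring_ideal (\<Union>n. bounded_polys Q y n) (\<Union>n. bounded_polys N y n)"
proof -
  interpret N: poly_module Q N y by (rule ring_ideal_poly_module[OF QN])
  interpret Q: poly_module Q Q y by (rule ring_ideal_poly_module[OF QN])
  note Q = ring_idealD[OF QN]
  have join: "\<exists>n. x \<in> bounded_polys M y n \<and> x' \<in> bounded_polys M y n"
    if "poly_module Q M" "x \<in> (\<Union>n. bounded_polys M y n)" "x' \<in> (\<Union>n. bounded_polys M y n)" for x x' M
  proof -
    interpret M: poly_module Q M y by fact
    from that obtain m n where "x \<in> M.V m" "x' \<in> M.V n" by auto
    then show ?thesis
      using M.V_mono[of m "max m n"] M.V_mono[of n "max m n"] by auto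
  qed
  show ?thesis
    unfolding ring_ideal_def subring_set_def
  proof (intro conjI ballI)
    show "1 \<in> (\<Union>n. Q.V n)" using Q.N_in_V[OF subring_setD(1)[OF Q(1)], of 0] by blast
    show "(\<Union>n. N.V n) \<subseteq> (\<Union>n. Q.V n)"
    proof -
      have "N.V n \<subseteq> Q.V n" for n
        using Q(2) by (induction n) auto
      then show ?thesis by blast
    qed
    show "0 \<in> (\<Union>n. N.V n)" using N.V_zero by blast
    show "1 \<notin> (\<Union>n. N.V n)" using no1 by blast
  next
    fix x x' assume "x \<in> (\<Union>n. Q.V n)" "x' \<in> (\<Union>n. Q.V n)"
    then obtain n where n: "x \<in> Q.V n" "x' \<in> Q.V n"
      using join[OF Q.poly_module_axioms] by blast
    have "- 1 * x' \<in> Q.V n"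
      using subring_setD(1,6)[OF Q(1)] n(2) by (intro Q.V_scale) auto
    then have "x + - 1 * x' \<in> Q.V n" using n(1) by (intro Q.V_add)
    then show "x - x' \<in> (\<Union>n. Q.V n)" by (auto intro!: UN_I[of n])
    show "x * x' \<in> (\<Union>n. Q.V n)" using Q.V_mult[OF n] by blast
  next
    fix x x' assume "x \<in> (\<Union>n. N.V n)" "x' \<in> (\<Union>n. N.V n)"
    then obtain n where "x \<in> N.V n" "x' \<in> N.V n"
      using join[OF N.poly_module_axioms] by blast
    then show "x + x' \<in> (\<Union>n. N.V n)" using N.V_add by blast
  next
    fix a x assume "a \<in> (\<Union>n. Q.V n)" "x \<in> (\<Union>n. N.V n)"
    then show "a * x \<in> (\<Union>n. N.V n)" using N.V_mult by blast
  qed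
qed

section \<open>Maximal pairs and Chevalley's extension theorem\<close>

definition maximal_ring_ideal :: "'k::field set \<Rightarrow> 'k set \<Rightarrow> bool" where
  "maximal_ring_ideal Q N \<longleftrightarrow> ring_ideal Q N \<and>
    (\<forall>Q' N'. ring_ideal Q' N' \<longrightarrow> Q \<subseteq> Q' \<longrightarrow> N \<subseteq> N' \<longrightarrow> Q' = Q \<and> N' = N)"

lemma maximal_ring_ideal_mem:
  assumes QN: "maximal_ring_ideal Q N" and no1: "\<And>n. 1 \<notin> bounded_polys N y n"
  shows "y \<in> Q"
proof -
  have id: "ring_ideal Q N" using QN by (simp add: maximal_ring_ideal_def)
  interpret N: poly_module Q N y by (rule ring_ideal_poly_module[OF id])
  interpret Q: poly_module Q Q y by (rule ring_ideal_poly_module[OF id])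
  have "Q \<subseteq> (\<Union>n. Q.V n)" "N \<subseteq> (\<Union>n. N.V n)" using Q.N_in_V[of _ 0] N.N_in_V[of _ 0] by blast+
  then have "(\<Union>n. Q.V n) = Q"
    using QN ring_ideal_adjoin[OF id no1] by (simp add: maximal_ring_ideal_def)
  moreover have "y \<in> Q.V (Suc 0)"
    using Q.V_I[OF Q.N_zero, of 1 0] subring_setD(1)[OF ring_idealD(1)[OF id]] by simp
  ultimately show ?thesis by blast
qed

text \<open>A relation for 1 in powers of the inverse of \<open>1 - a\<close>, multiplied by (1 -
  a)^n, would put (1 - a)^n into \<open>N\<close>; but this power is congruent to 1 modulo
  \<open>N\<close>.\<close>

lemma maximal_ring_ideal_unit:
  assumes QN: "maximal_ring_ideal Q N" and a: "a \<in> N"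
  shows "inverse (1 - a) \<in> Q"
proof (rule maximal_ring_ideal_mem[OF QN])
  fix n
  have id: "ring_ideal Q N" using QN by (simp add: maximal_ring_ideal_def)
  note Q = ring_idealD[OF id]
  have a1: "1 - a \<noteq> 0" using Q(4) a by auto
  have u: "1 - a \<in> Q" using subring_setD(1,4)[OF Q(1)] Q(7)[OF a] by blast
  show "1 \<notin> bounded_polys N (inverse (1 - a)) n"
  proof
    have *: "(1 - a) ^ n * x \<in> N" if "x \<in> bounded_polys N (inverse (1 - a)) n" for x n
      using that
    proof (induction n arbitrary: x)
      case (Suc n)
      then obtain b v where x: "x = b + inverse (1 - a) * v" "b \<in> N" "v \<in> bounded_polys N (inverse (1 - a)) n"
        by auto
      have "(1 - a) ^ Suc n * b + (1 - a) ^ n * v \<in> N"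
        using x u by (intro Q(5,6) subring_set_power[OF Q(1)] Suc.IH)
      also have "(1 - a) ^ Suc n * b + (1 - a) ^ n * v = (1 - a) ^ Suc n * x"
        using a1 by (simp add: x(1) field_simps)
      finally show ?case .
    qed simp
    have pow: "1 - (1 - a) ^ n \<in> N" for n
    proof (induction n)
      case (Suc n)
      have "(1 - (1 - a) ^ n) + (1 - a) ^ n * a \<in> N"
        using Suc u a by (intro Q(5,6) subring_set_power[OF Q(1)])
      then show ?case by (simp add: algebra_simps)
    qed (simp add: Q(3))
    assume "1 \<in> bounded_polys N (inverse (1 - a)) n"
    then have "(1 - a) ^ n \<in> N" using *[of 1 n] by simp
    with pow[of n] have "(1 - (1 - a) ^ n) + (1 - a) ^ n \<in> N" by (rule Q(5))
    then show False using Q(4) by simp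
  qed
qed

text \<open>If \<open>1 = b\<^sub>0 + b\<^sub>1 y\<^sup>-\<^sup>1 + \<dots> + b\<^sub>m y\<^sup>-\<^sup>m\<close>, then \<open>y\<close> is a combination of \<open>1, \<dots>, y\<^sup>1\<^sup>-\<^sup>m\<close>, which lowers
  the degree of a relation \<open>1 = a\<^sub>0 + \<dots> + a\<^sub>n y\<^sup>n\<close> with \<open>m \<le> n\<close>.\<close>

lemma maximal_ring_ideal_reduce:
  assumes QN: "maximal_ring_ideal Q N" and y: "y \<noteq> 0"
    and 1: "1 \<in> bounded_polys N y n" "1 \<in> bounded_polys N (inverse y) m" and mn: "m \<le> n"
  shows "\<exists>n'<n. 1 \<in> bounded_polys N y n'"
proof -
  have id: "ring_ideal Q N" using QN by (simp add: maximal_ring_ideal_def)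
  note Q = ring_idealD[OF id]
  interpret N: poly_module Q N y by (rule ring_ideal_poly_module[OF id])
  interpret Q: poly_module Q Q y by (rule ring_ideal_poly_module[OF id])
  interpret N': poly_module Q N "inverse y" by (rule ring_ideal_poly_module[OF id])
  obtain m' where m': "m = Suc m'" using 1(2) Q(4) by (cases m) auto
  obtain n' where n': "n = Suc n'" using mn m' by (cases n) auto
  obtain b w where b: "1 = b + inverse y * w" "b \<in> N" "w \<in> N'.V m'"
    using 1(2) unfolding m' by (rule N'.V_SucE)
  \<comment> \<open>As \<open>1 - b\<close> is invertible in \<open>Q\<close>, the relation writes y
    as u w, of degree m' in 1/y. Then y^(n'+1) = y^n' u w has degree at most n' in y, with
    coefficients in \<open>N\<close>.\<close>
  define u where "u = inverse (1 - b)"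
  have uQ: "u \<in> Q" unfolding u_def by (rule maximal_ring_ideal_unit[OF QN b(2)])
  have "1 - b \<noteq> 0" using b(2) Q(4) by auto
  moreover have "y * (1 - b) = w" using b(1) y by (simp add: field_simps)
  ultimately have yw: "y = u * w" unfolding u_def by (simp add: field_simps)
  have uw: "u * w \<in> N'.V m'" by (rule N'.V_scale[OF uQ b(3)])
  have ypow: "y ^ j \<in> Q.V j" for j
  proof (induction j)
    case (Suc j)
    then show ?case using Q.V_I[OF Q.N_zero] by (simp del: bounded_polys.simps(2))
  qed (simp add: subring_setD(1)[OF Q(1)])
  have rev: "y ^ j * x \<in> N.V j" if "x \<in> N'.V j" for x j
    using that
  proof (induction j arbitrary: x)
    case (Suc j)
    then obtain b v where x: "x = b + inverse y * v" "b \<in> N" "v \<in> N'.V j" by (auto elim!: N'.V_SucE simp del: bounded_polys.simps)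
    have "y ^ Suc j * b \<in> N.V (Suc j)" using N.V_mult[OF ypow[of "Suc j"], of b 0] x(2) by simp
    moreover have "y ^ j * v \<in> N.V (Suc j)" using Suc.IH[OF x(3)] N.V_Suc_mono by blast
    ultimately have "y ^ Suc j * b + y ^ j * v \<in> N.V (Suc j)" by (rule N.V_add)
    also have "y ^ Suc j * b + y ^ j * v = y ^ Suc j * x"
    proof -
      have "y ^ Suc j * (inverse y * v) = y ^ j * v" using y by (simp add: field_simps)
      then show ?thesis by (simp only: x(1) distrib_left)
    qed
    finally show ?case .
  qed simp
  have top: "\<exists>v\<in>N.V j. \<exists>a\<in>N. x = v + a * y ^ Suc j" if "x \<in> N.V (Suc j)" for x j
    using that
  proof (induction j arbitrary: x)
    case 0
    then obtain b v where x: "x = b + y * v" "b \<in> N" "v \<in> N.V 0" by (rule N.V_SucE)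
    then show ?case by (intro bexI[of _ b] bexI[of _ v]) auto
  next
    case (Suc j)
    from Suc.prems obtain b v where x: "x = b + y * v" "b \<in> N" "v \<in> N.V (Suc j)" by (rule N.V_SucE)
    then obtain v' a where "v' \<in> N.V j" "a \<in> N" "v = v' + a * y ^ Suc j" using Suc.IH by blast
    then show ?case
      using x N.V_I[of b v' j] by (intro bexI[of _ "b + y * v'"] bexI[of _ a]) (auto simp: algebra_simps simp del: bounded_polys.simps)
  qed
  obtain v a where v: "v \<in> N.V n'" "a \<in> N" "1 = v + a * y ^ Suc n'"
    using top[of 1 n'] 1(1) n' by blast
  have "y ^ (n' - m') * (y ^ m' * (u * w)) \<in> N.V (n' - m' + m')"
    by (intro N.V_mult ypow rev uw)
  moreover have "y ^ (n' - m') * (y ^ m' * (u * w)) = y ^ Suc n'"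
  proof -
    have "y ^ (n' - m') * y ^ m' = y ^ n'" using mn m' n' by (simp flip: power_add)
    then show ?thesis using yw by (metis mult.assoc power_Suc2)
  qed
  ultimately have "y ^ Suc n' \<in> N.V n'" using mn m' n' by simp
  then have "a * y ^ Suc n' \<in> N.V n'" using v(2) Q(7) by (intro N.V_scale) auto
  then have "v + a * y ^ Suc n' \<in> N.V n'" using v(1) by (intro N.V_add)
  then show ?thesis using v(3) n' by auto
qed

text \<open>If neither \<open>y\<close> nor its inverse lay in \<open>Q\<close>, both would admit a
  relation for 1 over \<open>N\<close>. With the degrees least possible, the relation of larger or
  equal degree could still be shortened by the other.\<close>

lemma maximal_ring_ideal_valuation:
  assumes QN: "maximal_ring_ideal Q N"
  shows "valuation_set Q"
  unfolding valuation_set_def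
proof (intro conjI allI)
  have id: "ring_ideal Q N" using QN by (simp add: maximal_ring_ideal_def)
  show "subring_set Q" by (rule ring_idealD(1)[OF id])
  fix y
  show "y \<in> Q \<or> inverse y \<in> Q"
  proof (rule ccontr)
    assume no: "\<not> (y \<in> Q \<or> inverse y \<in> Q)"
    then have y: "y \<noteq> 0" using ring_idealD(3,7)[OF id] by auto
    define n where "n = (LEAST n. 1 \<in> bounded_polys N y n)"
    define m where "m = (LEAST n. 1 \<in> bounded_polys N (inverse y) n)"
    have "\<exists>n. 1 \<in> bounded_polys N y n" "\<exists>n. 1 \<in> bounded_polys N (inverse y) n"
      using no maximal_ring_ideal_mem[OF QN] by blast+
    then have nm: "1 \<in> bounded_polys N y n" "1 \<in> bounded_polys N (inverse y) m"
      unfolding n_def m_def by (auto intro: LeastI_ex)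
    have least: "\<not> (\<exists>n'<n. 1 \<in> bounded_polys N y n')" "\<not> (\<exists>n'<m. 1 \<in> bounded_polys N (inverse y) n')"
      unfolding n_def m_def by (auto dest: not_less_Least)
    show False
    proof (cases "m \<le> n")
      case True
      then show False using maximal_ring_ideal_reduce[OF QN y nm] least(1) by blast
    next
      case False
      then show False
        using maximal_ring_ideal_reduce[OF QN _ nm(2), of n] y nm(1) least(2) by simp
    qed
  qed
qed

text \<open>A maximal pair above \<open>B\<close> and \<open>N0\<close> has a valuation ring as its
  first member, and its proper ideal contains no unit of that ring.\<close>

lemma chevalley_extension:
  assumes "ring_ideal B N0"
  shows "\<exists>Q. valuation_set Q \<and> B \<subseteq> Q \<and> (\<forall>x\<in>N0. x = 0 \<or> inverse x \<notin> Q)"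
proof -
  \<comment> \<open>A pair of sets is coded as one subset of the product with \<open>bool\<close>,
    so that the order on pairs becomes inclusion and Zorn's lemma for sets applies.\<close>
  define rg where "rg S = {x. (x, True) \<in> S}" for S :: "('a \<times> bool) set"
  define il where "il S = {x. (x, False) \<in> S}" for S :: "('a \<times> bool) set"
  define mk where "mk Q N = Q \<times> {True} \<union> N \<times> {False}" for Q N :: "'a set"
  have [simp]: "rg (mk Q N) = Q" "il (mk Q N) = N" for Q N
    by (auto simp: rg_def il_def mk_def)
  define good where "good = {S. ring_ideal (rg S) (il S) \<and> B \<subseteq> rg S \<and> N0 \<subseteq> il S}"
  have "mk B N0 \<in> good" using assms by (simp add: good_def)
  then have "good \<noteq> {}" by blast
  moreover have "\<Union>C \<in> good" if C: "C \<noteq> {}" "subset.chain good C" for C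
  proof -
    have Cg: "S \<in> good" if "S \<in> C" for S using that C(2) by (auto simp: subset_chain_def)
    have two: "\<exists>S\<in>C. p \<in> S \<and> p' \<in> S" if "p \<in> \<Union>C" "p' \<in> \<Union>C" for p p'
      using that C(2) unfolding subset_chain_def by blast
    have id: "ring_ideal (rg S) (il S)" if "S \<in> C" for S using Cg[OF that] by (simp add: good_def)
    have rgU: "x \<in> rg (\<Union>C) \<longleftrightarrow> (x, True) \<in> \<Union>C" and ilU: "x \<in> il (\<Union>C) \<longleftrightarrow> (x, False) \<in> \<Union>C" for x
      by (simp_all add: rg_def il_def)
    have memU: "x \<in> rg S \<Longrightarrow> S \<in> C \<Longrightarrow> x \<in> rg (\<Union>C)" "x \<in> il S \<Longrightarrow> S \<in> C \<Longrightarrow> x \<in> il (\<Union>C)" for x S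
      by (auto simp: rg_def il_def)
    obtain S0 where S0: "S0 \<in> C" using C(1) by blast
    have "ring_ideal (rg (\<Union>C)) (il (\<Union>C))"
      unfolding ring_ideal_def subring_set_def
    proof (intro conjI ballI)
      show "1 \<in> rg (\<Union>C)"
        by (rule memU(1)[OF subring_setD(1)[OF ring_idealD(1)[OF id[OF S0]]] S0])
      show "0 \<in> il (\<Union>C)" by (rule memU(2)[OF ring_idealD(3)[OF id[OF S0]] S0])
      show "il (\<Union>C) \<subseteq> rg (\<Union>C)"
      proof
        fix x assume "x \<in> il (\<Union>C)"
        then obtain S where "S \<in> C" "x \<in> il S" by (auto simp: il_def)
        then show "x \<in> rg (\<Union>C)" using ring_idealD(7)[OF id] memU(1) by blast
      qed
      show "1 \<notin> il (\<Union>C)"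
      proof
        assume "1 \<in> il (\<Union>C)"
        then obtain S where "S \<in> C" "1 \<in> il S" by (auto simp: il_def)
        then show False using ring_idealD(4)[OF id] by blast
      qed
    next
      fix x y assume "x \<in> rg (\<Union>C)" "y \<in> rg (\<Union>C)"
      then obtain S where S: "S \<in> C" "x \<in> rg S" "y \<in> rg S" using two rgU by (auto simp: rg_def) blast
      show "x - y \<in> rg (\<Union>C)" "x * y \<in> rg (\<Union>C)"
        using S by (auto intro!: memU(1)[of _ S] subring_setD(4,5) ring_idealD(1)[OF id])
    next
      fix x y assume "x \<in> il (\<Union>C)" "y \<in> il (\<Union>C)"
      then obtain S where S: "S \<in> C" "x \<in> il S" "y \<in> il S" using two ilU by (auto simp: il_def) blast
      show "x + y \<in> il (\<Union>C)"
        using S ring_idealD(5)[OF id] by (intro memU(2)[of _ S]) auto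
    next
      fix x y assume "x \<in> rg (\<Union>C)" "y \<in> il (\<Union>C)"
      then obtain S where S: "S \<in> C" "(x, True) \<in> S" "(y, False) \<in> S" using two rgU ilU by blast
      then show "x * y \<in> il (\<Union>C)"
        using ring_idealD(6)[OF id] by (intro memU(2)[of _ S]) (auto simp: rg_def il_def)
    qed
    moreover have "B \<subseteq> rg (\<Union>C)" "N0 \<subseteq> il (\<Union>C)"
      using Cg[OF S0] memU[OF _ S0] by (auto simp: good_def)
    ultimately show ?thesis by (simp add: good_def)
  qed
  ultimately obtain M where M: "M \<in> good" "\<And>S. S \<in> good \<Longrightarrow> M \<subseteq> S \<Longrightarrow> S = M"
    using subset_Zorn_nonempty[of good] by blast
  have "maximal_ring_ideal (rg M) (il M)"
    unfolding maximal_ring_ideal_def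
  proof (intro conjI allI impI)
    show "ring_ideal (rg M) (il M)" using M(1) by (simp add: good_def)
    fix Q N assume *: "ring_ideal Q N" "rg M \<subseteq> Q" "il M \<subseteq> N"
    have "mk Q N \<in> good" using M(1) * by (auto simp: good_def)
    moreover have "M \<subseteq> mk Q N"
    proof
      fix p assume "p \<in> M"
      then show "p \<in> mk Q N" using * by (cases p, cases "snd p") (auto simp: mk_def rg_def il_def)
    qed
    ultimately have "mk Q N = M" by (rule M(2))
    then show "Q = rg M" "N = il M" by auto
  qed
  then have "valuation_set (rg M)" by (rule maximal_ring_ideal_valuation)
  moreover have "B \<subseteq> rg M" using M(1) by (simp add: good_def)
  moreover have "inverse x \<notin> rg M" if "x \<in> N0" "x \<noteq> 0" for x
  proof
    assume "inverse x \<in> rg M"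
    moreover have id: "ring_ideal (rg M) (il M)" and "x \<in> il M" using M(1) that by (auto simp: good_def)
    ultimately have "inverse x * x \<in> il M" using ring_idealD(6)[OF id] by blast
    then show False using ring_idealD(4)[OF id] that by simp
  qed
  ultimately show ?thesis by blast
qed

lemma valuation_set_total:
  assumes "valuation_set Q"
  shows "x / y \<in> Q \<or> y / x \<in> Q"
  using assms by (auto simp: valuation_set_def)

definition nonunits :: "'k::field set \<Rightarrow> 'k set" where
  "nonunits Q = {x \<in> Q. x = 0 \<or> inverse x \<notin> Q}"

text \<open>Of two non-zero elements one divides the other, so a sum is a multiple of one summand,
  as in x + y = (1 + x/y) y.\<close>

lemma ring_ideal_nonunits:
  assumes "valuation_set Q"
  shows "ring_ideal Q (nonunits Q)"
proof -
  have Q: "subring_set Q" using assms by (simp add: valuation_set_def)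
  note Qs = subring_setD[OF Q]
  have mult: "a * x \<in> nonunits Q" if "a \<in> Q" "x \<in> nonunits Q" for a x
  proof (rule ccontr)
    assume "a * x \<notin> nonunits Q"
    then have "a * x \<noteq> 0" "inverse (a * x) \<in> Q" using that Qs(5) by (auto simp: nonunits_def)
    then have eq: "inverse x = a * inverse (a * x)" and "x \<noteq> 0" by auto
    have "inverse x \<in> Q" unfolding eq by (rule Qs(5)[OF that(1) \<open>inverse (a * x) \<in> Q\<close>])
    then show False using that \<open>x \<noteq> 0\<close> by (simp add: nonunits_def)
  qed
  have add: "x + y \<in> nonunits Q" if "x \<in> nonunits Q" "y \<in> nonunits Q" for x y
  proof (cases "x = 0 \<or> y = 0")
    case False
    have "(1 + x / y) * y \<in> nonunits Q \<or> (1 + y / x) * x \<in> nonunits Q"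
      using valuation_set_total[OF assms, of x y] that mult Qs(1,3) by blast
    then show ?thesis using False by (auto simp: field_simps)
  qed (use that in auto)
  show ?thesis
    unfolding ring_ideal_def
    using Q Qs(1,2) add mult by (auto simp: nonunits_def)
qed

lemma ring_ideal_sum: "ring_ideal Q N \<Longrightarrow> (\<And>i. i \<in> S \<Longrightarrow> f i \<in> N) \<Longrightarrow> sum f S \<in> N"
  by (induction S rule: infinite_finite_induct) (auto intro: ring_idealD)

lemma closed_points_valuation_set:
  assumes "Q \<in> closed_points k"
  shows "valuation_set Q" "k \<subseteq> Q" "Q \<noteq> UNIV"
  using assms subring_set_if_subring by (auto simp: closed_points_def valuation_set_def)

lemma subring_if_subring_set:
  assumes "subring_set (Q :: 'k::field set)"
  shows "subring Q univ_ring"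
proof -
  interpret U: ring "univ_ring :: 'k ring" by (rule ring_from_type_algebra)
  show ?thesis by (rule U.subringI) (use subring_setD[OF assms] in auto)
qed

lemma closed_pointsI:
  assumes "valuation_set Q" "k \<subseteq> Q" "Q \<noteq> UNIV"
  shows "Q \<in> closed_points k"
  using assms subring_if_subring_set by (auto simp: closed_points_def valuation_set_def)

section \<open>Functions regular away from infinity\<close>

locale curve =
  fixes k R A :: "'k::field set" and \<pi> :: 'k
  assumes function_field: "function_field_of_curve k"
    and R_closed_point: "R \<in> closed_points k"
    and A_def: "A = regular_functions_away k R"
    and \<pi>_uniformizer: "uniformizer R \<pi>"
begin

lemma R_valuation: "valuation_set R" and k_R: "k \<subseteq> R" and R_proper: "R \<noteq> UNIV"
  using closed_points_valuation_set[OF R_closed_point] by auto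

lemma R_subring: "subring_set R"
  using R_valuation by (simp add: valuation_set_def)

lemma k_subring: "subring_set k" and k_inverse: "x \<in> k \<Longrightarrow> inverse x \<in> k"
  using function_field_constants[OF function_field] by auto

lemma nonunits_R: "nonunits R = (\<lambda>a. a * \<pi>) ` R"
  using \<pi>_uniformizer by (simp add: uniformizer_def nonunits_def)

lemma \<pi>_nonunit: "\<pi> \<in> nonunits R"
  unfolding nonunits_R using subring_setD(1)[OF R_subring] by (intro image_eqI[of _ _ 1]) auto

lemma \<pi>_nonzero: "\<pi> \<noteq> 0"
proof
  assume "\<pi> = 0"
  then have "nonunits R \<subseteq> {0}" by (auto simp: nonunits_R)
  moreover obtain x where "x \<notin> R" using R_proper by blast
  then have "inverse x \<in> nonunits R" "inverse x \<noteq> 0"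
    using R_valuation subring_setD(2)[OF R_subring] by (auto simp: nonunits_def valuation_set_def)
  ultimately show False by blast
qed

lemma \<pi>_R: "\<pi> \<in> R"
  using \<pi>_nonunit by (auto simp: nonunits_def)

lemma not_R_iff: "x \<notin> R \<Longrightarrow> inverse x / \<pi> \<in> R"
proof -
  assume x: "x \<notin> R"
  then have "inverse x \<in> nonunits R"
    using R_valuation by (auto simp: nonunits_def valuation_set_def)
  then show ?thesis using \<pi>_nonzero by (auto simp: nonunits_R)
qed

lemma A_subring: "subring_set A"
  unfolding A_def regular_functions_away_def subring_set_def
proof (intro conjI ballI InterI)
  fix Q assume "Q \<in> closed_points k - {R}"
  then have Q: "subring_set Q" using closed_points_valuation_set[of Q k] by (simp add: valuation_set_def)
  then show "1 \<in> Q" by (rule subring_setD)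
  fix x y assume "x \<in> \<Inter> (closed_points k - {R})" "y \<in> \<Inter> (closed_points k - {R})"
  then have "x \<in> Q" "y \<in> Q" using \<open>Q \<in> closed_points k - {R}\<close> by auto
  then show "x - y \<in> Q" "x * y \<in> Q" by (auto intro: subring_setD[OF Q])
qed

lemma k_A: "k \<subseteq> A"
  using closed_points_valuation_set(2) by (fastforce simp: A_def regular_functions_away_def)

lemma A_subset: "Q \<in> closed_points k \<Longrightarrow> Q \<noteq> R \<Longrightarrow> A \<subseteq> Q"
  by (auto simp: A_def regular_functions_away_def)

lemma power_relation_in_k:
  assumes "\<And>i. a i \<in> k" "(\<Sum>i<n. a i * x ^ i) = 0" "j < n" "a j \<noteq> 0"
  shows "x \<in> k"
  using function_field_transcendental[OF function_field assms] .

lemma bounded_polys_sum: "x \<in> bounded_polys k t n \<Longrightarrow> \<exists>a. (\<forall>i. a i \<in> k) \<and> x = (\<Sum>i<Suc n. a i * t ^ i)"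
proof (induction n arbitrary: x)
  case 0
  then show ?case by (intro exI[of _ "\<lambda>_. x"]) simp
next
  case (Suc n)
  then obtain b v where x: "x = b + t * v" "b \<in> k" "v \<in> bounded_polys k t n" by auto
  then obtain a where a: "\<forall>i. a i \<in> k" "v = (\<Sum>i<Suc n. a i * t ^ i)" using Suc.IH by blast
  have "x = (\<Sum>i<Suc (Suc n). (case i of 0 \<Rightarrow> b | Suc i \<Rightarrow> a i) * t ^ i)"
    unfolding x(1) a(2) sum.lessThan_Suc_shift[of _ "Suc n"] by (simp add: sum_distrib_left algebra_simps del: sum.lessThan_Suc)
  moreover have "\<forall>i. (case i of 0 \<Rightarrow> b | Suc i \<Rightarrow> a i) \<in> k" using x(2) a(1) by (auto split: nat.split)
  ultimately show ?case by (intro exI[of _ "\<lambda>i. case i of 0 \<Rightarrow> b | Suc i \<Rightarrow> a i"]) blast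
qed

text \<open>A function without poles is constant, so one that also vanishes at \<open>\<infinity>\<close> is zero.\<close>

lemma A_nonunit_zero:
  assumes "x \<in> A" "x \<in> nonunits R"
  shows "x = 0"
proof (rule ccontr)
  assume x0: "x \<noteq> 0"
  define y where "y = inverse x"
  have y: "y \<notin> R" "y \<noteq> 0" using assms(2) x0 by (auto simp: nonunits_def y_def)
  then have yk: "y \<notin> k" using k_R by blast
  interpret K: poly_module k k y using k_subring subring_setD[OF k_subring] by unfold_locales
  \<comment> \<open>This is k[y], and the ideal generated by \<open>y\<close> is proper because
    \<open>y\<close> is transcendental. A valuation ring over k[y] with \<open>y\<close> a non-unit
    does not contain x = 1/y. It differs from \<open>R\<close>, which contains x, so x has a pole
    away from infinity.\<close>
  define B where "B = (\<Union>n. K.V n)"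
  have yV: "y * v \<in> K.V (Suc n)" if "v \<in> K.V n" for v n
    using K.V_I[OF K.N_zero that] by (simp del: bounded_polys.simps)
  have join: "\<exists>n. u \<in> K.V n \<and> v \<in> K.V n" if "u \<in> B" "v \<in> B" for u v
  proof -
    from that obtain m n where "u \<in> K.V m" "v \<in> K.V n" by (auto simp: B_def)
    then show ?thesis using K.V_mono[of m "max m n"] K.V_mono[of n "max m n"] by auto
  qed
  have B: "subring_set B"
    unfolding subring_set_def
  proof (intro conjI ballI)
    show "1 \<in> B" unfolding B_def using K.N_in_V[OF subring_setD(1)[OF k_subring], of 0] by blast
    fix u v assume "u \<in> B" "v \<in> B"
    then obtain n where n: "u \<in> K.V n" "v \<in> K.V n" using join by blast
    have "- 1 * v \<in> K.V n"
      using subring_setD(1,6)[OF k_subring] n(2) by (intro K.V_scale) auto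
    then have "u + - 1 * v \<in> K.V n" using n(1) by (intro K.V_add)
    then show "u - v \<in> B" unfolding B_def by (auto intro!: UN_I[of n])
    show "u * v \<in> B" unfolding B_def using K.V_mult[OF n] by blast
  qed
  have kB: "k \<subseteq> B" and yB: "y * v \<in> B" if "v \<in> B" for v
    using K.N_in_V[of _ 0] yV that unfolding B_def by blast+
  have 1: "1 \<in> B" by (rule subring_setD(1)[OF B])
  have "1 \<notin> (\<lambda>v. y * v) ` B"
  proof
    assume "1 \<in> (\<lambda>v. y * v) ` B"
    then obtain n v where v: "v \<in> K.V n" "1 = y * v" by (auto simp: B_def)
    then obtain a where a: "\<forall>i. a i \<in> k" "v = (\<Sum>i<Suc n. a i * y ^ i)" using bounded_polys_sum by blast
    \<comment> \<open>The equation 1 = y v, read as a polynomial relation for y with constant term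
      -1.\<close>
    let ?a = "\<lambda>i. case i of 0 \<Rightarrow> - 1 | Suc i \<Rightarrow> a i"
    have "(\<Sum>i<Suc (Suc n). ?a i * y ^ i) = - 1 + y * v"
      unfolding a(2) sum.lessThan_Suc_shift[of _ "Suc n"] by (simp add: sum_distrib_left algebra_simps del: sum.lessThan_Suc)
    then have sum0: "(\<Sum>i<Suc (Suc n). ?a i * y ^ i) = 0" using v(2) by simp
    have "?a i \<in> k" for i
      using a(1) subring_setD(1,6)[OF k_subring] by (auto split: nat.split)
    from power_relation_in_k[OF this sum0, where j = 0] have "y \<in> k" by simp
    then show False using yk by simp
  qed
  then have "ring_ideal B ((\<lambda>v. y * v) ` B)"
    unfolding ring_ideal_def
  proof (intro conjI ballI)
    show "(\<lambda>v. y * v) ` B \<subseteq> B" using yB by blast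
    show "0 \<in> (\<lambda>v. y * v) ` B" using subring_setD(2)[OF B] by (intro image_eqI[of _ _ 0]) auto
  next
    fix u v assume "u \<in> (\<lambda>v. y * v) ` B" "v \<in> (\<lambda>v. y * v) ` B"
    then obtain u' v' where "u' \<in> B" "v' \<in> B" "u = y * u'" "v = y * v'" by blast
    then show "u + v \<in> (\<lambda>v. y * v) ` B"
      using subring_setD(3)[OF B] by (intro image_eqI[of _ _ "u' + v'"]) (auto simp: distrib_left)
  next
    fix a v assume a: "a \<in> B" and "v \<in> (\<lambda>v. y * v) ` B"
    then obtain v' where "v' \<in> B" "v = y * v'" by blast
    then show "a * v \<in> (\<lambda>v. y * v) ` B"
      using a subring_setD(5)[OF B] by (intro image_eqI[of _ _ "a * v'"]) auto
  qed (use B in auto)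
  from chevalley_extension[OF this] obtain Q where Q: "valuation_set Q" "B \<subseteq> Q" "\<forall>v\<in>(\<lambda>v. y * v) ` B. v = 0 \<or> inverse v \<notin> Q"
    by blast
  have "y \<in> (\<lambda>v. y * v) ` B" using 1 by (intro image_eqI[of _ _ 1]) auto
  then have "x \<notin> Q" using Q(3) y(2) by (auto simp: y_def)
  moreover have "Q \<in> closed_points k"
    using Q \<open>x \<notin> Q\<close> kB[OF 1] by (intro closed_pointsI) auto
  moreover have "x \<in> R" using assms(2) by (simp add: nonunits_def)
  ultimately show False using A_subset[of Q] assms(1) by blast
qed

lemma linear_growth_exists: "\<exists>E q. linear_growth k E q"
  by (rule function_field_linear_growth[OF function_field])

text \<open>After division by \<open>e\<close>, distinct elements stay incongruent modulo
  \<open>\<pi> / e\<close>, since otherwise their difference would be a non-zero element of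
  \<open>A\<close> vanishing at infinity; so \<open>residues_bounded\<close> applies. If
  \<open>\<pi> / e\<close> is not in \<open>R\<close>, the bound is so strict that every element of
  the set vanishes at infinity.\<close>

lemma finite_A_bounded:
  assumes "e \<noteq> 0"
  shows "finite {x \<in> A. x / e \<in> R}"
proof (cases "\<pi> / e \<in> R")
  case True
  obtain E q where "linear_growth k E q" using linear_growth_exists by blast
  then interpret linear_growth k E q .
  from residues_bounded[of "\<pi> / e"] assms \<pi>_nonzero
  obtain n where "\<forall>Q T. subring_set Q \<longrightarrow> \<pi> / e \<in> Q \<longrightarrow> T \<subseteq> Q \<longrightarrow> finite T \<longrightarrow>
    (\<forall>x\<in>T. \<forall>y\<in>T. (x - y) / (\<pi> / e) \<in> Q \<longrightarrow> x = y) \<longrightarrow> card T \<le> n" by auto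
  then have n: "\<And>T. T \<subseteq> R \<Longrightarrow> finite T \<Longrightarrow>
    (\<forall>x\<in>T. \<forall>y\<in>T. (x - y) / (\<pi> / e) \<in> R \<longrightarrow> x = y) \<Longrightarrow> card T \<le> n"
    using R_subring True by blast
  have bound: "card T \<le> n" if T: "T \<subseteq> {x \<in> A. x / e \<in> R}" "finite T" for T
  proof -
    have inj: "inj_on (\<lambda>x. x / e) T" using assms by (auto simp: inj_on_def)
    have "card ((\<lambda>x. x / e) ` T) \<le> n"
    proof (rule n)
      show "(\<lambda>x. x / e) ` T \<subseteq> R" using T by auto
      show "\<forall>x\<in>(\<lambda>x. x / e) ` T. \<forall>y\<in>(\<lambda>x. x / e) ` T. (x - y) / (\<pi> / e) \<in> R \<longrightarrow> x = y"
      proof (intro ballI impI)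
        fix u v assume "u \<in> (\<lambda>x. x / e) ` T" "v \<in> (\<lambda>x. x / e) ` T" "(u - v) / (\<pi> / e) \<in> R"
        then obtain x y where xy: "x \<in> T" "y \<in> T" "u = x / e" "v = y / e" "(x / e - y / e) / (\<pi> / e) \<in> R" by auto
        have "(x / e - y / e) / (\<pi> / e) = (x - y) / \<pi>"
          using assms \<pi>_nonzero by (simp add: field_simps)
        then have "(x - y) / \<pi> \<in> R" using xy(5) by metis
        then have "x - y \<in> nonunits R" unfolding nonunits_R using \<pi>_nonzero
          by (intro image_eqI[of _ _ "(x - y) / \<pi>"]) auto
        moreover have "x - y \<in> A" using xy T by (intro subring_setD(4)[OF A_subring]) auto
        ultimately have "x - y = 0" by (intro A_nonunit_zero)
        then show "u = v" using xy by simp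
      qed
    qed (use T in simp)
    then show ?thesis by (simp add: card_image[OF inj])
  qed
  show ?thesis
  proof (rule ccontr)
    assume "infinite {x \<in> A. x / e \<in> R}"
    then obtain T where "T \<subseteq> {x \<in> A. x / e \<in> R}" "finite T" "card T = Suc n"
      using infinite_arbitrarily_large by blast
    then show False using bound[of T] by simp
  qed
next
  case False
  have "{x \<in> A. x / e \<in> R} \<subseteq> {0}"
  proof safe
    fix x assume x: "x \<in> A" "x / e \<in> R"
    have "e / \<pi> / \<pi> \<in> R" using not_R_iff[OF False] by simp
    then have "x / e * (e / \<pi> / \<pi>) * \<pi> \<in> R"
      using x(2) \<pi>_R by (intro subring_setD(5)[OF R_subring])
    then have "x / \<pi> \<in> R" using assms \<pi>_nonzero by (simp add: field_simps)
    then have "x \<in> nonunits R" unfolding nonunits_R using \<pi>_nonzero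
      by (intro image_eqI[of _ _ "x / \<pi>"]) auto
    then show "x = 0" by (rule A_nonunit_zero[OF x(1)])
  qed
  then show ?thesis using finite_subset by blast
qed

text \<open>If \<open>c\<^sub>m x\<^sup>m + \<dots> + c\<^sub>0 = 0\<close> with coefficients in \<open>A\<close>, then \<open>c\<^sub>m x\<close> is integral over \<open>A\<close>.\<close>

lemma A_denominator:
  assumes nonconst: "s \<in> A" "s \<notin> k"
  shows "\<exists>a\<in>A. a \<noteq> 0 \<and> a * x \<in> A"
proof -
  obtain E q where "linear_growth k E q" using linear_growth_exists by blast
  then interpret linear_growth k E q .
  obtain n a where a: "\<forall>i j. a i j \<in> k" "\<exists>i<n. \<exists>j<n. a i j \<noteq> 0"
    "(\<Sum>i<n. (\<Sum>j<n. a i j * s ^ j) * x ^ i) = 0"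
    using algebraically_dependent[of s x] by blast
  define c where "c i = (\<Sum>j<n. a i j * s ^ j)" for i
  have cA: "c i \<in> A" for i
    unfolding c_def using a(1) k_A nonconst(1)
    by (intro subring_set_sum[OF A_subring] subring_setD(5)[OF A_subring] subring_set_power[OF A_subring]) auto
  \<comment> \<open>If a non-zero row of coefficients gave the value 0, it would be a relation for
    the non-constant \<open>s\<close> over \<open>k\<close>.\<close>
  have "\<exists>i<n. c i \<noteq> 0"
  proof -
    obtain i j where ij: "i < n" "j < n" "a i j \<noteq> 0" using a(2) by blast
    have "c i \<noteq> 0"
    proof
      assume "c i = 0"
      then have "s \<in> k" using power_relation_in_k[of "a i" s n j] a(1) ij by (simp add: c_def)
      then show False using nonconst by simp
    qed
    then show ?thesis using ij by blast
  qed
  define m where "m = Max {i. i < n \<and> c i \<noteq> 0}"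
  have "m \<in> {i. i < n \<and> c i \<noteq> 0}" unfolding m_def using \<open>\<exists>i<n. c i \<noteq> 0\<close> by (intro Max_in) auto
  then have m: "m < n" "c m \<noteq> 0" by auto
  have top: "c i = 0" if "m < i" "i < n" for i
  proof (rule ccontr)
    assume "c i \<noteq> 0"
    then have "i \<le> m" unfolding m_def using that by (intro Max_ge) auto
    then show False using that by simp
  qed
  have "(\<Sum>i<Suc m. c i * x ^ i) = (\<Sum>i<n. c i * x ^ i)"
    using m(1) top by (intro sum.mono_neutral_left) auto
  then have rel: "c m * x ^ m = - (\<Sum>i<m. c i * x ^ i)"
    using a(3) by (simp add: c_def[symmetric] eq_neg_iff_add_eq_0 add.commute)
  have m0: "m \<noteq> 0" using rel m(2) by (intro notI) simp
  define y where "y = c m * x"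
  \<comment> \<open>Multiplied by c_m^(m-1) the relation becomes monic in y. If y were not in Q,
    then 1/y would be, and division by y^(m-1) would express y through elements of Q.\<close>
  have "y \<in> Q" if Q: "Q \<in> closed_points k" "Q \<noteq> R" for Q
  proof (rule ccontr)
    assume yQ: "y \<notin> Q"
    have Qv: "valuation_set Q" by (rule closed_points_valuation_set[OF Q(1)])
    then have Qs: "subring_set Q" and iy: "inverse y \<in> Q" using yQ by (auto simp: valuation_set_def)
    have y0: "y \<noteq> 0" using yQ subring_setD(2)[OF Qs] by auto
    have x0: "x \<noteq> 0" using y0 by (auto simp: y_def)
    have "y ^ m = c m ^ (m - 1) * (c m * x ^ m)"
      using m0 by (cases m) (simp_all add: y_def power_mult_distrib ac_simps)
    also have "\<dots> = - (\<Sum>i<m. c m ^ (m - 1) * (c i * x ^ i))"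
      unfolding rel by (simp add: sum_distrib_left)
    also have "\<dots> = - (\<Sum>i<m. c i * c m ^ (m - 1 - i) * y ^ i)"
    proof -
      have "c m ^ (m - 1) * (c i * x ^ i) = c i * c m ^ (m - 1 - i) * y ^ i" if "i < m" for i
      proof -
        have "m - 1 = (m - 1 - i) + i" using that by simp
        then have "c m ^ (m - 1) = c m ^ (m - 1 - i) * c m ^ i" by (metis power_add)
        then show ?thesis by (simp add: y_def power_mult_distrib)
      qed
      then show ?thesis by (intro arg_cong[of _ _ uminus] sum.cong refl) auto
    qed
    finally have e1: "y ^ m * inverse y ^ (m - 1) = - (\<Sum>i<m. c i * c m ^ (m - 1 - i) * (y ^ i * inverse y ^ (m - 1)))"
      by (simp add: sum_distrib_right mult.assoc)
    have e2: "y ^ m * inverse y ^ (m - 1) = y"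
      using m0 y0 by (cases m) (simp_all add: mult.assoc flip: power_mult_distrib)
    have e3: "y ^ i * inverse y ^ (m - 1) = inverse y ^ (m - 1 - i)" if "i < m" for i
    proof -
      have "m - 1 = i + (m - 1 - i)" using that by simp
      then have "inverse y ^ (m - 1) = inverse y ^ i * inverse y ^ (m - 1 - i)" by (metis power_add)
      then show ?thesis using y0 by (simp flip: power_mult_distrib mult.assoc)
    qed
    have "y = - (\<Sum>i<m. c i * c m ^ (m - 1 - i) * (y ^ i * inverse y ^ (m - 1)))"
      using e1 unfolding e2 .
    also have "\<dots> = - (\<Sum>i<m. c i * c m ^ (m - 1 - i) * inverse y ^ (m - 1 - i))"
      by (intro arg_cong[of _ _ uminus] sum.cong refl) (simp only: e3 lessThan_iff)
    also have "\<dots> \<in> Q"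
      using cA A_subset[OF Q] iy
      by (intro subring_setD(5,6)[OF Qs] subring_set_sum[OF Qs] subring_set_power[OF Qs]) auto
    finally show False using yQ by simp
  qed
  then have "y \<in> A" by (auto simp: A_def regular_functions_away_def)
  then show ?thesis using cA[of m] m(2) by (auto simp: y_def)
qed

end

locale curve_ideal = curve +
  fixes I
  assumes I_ideal: "ideal I (subring_as_ring A)" and I_nonzero: "I \<noteq> {0}" and I_proper: "I \<noteq> A"
begin

lemma I_ring_ideal: "ring_ideal A I"
proof -
  interpret ideal I "subring_as_ring A" by (rule I_ideal)
  have sub: "I \<subseteq> A" using a_subset by simp
  have mult: "a * x \<in> I" if "a \<in> A" "x \<in> I" for a x
    using I_l_closed[of x a] that by simp
  have "1 \<notin> I"
  proof
    assume "1 \<in> I"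
    then have "A \<subseteq> I" using mult[of _ 1] by auto
    then show False using sub I_proper by auto
  qed
  then show ?thesis
    unfolding ring_ideal_def using A_subring sub mult additive_subgroup.zero_closed[OF additive_subgroup_axioms]
      additive_subgroup.a_closed[OF additive_subgroup_axioms] by auto
qed

lemma I_nonconstant: "\<exists>s\<in>A. s \<notin> k"
proof -
  note I = ring_idealD[OF I_ring_ideal]
  obtain s where s: "s \<in> I" "s \<noteq> 0" using I_nonzero I(3) by blast
  have "s \<notin> k"
  proof
    assume "s \<in> k"
    then have "inverse s * s \<in> I" using k_inverse k_A s(1) I(6) by blast
    then show False using s(2) I(4) by simp
  qed
  then show ?thesis using s I(2) by blast
qed

lemma denominator: "\<exists>a\<in>A. a \<noteq> 0 \<and> a * x \<in> A"
  using I_nonconstant A_denominator by blast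

text \<open>In \<open>fixed_vector\<close> this ring measures how far \<open>g - 1\<close> shrinks
  the vectors of \<open>P\<close>.\<close>

lemma valuation_over_I: "\<exists>Q. valuation_set Q \<and> A \<subseteq> Q \<and> I \<subseteq> nonunits Q"
  using chevalley_extension[OF I_ring_ideal] ring_idealD(2)[OF I_ring_ideal]
  unfolding nonunits_def by blast

lemma R_separated: 
  assumes "z \<in> nonunits R" "z \<noteq> 0" "\<And>j. w / z ^ j \<in> R"
  shows "w = 0"
proof -
  obtain E q where "linear_growth k E q" using linear_growth_exists by blast
  then interpret linear_growth k E q .
  show ?thesis using separated[OF R_subring, of z w] assms by (simp add: nonunits_def)
qed

end


section \<open>Lattices and projective modules\<close>

text \<open>Divisibility in \<open>Q\<close> is a total preorder. That \<open>b / a\<close> lies in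
  \<open>Q\<close> means that \<open>b\<close> is a multiple of \<open>a\<close>, so
  \<open>a\<close> generates the largest principal ideal.\<close>

lemma valuation_set_max:
  assumes Q: "valuation_set Q" and "finite S" "S \<noteq> {}" "0 \<notin> S"
  shows "\<exists>a\<in>S. \<forall>b\<in>S. b / a \<in> Q"
  using assms(2-)
proof (induction S rule: finite_ne_induct)
  case (singleton x)
  then show ?case using Q subring_setD(1)[of Q] by (auto simp: valuation_set_def)
next
  case (insert x S)
  then obtain a where a: "a \<in> S" "\<forall>b\<in>S. b / a \<in> Q" by auto
  have Qs: "subring_set Q" using Q by (simp add: valuation_set_def)
  have x0: "x \<noteq> 0" and a0: "a \<noteq> 0" using insert.prems a(1) by auto
  show ?case
  proof (cases "x / a \<in> Q")
    case True
    then show ?thesis using a by auto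
  next
    case False
    then have "a / x \<in> Q" using valuation_set_total[OF Q, of x a] by blast
    then have "b / a * (a / x) \<in> Q" if "b \<in> S" for b using a that by (intro subring_setD(5)[OF Qs]) auto
    then have "\<forall>b\<in>S. b / x \<in> Q" using a0 by simp
    then show ?thesis using x0 subring_setD(1)[OF Qs] by auto
  qed
qed

lemma valuation_set_min:
  assumes Q: "valuation_set Q" and "finite S" "S \<noteq> {}" "0 \<notin> S"
  shows "\<exists>a\<in>S. \<forall>b\<in>S. a / b \<in> Q"
proof -
  have "finite (inverse ` S)" "inverse ` S \<noteq> {}" "0 \<notin> inverse ` S" using assms by auto
  from valuation_set_max[OF Q this] obtain a where "a \<in> S" "\<forall>b\<in>S. inverse b / inverse a \<in> Q" by blast
  then show ?thesis by (auto simp: divide_inverse mult.commute)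
qed

lemma valuation_set_bound:
  assumes Q: "valuation_set Q" and "finite S"
  shows "\<exists>c. c \<noteq> 0 \<and> (\<forall>x\<in>S. x / c \<in> Q)"
proof (cases "S - {0} = {}")
  case True
  then have "\<forall>x\<in>S. x / 1 \<in> Q" using Q subring_setD(2)[of Q] by (auto simp: valuation_set_def)
  then show ?thesis by (intro exI[of _ 1]) auto
next
  case False
  then obtain a where "a \<in> S - {0}" "\<forall>b\<in>S - {0}. b / a \<in> Q"
    using valuation_set_max[OF Q, of "S - {0}"] assms(2) by auto
  then show ?thesis using Q subring_setD(2)[of Q] by (intro exI[of _ a]) (auto simp: valuation_set_def)
qed

lemma (in curve_ideal) common_denominator:
  "finite S \<Longrightarrow> \<exists>a\<in>A. a \<noteq> 0 \<and> (\<forall>x\<in>S. a * x \<in> A)"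
proof (induction S rule: finite_induct)
  case empty
  then show ?case using subring_setD(1)[OF A_subring] by (intro bexI[of _ 1]) auto
next
  case (insert x S)
  then obtain a where a: "a \<in> A" "a \<noteq> 0" "\<forall>x\<in>S. a * x \<in> A" by blast
  obtain b where b: "b \<in> A" "b \<noteq> 0" "b * x \<in> A" using denominator by blast
  have "b * a * y \<in> A" if "y \<in> S" for y
    using subring_setD(5)[OF A_subring b(1), of "a * y"] a that by (simp add: mult.assoc)
  moreover have "b * a * x \<in> A"
    using subring_setD(5)[OF A_subring a(1) b(3)] by (simp add: ac_simps)
  ultimately show ?case
    using a b subring_setD(5)[OF A_subring] by (intro bexI[of _ "b * a"]) auto
qed

lemma submodule_module_ofD:
  assumes "submodule P (subring_as_ring A) (module_of scale UNIV)"
  shows "0 \<in> P" "x \<in> P \<Longrightarrow> y \<in> P \<Longrightarrow> x + y \<in> P" "a \<in> A \<Longrightarrow> x \<in> P \<Longrightarrow> scale a x \<in> P"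
proof -
  interpret submodule P "subring_as_ring A" "module_of scale UNIV" by fact
  show "0 \<in> P" using one_closed by (simp add: module_of_def)
  show "x \<in> P \<Longrightarrow> y \<in> P \<Longrightarrow> x + y \<in> P" using m_closed[of x y] by (simp add: module_of_def)
  show "a \<in> A \<Longrightarrow> x \<in> P \<Longrightarrow> scale a x \<in> P" using smult_closed[of a x] by (simp add: module_of_def)
qed

text \<open>\<open>f\<close> collects the coordinates of the embedding into the free module, and
  \<open>e\<close> the images of its basis vectors. Outside the basis the coordinates are set to 0,
  so that the indices range over the whole type.\<close>

lemma projective_module_dual_basis:
  assumes A: "subring_set A" and P: "0 \<in> P"
    and proj: "projective_module (subring_as_ring A) (module_of scale P)"
  obtains f :: "'w::ab_group_add \<Rightarrow> 'w \<Rightarrow> 'k::field" and e :: "'w \<Rightarrow> 'w" where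
    "\<And>x y. x \<in> P \<Longrightarrow> f y x \<in> A" "\<And>x x' y. x \<in> P \<Longrightarrow> x' \<in> P \<Longrightarrow> f y (x + x') = f y x + f y x'"
    "\<And>a x y. a \<in> A \<Longrightarrow> x \<in> P \<Longrightarrow> f y (scale a x) = a * f y x" "\<And>x. x \<in> P \<Longrightarrow> finite {y. f y x \<noteq> 0}"
    "\<And>y x. x \<in> P \<Longrightarrow> f y x \<noteq> 0 \<Longrightarrow> e y \<in> P"
    "\<And>x. x \<in> P \<Longrightarrow> x = (\<Sum>y | f y x \<noteq> 0. scale (f y x) (e y))"
proof -
  let ?F = "\<lambda>Y :: 'w set. free_module (subring_as_ring A) Y"
  obtain Y :: "'w set" and s i where s: "s \<in> module_homs (subring_as_ring A) (?F Y) (module_of scale P)"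
    and i: "i \<in> module_homs (subring_as_ring A) (module_of scale P) (?F Y)"
    and si: "\<And>x. x \<in> P \<Longrightarrow> s (i x) = x"
    using proj unfolding projective_module_def by (auto simp: module_of_def)
  have carF: "\<phi> \<in> carrier (?F Y) \<longleftrightarrow> \<phi> \<in> Y \<rightarrow>\<^sub>E A \<and> finite {y \<in> Y. \<phi> y \<noteq> 0}" for \<phi>
    by (simp add: free_module_def)
  have addF: "\<phi> \<oplus>\<^bsub>?F Y\<^esub> \<psi> = (\<lambda>y\<in>Y. \<phi> y + \<psi> y)" and smF: "a \<odot>\<^bsub>?F Y\<^esub> \<phi> = (\<lambda>y\<in>Y. a * \<phi> y)" for \<phi> \<psi> a
    by (simp_all add: free_module_def)
  have carP: "carrier (module_of scale P) = P" "x \<oplus>\<^bsub>module_of scale P\<^esub> y = x + y" "a \<odot>\<^bsub>module_of scale P\<^esub> x = scale a x" for x y a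
    by (simp_all add: module_of_def)
  have ic: "i x \<in> carrier (?F Y)" if "x \<in> P" for x
    using i that by (auto simp: module_homs_def carP)
  have iadd: "i (x + x') = (\<lambda>y\<in>Y. i x y + i x' y)" if "x \<in> P" "x' \<in> P" for x x'
    using i that unfolding module_homs_def carP addF by blast
  have ism: "i (scale a x) = (\<lambda>y\<in>Y. a * i x y)" if "a \<in> A" "x \<in> P" for a x
    using i that unfolding module_homs_def carP smF by auto
  have sc: "s \<phi> \<in> P" if "\<phi> \<in> carrier (?F Y)" for \<phi>
    using s that by (auto simp: module_homs_def carP)
  have sadd: "s (\<lambda>y\<in>Y. \<phi> y + \<psi> y) = s \<phi> + s \<psi>" if "\<phi> \<in> carrier (?F Y)" "\<psi> \<in> carrier (?F Y)" for \<phi> \<psi>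
    using s that unfolding module_homs_def carP addF by blast
  have ssm: "s (\<lambda>y\<in>Y. a * \<phi> y) = scale a (s \<phi>)" if "a \<in> A" "\<phi> \<in> carrier (?F Y)" for a \<phi>
    using s that unfolding module_homs_def carP smF by auto
  define \<delta> where "\<delta> y = (\<lambda>x\<in>Y. if x = y then 1 else (0::'k))" for y
  have \<delta>c: "\<delta> y \<in> carrier (?F Y)" for y
  proof -
    have "{x \<in> Y. \<delta> y x \<noteq> 0} \<subseteq> {y}" by (auto simp: \<delta>_def)
    then have "finite {x \<in> Y. \<delta> y x \<noteq> 0}" by (rule finite_subset) simp
    then show ?thesis using subring_setD(1,2)[OF A] by (auto simp: carF \<delta>_def)
  qed
  have zero: "s (\<lambda>y\<in>Y. 0) = 0"
  proof -
    have "(\<lambda>y\<in>Y. 0) \<in> carrier (?F Y)" using subring_setD(2)[OF A] by (auto simp: carF)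
    from sadd[OF this this] show ?thesis by (simp cong: restrict_cong)
  qed
  \<comment> \<open>Induction on a finite set containing the support; each index contributes one
    multiple of a basis vector.\<close>
  have expand: "s \<phi> = (\<Sum>y\<in>T. scale (\<phi> y) (s (\<delta> y)))"
    if "finite T" "T \<subseteq> Y" "\<phi> \<in> Y \<rightarrow>\<^sub>E A" "\<And>y. y \<in> Y - T \<Longrightarrow> \<phi> y = 0" for T \<phi>
    using that
  proof (induction T arbitrary: \<phi> rule: finite_induct)
    case empty
    then have "\<phi> = (\<lambda>y\<in>Y. 0)" by (intro ext) (auto simp: PiE_def extensional_def)
    then show ?case using zero by (simp only: sum.empty)
  next
    case (insert z T)
    define \<psi> where "\<psi> = \<phi>(z := 0)"
    have zY: "z \<in> Y" using insert.prems by simp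
    have \<psi>: "\<psi> \<in> Y \<rightarrow>\<^sub>E A" using insert.prems zY subring_setD(2)[OF A] by (auto simp: \<psi>_def PiE_def extensional_def Pi_def)
    have \<psi>0: "\<psi> y = 0" if "y \<in> Y - T" for y using insert.prems(3)[of y] that by (auto simp: \<psi>_def)
    have "{y \<in> Y. \<psi> y \<noteq> 0} \<subseteq> T" using \<psi>0 by auto
    then have \<psi>c: "\<psi> \<in> carrier (?F Y)" using \<psi> finite_subset[OF _ insert.hyps(1)] by (simp add: carF)
    have \<phi>z: "\<phi> z \<in> A" using insert.prems zY by auto
    have \<delta>': "(\<lambda>y\<in>Y. \<phi> z * \<delta> z y) \<in> carrier (?F Y)"
    proof -
      have "{x \<in> Y. (\<lambda>y\<in>Y. \<phi> z * \<delta> z y) x \<noteq> 0} \<subseteq> {z}" by (auto simp: \<delta>_def)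
      then have "finite {x \<in> Y. (\<lambda>y\<in>Y. \<phi> z * \<delta> z y) x \<noteq> 0}" by (rule finite_subset) simp
      then show ?thesis using \<phi>z subring_setD(2)[OF A] by (auto simp: carF \<delta>_def)
    qed
    have "\<phi> = (\<lambda>y\<in>Y. \<psi> y + (\<lambda>y\<in>Y. \<phi> z * \<delta> z y) y)"
      using insert.prems(2) by (intro ext) (auto simp: \<psi>_def \<delta>_def PiE_def extensional_def)
    then have "s \<phi> = s \<psi> + scale (\<phi> z) (s (\<delta> z))"
      using sadd[OF \<psi>c \<delta>'] ssm[OF \<phi>z \<delta>c] by metis
    also have "s \<psi> = (\<Sum>y\<in>T. scale (\<psi> y) (s (\<delta> y)))"
      using insert.prems \<psi> \<psi>0 by (intro insert.IH) auto
    also have "\<dots> = (\<Sum>y\<in>T. scale (\<phi> y) (s (\<delta> y)))"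
      using insert.hyps by (intro sum.cong) (auto simp: \<psi>_def)
    finally show ?case using insert.hyps by (simp add: add.commute)
  qed
  define f where "f y x = (if y \<in> Y then i x y else 0)" for y x
  define e where "e y = s (\<delta> y)" for y
  show ?thesis
  proof (rule that[of f e])
    show "f y x \<in> A" if "x \<in> P" for x y
      using ic[OF that] subring_setD(2)[OF A] by (auto simp: f_def carF)
    show "f y (x + x') = f y x + f y x'" if "x \<in> P" "x' \<in> P" for x x' y
      by (simp add: f_def iadd[OF that])
    show "f y (scale a x) = a * f y x" if "a \<in> A" "x \<in> P" for a x y
      by (simp add: f_def ism[OF that])
    have supp: "{y. f y x \<noteq> 0} = {y \<in> Y. i x y \<noteq> 0}" for x by (auto simp: f_def)
    show fin: "finite {y. f y x \<noteq> 0}" if "x \<in> P" for x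
      using ic[OF that] unfolding supp by (simp add: carF)
    show "e y \<in> P" for y unfolding e_def by (rule sc[OF \<delta>c])
    show "x = (\<Sum>y | f y x \<noteq> 0. scale (f y x) (e y))" if "x \<in> P" for x
    proof -
      have "s (i x) = (\<Sum>y | f y x \<noteq> 0. scale (i x y) (s (\<delta> y)))"
        using ic[OF that] by (intro expand fin[OF that]) (auto simp: f_def carF)
      also have "\<dots> = (\<Sum>y | f y x \<noteq> 0. scale (f y x) (e y))"
        by (rule sum.cong) (auto simp: f_def e_def split: if_splits)
      finally show ?thesis unfolding si[OF that] .
    qed
  qed
qed

text \<open>Two coordinate systems are kept: the K-basis \<open>Bs\<close> inside \<open>P\<close>,
  suited to comparison with lattices, and the dual basis \<open>f\<close>, \<open>e\<close>, whose
  coordinates on \<open>P\<close> lie in \<open>A\<close>.\<close>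

locale arithmetic_module = curve_ideal k R A \<pi> I + finite_dimensional_vector_space scale Bs
  for k R A :: "'k::field set" and \<pi> :: 'k and I :: "'k set"
    and scale :: "'k \<Rightarrow> 'w::ab_group_add \<Rightarrow> 'w" and Bs :: "'w set" +
  fixes P :: "'w set" and f :: "'w \<Rightarrow> 'w \<Rightarrow> 'k" and e :: "'w \<Rightarrow> 'w"
  assumes P_zero: "0 \<in> P" and P_add: "x \<in> P \<Longrightarrow> y \<in> P \<Longrightarrow> x + y \<in> P"
    and P_scale: "a \<in> A \<Longrightarrow> x \<in> P \<Longrightarrow> scale a x \<in> P"
    and Bs_P: "Bs \<subseteq> P" and Bs_nonempty: "Bs \<noteq> {}"
    and f_A: "x \<in> P \<Longrightarrow> f y x \<in> A" and f_add: "x \<in> P \<Longrightarrow> x' \<in> P \<Longrightarrow> f y (x + x') = f y x + f y x'"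
    and f_scale: "a \<in> A \<Longrightarrow> x \<in> P \<Longrightarrow> f y (scale a x) = a * f y x"
    and f_finite: "x \<in> P \<Longrightarrow> finite {y. f y x \<noteq> 0}"
    and e_P: "x \<in> P \<Longrightarrow> f y x \<noteq> 0 \<Longrightarrow> e y \<in> P"
    and dual_basis: "x \<in> P \<Longrightarrow> x = (\<Sum>y | f y x \<noteq> 0. scale (f y x) (e y))"
begin

abbreviation "coord \<equiv> representation Bs"

lemma coord_sum: "(\<Sum>b\<in>Bs. scale (coord x b) b) = x"
  by (rule sum_representation_eq) (auto simp: independent_Basis span_Basis finite_Basis)

lemma coord_scale: "coord (scale a x) b = a * coord x b"
  by (simp add: representation_scale independent_Basis span_Basis)

lemma coord_sum_scale: "coord (\<Sum>v\<in>S. scale (c v) v) b = (\<Sum>v\<in>S. c v * coord v b)"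
  using representation_sum[of Bs S "\<lambda>v. scale (c v) v"]
  by (simp add: independent_Basis span_Basis coord_scale)

lemma coord_zero_imp: "(\<And>b. b \<in> Bs \<Longrightarrow> coord x b = 0) \<Longrightarrow> x = 0"
  using coord_sum[of x] by simp

lemma P_sum: "(\<And>i. i \<in> S \<Longrightarrow> g i \<in> P) \<Longrightarrow> sum g S \<in> P"
  by (induction S rule: infinite_finite_induct) (auto simp: P_zero P_add)

lemma P_minus: "x \<in> P \<Longrightarrow> - x \<in> P"
  using P_scale[OF subring_setD(6)[OF A_subring subring_setD(1)[OF A_subring]], of x] by simp

lemma P_diff: "x \<in> P \<Longrightarrow> y \<in> P \<Longrightarrow> x - y \<in> P"
  using P_add[OF _ P_minus, of x y] by simp

lemma f_zero: "f y 0 = 0"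
  using f_scale[OF subring_setD(2)[OF A_subring] P_zero, of y] by simp

lemma f_minus: "x \<in> P \<Longrightarrow> f y (- x) = - f y x"
  using f_add[OF _ P_minus, of x x y] f_zero by (simp add: eq_neg_iff_add_eq_0 add.commute)

lemma f_sum_scale:
  "(\<And>i. i \<in> S \<Longrightarrow> a i \<in> A \<and> g i \<in> P) \<Longrightarrow> f y (\<Sum>i\<in>S. scale (a i) (g i)) = (\<Sum>i\<in>S. a i * f y (g i))"
  by (induction S rule: infinite_finite_induct) (auto simp: f_zero f_add f_scale P_scale P_sum)

lemma f_nonzero:
  assumes "x \<in> P" "x \<noteq> 0"
  shows "\<exists>y. f y x \<noteq> 0"
proof (rule ccontr)
  assume none: "\<not> (\<exists>y. f y x \<noteq> 0)"
  have "x = (\<Sum>y | f y x \<noteq> 0. scale (f y x) (e y))" by (rule dual_basis[OF assms(1)])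
  also have "\<dots> = 0" using none by simp
  finally show False using assms(2) by simp
qed

lemma P_denominator: "\<exists>a\<in>A. a \<noteq> 0 \<and> scale a x \<in> P"
proof -
  obtain a where a: "a \<in> A" "a \<noteq> 0" "\<forall>c\<in>coord x ` Bs. a * c \<in> A"
    using common_denominator[of "coord x ` Bs"] finite_Basis by auto
  have "scale a x = scale a (\<Sum>b\<in>Bs. scale (coord x b) b)" by (simp add: coord_sum)
  also have "\<dots> = (\<Sum>b\<in>Bs. scale (a * coord x b) b)" by (simp add: scale_sum_right)
  also have "\<dots> \<in> P" using a Bs_P by (intro P_sum P_scale) auto
  finally show ?thesis using a by blast
qed

text \<open>\<open>f y\<close> is A-linear on \<open>P\<close>, while the coordinates of
  \<open>x\<close> lie in K. Clearing their denominators makes it compute like a K-linear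
  form.\<close>

lemma f_coord:
  assumes "x \<in> P"
  shows "f y x = (\<Sum>b\<in>Bs. coord x b * f y b)"
proof -
  obtain a where a: "a \<in> A" "a \<noteq> 0" "\<forall>c\<in>coord x ` Bs. a * c \<in> A"
    using common_denominator[of "coord x ` Bs"] finite_Basis by auto
  have "scale a x = scale a (\<Sum>b\<in>Bs. scale (coord x b) b)" by (simp add: coord_sum)
  also have "\<dots> = (\<Sum>b\<in>Bs. scale (a * coord x b) b)" by (simp add: scale_sum_right)
  finally have "f y (scale a x) = f y (\<Sum>b\<in>Bs. scale (a * coord x b) b)" by simp
  also have "\<dots> = (\<Sum>b\<in>Bs. a * coord x b * f y b)"
    using a Bs_P by (intro f_sum_scale) auto
  finally have "a * f y x = a * (\<Sum>b\<in>Bs. coord x b * f y b)"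
    using f_scale[OF a(1) assms] by (simp add: sum_distrib_left mult.assoc)
  then show ?thesis using a(2) by simp
qed

section \<open>Lattices and their points in \<open>P\<close>\<close>

abbreviation "R_lattice \<equiv> lattice_in scale R"

lemma latticeE:
  assumes "R_lattice L"
  obtains B where "finite B" "\<forall>x. x \<in> L \<longleftrightarrow> (\<exists>c. x = (\<Sum>b\<in>B. scale (c b) b) \<and> (\<forall>b\<in>B. c b \<in> R))" "span L = UNIV"
proof -
  have "dim L = dim UNIV" using assms by (simp add: lattice_in_def)
  then have "span L = UNIV" using dim_eq_full by (metis dim_UNIV dimension_def)
  moreover obtain B where "finite B" "L = {\<Sum>b\<in>B. scale (c b) b | c. \<forall>b\<in>B. c b \<in> R}"
    using assms by (auto simp: lattice_in_def)
  ultimately show ?thesis by (intro that[of B]) auto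
qed

lemma lattice_zero_add_scale:
  assumes "R_lattice L"
  shows "0 \<in> L" "x \<in> L \<Longrightarrow> y \<in> L \<Longrightarrow> x + y \<in> L" "a \<in> R \<Longrightarrow> x \<in> L \<Longrightarrow> scale a x \<in> L"
proof -
  obtain B where B': "finite B" "\<forall>x. x \<in> L \<longleftrightarrow> (\<exists>c. x = (\<Sum>b\<in>B. scale (c b) b) \<and> (\<forall>b\<in>B. c b \<in> R))" using assms by (rule latticeE)
  note B = B'(1) B'(2)[rule_format]
  note Rs = subring_setD[OF R_subring]
  have "(\<Sum>b\<in>B. scale 0 b) = 0" by simp
  then show "0 \<in> L" unfolding B(2) using Rs(2) by (auto intro!: exI[of _ "\<lambda>_. 0"])
  show "x + y \<in> L" if xy: "x \<in> L" "y \<in> L"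
  proof -
    obtain c d where "x = (\<Sum>b\<in>B. scale (c b) b)" "y = (\<Sum>b\<in>B. scale (d b) b)" "\<forall>b\<in>B. c b \<in> R" "\<forall>b\<in>B. d b \<in> R"
      using xy unfolding B(2) by blast
    then have "x + y = (\<Sum>b\<in>B. scale (c b + d b) b)" "\<forall>b\<in>B. c b + d b \<in> R"
      using Rs(3) by (auto simp: sum.distrib scale_left_distrib)
    then show ?thesis unfolding B(2) by (intro exI[of _ "\<lambda>b. c b + d b"] conjI)
  qed
  show "scale a x \<in> L" if ax: "a \<in> R" "x \<in> L"
  proof -
    obtain c where "x = (\<Sum>b\<in>B. scale (c b) b)" "\<forall>b\<in>B. c b \<in> R"
      using ax unfolding B(2) by blast
    then have "scale a x = (\<Sum>b\<in>B. scale (a * c b) b)" "\<forall>b\<in>B. a * c b \<in> R"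
      using Rs(5) ax(1) by (auto simp: scale_sum_right)
    then show ?thesis unfolding B(2) by (intro exI[of _ "\<lambda>b. a * c b"] conjI)
  qed
qed

lemma lattice_minus: "R_lattice L \<Longrightarrow> x \<in> L \<Longrightarrow> - x \<in> L"
  using lattice_zero_add_scale(3)[OF _ subring_setD(6)[OF R_subring subring_setD(1)[OF R_subring]], of L x] by simp

lemma lattice_coord_bound:
  assumes "R_lattice L"
  shows "\<exists>c. c \<noteq> 0 \<and> (\<forall>x\<in>L. \<forall>b\<in>Bs. coord x b / c \<in> R)"
proof -
  obtain B where B': "finite B" "\<forall>x. x \<in> L \<longleftrightarrow> (\<exists>c. x = (\<Sum>b\<in>B. scale (c b) b) \<and> (\<forall>b\<in>B. c b \<in> R))" using assms by (rule latticeE)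
  note B = B'(1) B'(2)[rule_format]
  obtain c where c: "c \<noteq> 0" "\<forall>x\<in>(\<lambda>(v, b). coord v b) ` (B \<times> Bs). x / c \<in> R"
    using valuation_set_bound[OF R_valuation, of "(\<lambda>(v, b). coord v b) ` (B \<times> Bs)"] B(1) finite_Basis by auto
  have "coord x b / c \<in> R" if x: "x \<in> L" "b \<in> Bs" for x b
  proof -
    obtain d where d: "x = (\<Sum>v\<in>B. scale (d v) v)" "\<forall>v\<in>B. d v \<in> R" using x(1) unfolding B(2) by blast
    have "coord x b / c = (\<Sum>v\<in>B. d v * (coord v b / c))"
      by (simp add: d(1) coord_sum_scale sum_divide_distrib)
    also have "\<dots> \<in> R"
      using d(2) c(2) x(2) by (intro subring_set_sum[OF R_subring] subring_setD(5)[OF R_subring]) auto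
    finally show ?thesis .
  qed
  then show ?thesis using c(1) by blast
qed

text \<open>The dual basis embeds \<open>P \<inter> L\<close> into a finite product. Only finitely
  many \<open>f y\<close> are non-zero on \<open>P\<close>, since each is determined by its values
  on \<open>Bs\<close>; and on \<open>P \<inter> L\<close> each takes values in \<open>A\<close>
  with a pole of bounded order at infinity.\<close>

lemma finite_P_lattice:
  assumes "R_lattice L"
  shows "finite (P \<inter> L)"
proof -
  obtain c where c: "c \<noteq> 0" "\<And>x b. x \<in> L \<Longrightarrow> b \<in> Bs \<Longrightarrow> coord x b / c \<in> R"
    using lattice_coord_bound[OF assms] by blast
  define Y0 where "Y0 = (\<Union>b\<in>Bs. {y. f y b \<noteq> 0})"
  have Y0: "finite Y0" unfolding Y0_def using finite_Basis f_finite Bs_P by blast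
  have f0: "f y x = 0" if "x \<in> P" "y \<notin> Y0" for x y
    using that by (simp add: f_coord[OF that(1)] Y0_def)
  have "\<forall>y. \<exists>d. d \<noteq> 0 \<and> (\<forall>b\<in>Bs. f y b / d \<in> R)"
    using valuation_set_bound[OF R_valuation, of "f _ ` Bs"] finite_Basis by simp
  then obtain d where d: "\<And>y. d y \<noteq> 0" "\<And>y b. b \<in> Bs \<Longrightarrow> f y b / d y \<in> R" by metis
  let ?T = "\<lambda>y. {x \<in> A. x / (c * d y) \<in> R}"
  have "finite (Y0 \<rightarrow>\<^sub>E (\<Union>y\<in>Y0. ?T y))"
    using Y0 c(1) d(1) by (intro finite_PiE finite_UN_I finite_A_bounded) auto
  moreover have "(\<lambda>x. \<lambda>y\<in>Y0. f y x) ` (P \<inter> L) \<subseteq> (Y0 \<rightarrow>\<^sub>E (\<Union>y\<in>Y0. ?T y))"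
  proof (rule image_subsetI)
    fix x assume x: "x \<in> P \<inter> L"
    have "f y x \<in> ?T y" for y
    proof -
      have "f y x / (c * d y) = (\<Sum>b\<in>Bs. (coord x b / c) * (f y b / d y))"
        using x by (simp add: f_coord sum_divide_distrib)
      also have "\<dots> \<in> R"
        using c(2) d(2) x by (intro subring_set_sum[OF R_subring] subring_setD(5)[OF R_subring]) auto
      finally show ?thesis using f_A x by simp
    qed
    then show "(\<lambda>y\<in>Y0. f y x) \<in> (Y0 \<rightarrow>\<^sub>E (\<Union>y\<in>Y0. ?T y))"
      unfolding restrict_PiE_iff by (intro ballI UN_I)
  qed
  ultimately have "finite ((\<lambda>x. \<lambda>y\<in>Y0. f y x) ` (P \<inter> L))" by (rule rev_finite_subset)
  moreover have "inj_on (\<lambda>x. \<lambda>y\<in>Y0. f y x) (P \<inter> L)"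
  proof (rule inj_onI)
    fix x x' assume x: "x \<in> P \<inter> L" "x' \<in> P \<inter> L" and eq: "(\<lambda>y\<in>Y0. f y x) = (\<lambda>y\<in>Y0. f y x')"
    have "f y x = f y x'" for y
    proof (cases "y \<in> Y0")
      case True
      then show ?thesis using fun_cong[OF eq, of y] by simp
    qed (use f0 x in auto)
    then show "x = x'" using dual_basis[of x] dual_basis[of x'] x by simp
  qed
  ultimately show ?thesis by (rule finite_imageD)
qed

lemma lattice_scale:
  assumes "R_lattice L" "a \<noteq> 0"
  shows "R_lattice (scale a ` L)"
proof -
  obtain B where B': "finite B" "\<forall>x. x \<in> L \<longleftrightarrow> (\<exists>c. x = (\<Sum>b\<in>B. scale (c b) b) \<and> (\<forall>b\<in>B. c b \<in> R))" "span L = UNIV"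
    using assms(1) by (rule latticeE)
  note B = B'(1) B'(2)[rule_format] B'(3)
  have inj: "inj_on (scale a) B" using assms(2) by (auto simp: inj_on_def)
  have sum_eq: "(\<Sum>b\<in>scale a ` B. scale (c b) b) = scale a (\<Sum>b\<in>B. scale (c (scale a b)) b)" for c
    by (simp add: sum.reindex[OF inj] scale_sum_right mult.commute)
  have "scale a ` L = {\<Sum>b\<in>scale a ` B. scale (c b) b | c. \<forall>b\<in>scale a ` B. c b \<in> R}"
  proof (rule equalityI; rule subsetI)
    fix x assume "x \<in> scale a ` L"
    then obtain v where v: "x = scale a v" "v \<in> L" by blast
    then obtain c where "v = (\<Sum>b\<in>B. scale (c b) b)" "\<forall>b\<in>B. c b \<in> R" unfolding B(2) by blast
    with v have c: "x = scale a (\<Sum>b\<in>B. scale (c b) b)" "\<forall>b\<in>B. c b \<in> R" by auto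
    let ?c = "\<lambda>b. c (scale (inverse a) b)"
    have "x = (\<Sum>b\<in>scale a ` B. scale (?c b) b)" "\<forall>b\<in>scale a ` B. ?c b \<in> R"
      using c assms(2) by (auto simp: sum_eq)
    then show "x \<in> {\<Sum>b\<in>scale a ` B. scale (c b) b | c. \<forall>b\<in>scale a ` B. c b \<in> R}"
      by (intro CollectI exI[of _ ?c] conjI)
  next
    fix x assume "x \<in> {\<Sum>b\<in>scale a ` B. scale (c b) b | c. \<forall>b\<in>scale a ` B. c b \<in> R}"
    then obtain c where c: "x = (\<Sum>b\<in>scale a ` B. scale (c b) b)" "\<forall>b\<in>scale a ` B. c b \<in> R" by blast
    have "(\<Sum>b\<in>B. scale (c (scale a b)) b) \<in> L" unfolding B(2) using c(2) by (intro exI[of _ "\<lambda>b. c (scale a b)"]) auto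
    then show "x \<in> scale a ` L" unfolding c(1) sum_eq by (rule imageI)
  qed
  moreover have "span (scale a ` L) = UNIV"
  proof -
    have "L \<subseteq> span (scale a ` L)"
    proof
      fix x assume "x \<in> L"
      then have "scale (inverse a) (scale a x) \<in> span (scale a ` L)"
        by (intro span_scale span_base) auto
      then show "x \<in> span (scale a ` L)" using assms(2) by simp
    qed
    then have "span L \<subseteq> span (scale a ` L)" by (rule span_minimal) (rule subspace_span)
    then show ?thesis using B(3) by blast
  qed
  then have "dim (scale a ` L) = dim UNIV" using dim_eq_full by (metis dim_UNIV dimension_def)
  ultimately show ?thesis unfolding lattice_in_def using finite_imageI[OF B(1), of "scale a"] by blast
qed

text \<open>A basis vector in \<open>P\<close> is a K-combination of generators of \<open>L\<close>,
  and a common bound for its coefficients moves it into a multiple of \<open>L\<close>. Such a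
  rescaling does not leave the homothety class.\<close>

lemma lattice_meets_P:
  assumes "R_lattice L"
  shows "\<exists>a x. a \<noteq> 0 \<and> x \<noteq> 0 \<and> x \<in> P \<inter> scale a ` L"
proof -
  obtain B where B': "finite B" "\<forall>x. x \<in> L \<longleftrightarrow> (\<exists>c. x = (\<Sum>b\<in>B. scale (c b) b) \<and> (\<forall>b\<in>B. c b \<in> R))" "span L = UNIV"
    using assms by (rule latticeE)
  note B = B'(1) B'(2)[rule_format] B'(3)
  obtain p where p: "p \<in> Bs" using Bs_nonempty by blast
  have "p \<noteq> 0" using p independent_Basis dependent_zero by blast
  have "L \<subseteq> span B" using B(2) by (auto intro!: span_sum span_scale intro: span_base)
  then have "span L \<subseteq> span B" by (rule span_minimal) (rule subspace_span)
  then have "p \<in> span B" using B(3) by auto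
  then obtain c where c: "p = (\<Sum>b\<in>B. scale (c b) b)" using span_finite[OF B(1)] by auto
  obtain a where a: "a \<noteq> 0" "\<forall>x\<in>c ` B. x / a \<in> R"
    using valuation_set_bound[OF R_valuation, of "c ` B"] B(1) by auto
  have "p = scale a (\<Sum>b\<in>B. scale (c b / a) b)" using a(1) by (simp add: c scale_sum_right)
  moreover have "(\<Sum>b\<in>B. scale (c b / a) b) \<in> L" unfolding B(2) using a(2) by (intro exI[of _ "\<lambda>b. c b / a"]) auto
  ultimately have "p \<in> scale a ` L" by blast
  then show ?thesis using a(1) \<open>p \<noteq> 0\<close> p Bs_P by blast
qed

text \<open>Among the nonzero vectors of the finite group \<open>P \<inter> L\<close>, one whose coordinates generate the
  smallest ideal of a valuation ring over \<open>A\<close> centred on \<open>I\<close> is fixed, because \<open>g - 1\<close> makes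
  this ideal strictly smaller.\<close>

lemma fixed_vector:
  assumes L: "R_lattice L" and M: "\<exists>x\<in>P \<inter> L. x \<noteq> 0"
    and G: "\<And>g. g \<in> G \<Longrightarrow> Vector_Spaces.linear scale scale g \<and> g ` P \<subseteq> P \<and> g ` L \<subseteq> L \<and>
      (\<forall>x\<in>P. g x - x \<in> ideal_times scale I P)"
  shows "\<exists>x. x \<noteq> 0 \<and> (\<forall>g\<in>G. g x = x)"
proof -
  obtain Q where Q: "valuation_set Q" "A \<subseteq> Q" "I \<subseteq> nonunits Q" using valuation_over_I by blast
  have Qs: "subring_set Q" using Q(1) by (simp add: valuation_set_def)
  note m = ring_idealD[OF ring_ideal_nonunits[OF Q(1)]]
  \<comment> \<open>The coordinates of \<open>x\<close> generate a principal ideal over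
    \<open>Q\<close>, and \<open>c\<close> is a generator found among them.\<close>
  have gen: "\<exists>c. c \<noteq> 0 \<and> (\<exists>y. c = f y x) \<and> (\<forall>y. f y x / c \<in> Q)" if x: "x \<in> P" "x \<noteq> 0" for x
  proof -
    let ?S = "(\<lambda>y. f y x) ` {y. f y x \<noteq> 0}"
    have "finite ?S" "?S \<noteq> {}" "0 \<notin> ?S" using f_nonzero[OF x] f_finite[OF x(1)] by auto
    from valuation_set_max[OF Q(1) this] obtain c where c: "c \<in> ?S" "\<forall>b\<in>?S. b / c \<in> Q" by blast
    have "f y x / c \<in> Q" for y
      using c(2) subring_setD(2)[OF Qs] by (cases "f y x = 0") auto
    then show ?thesis using c(1) by auto
  qed
  define \<gamma> where "\<gamma> x = (SOME c. c \<noteq> 0 \<and> (\<exists>y. c = f y x) \<and> (\<forall>y. f y x / c \<in> Q))" for x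
  have \<gamma>: "\<gamma> x \<noteq> 0 \<and> (\<exists>y. \<gamma> x = f y x) \<and> (\<forall>y. f y x / \<gamma> x \<in> Q)" if "x \<in> P" "x \<noteq> 0" for x
    unfolding \<gamma>_def using gen[OF that] by (rule someI_ex)
  let ?M = "P \<inter> L - {0}"
  have "finite (\<gamma> ` ?M)" "\<gamma> ` ?M \<noteq> {}"
    using finite_P_lattice[OF L] M by auto
  moreover have "0 \<notin> \<gamma> ` ?M"
  proof
    assume "0 \<in> \<gamma> ` ?M"
    then obtain z where "0 = \<gamma> z" "z \<in> ?M" by (rule imageE)
    then show False using \<gamma>[of z] by simp
  qed
  ultimately have "finite (\<gamma> ` ?M)" "\<gamma> ` ?M \<noteq> {}" "0 \<notin> \<gamma> ` ?M" .
  \<comment> \<open>For this vector \<open>\<gamma> x\<close> is a multiple of every other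
    \<open>\<gamma> z\<close>: its ideal is the smallest one.\<close>
  from valuation_set_min[OF Q(1) this] obtain x where x: "x \<in> ?M" "\<And>z. z \<in> ?M \<Longrightarrow> \<gamma> x / \<gamma> z \<in> Q" by blast
  have "g x = x" if g: "g \<in> G" for g
  proof (rule ccontr)
    assume "g x \<noteq> x"
    interpret g: Vector_Spaces.linear scale scale g using G[OF g] by simp
    have gP: "g v \<in> P" if "v \<in> P" for v using G[OF g] that by auto
    have xP: "x \<in> P" using x by simp
    define z where "z = g x - x"
    have zM: "z \<in> ?M"
    proof -
      have "g x \<in> L" using G[OF g] x(1) by auto
      then have "g x + - x \<in> L" using x(1) L by (intro lattice_zero_add_scale(2) lattice_minus) auto
      then show ?thesis using P_diff[OF gP[OF xP] xP] \<open>g x \<noteq> x\<close> by (simp add: z_def)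
    qed
    have fI0: "f y (scale a v) \<in> I \<and> scale a v \<in> P" if av: "a \<in> I" "v \<in> P" for a v y
    proof -
      have aA: "a \<in> A" by (rule ring_idealD(7)[OF I_ring_ideal av(1)])
      have "f y v * a \<in> I" by (rule ring_idealD(6)[OF I_ring_ideal f_A[OF av(2)] av(1)])
      then show ?thesis using f_scale[OF aA av(2), of y] P_scale[OF aA av(2)] by (simp add: mult.commute)
    qed
    have fI: "f y u \<in> I \<and> u \<in> P" if "u \<in> ideal_times scale I P" for u y
      using that unfolding ideal_times_def
    proof (induction u rule: generate.induct)
      case one
      then show ?case using f_zero P_zero ring_idealD(3)[OF I_ring_ideal] by (simp add: module_of_def)
    next
      case (incl h)
      then show ?case using fI0 by blast
    next
      case (inv h)
      then have "h \<in> P" "f y h \<in> I" using fI0 by blast+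
      moreover have "inv\<^bsub>add_monoid (module_of scale UNIV)\<^esub> h = - h"
      proof -
        have "comm_group (add_monoid (module_of scale (UNIV :: 'w set)))"
          by (rule comm_groupI) (auto simp: module_of_def add.assoc add.commute intro: exI[of _ "- _"])
        then interpret W: comm_group "add_monoid (module_of scale (UNIV :: 'w set))" .
        show ?thesis by (rule W.inv_equality) (auto simp: module_of_def)
      qed
      ultimately show ?case using f_minus P_minus ring_idealD(8)[OF I_ring_ideal] by simp
    next
      case (eng h h')
      then show ?case using f_add P_add ring_idealD(5)[OF I_ring_ideal] by (simp add: module_of_def)
    qed
    obtain y1 where y1: "\<gamma> z = f y1 z" using \<gamma>[of z] zM by auto
    let ?S = "{y. f y x \<noteq> 0}"
    have "g x = (\<Sum>y\<in>?S. scale (f y x) (g (e y)))"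
      by (subst dual_basis[OF xP]) (simp add: g.sum g.scale)
    \<comment> \<open>A coordinate of z is a sum of products of a coordinate of x, which is a
      multiple of \<open>\<gamma> x\<close>, with a coordinate of g e_y - e_y, which lies in
      \<open>I\<close>. So \<open>\<gamma> z / \<gamma> x\<close> is a non-unit, against the choice
      of x.\<close>
    then have z_eq: "z = (\<Sum>y\<in>?S. scale (f y x) (g (e y) - e y))"
      using dual_basis[OF xP] by (simp add: z_def scale_right_diff_distrib sum_subtractf)
    have eP: "e y \<in> P" if "y \<in> ?S" for y using e_P[OF xP] that by simp
    have "f y1 z = (\<Sum>y\<in>?S. f y x * f y1 (g (e y) - e y))"
      unfolding z_eq using f_A[OF xP] gP P_diff eP by (intro f_sum_scale) auto
    then have "f y1 z / \<gamma> x = (\<Sum>y\<in>?S. f y x / \<gamma> x * f y1 (g (e y) - e y))"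
      by (simp add: sum_divide_distrib)
    also have "\<dots> \<in> nonunits Q"
    proof (rule ring_ideal_sum[OF ring_ideal_nonunits[OF Q(1)]])
      fix y assume "y \<in> ?S"
      then have "g (e y) - e y \<in> ideal_times scale I P" using G[OF g] eP by blast
      then have "f y1 (g (e y) - e y) \<in> nonunits Q" using fI Q(3) by blast
      then show "f y x / \<gamma> x * f y1 (g (e y) - e y) \<in> nonunits Q"
        using \<gamma>[of x] x(1) by (intro m(6)) auto
    qed
    finally have "\<gamma> x / \<gamma> z * (\<gamma> z / \<gamma> x) \<in> nonunits Q"
      using x(2)[OF zM] y1 by (intro m(6)) auto
    then show False using m(4) \<gamma>[of x] \<gamma>[of z] x(1) zM by simp
  qed
  then show ?thesis using x(1) by blast
qed

text \<open>A kernel vector has a non-zero multiple in \<open>P\<close>, where \<open>g\<close> is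
  injective.\<close>

lemma linear_bij_P_inj:
  assumes g: "Vector_Spaces.linear scale scale g" "bij_betw g P P"
  shows "inj g"
proof -
  interpret g: Vector_Spaces.linear scale scale g by fact
  have "x = 0" if "g x = 0" for x
  proof -
    obtain a where a: "a \<in> A" "a \<noteq> 0" "scale a x \<in> P" using P_denominator by blast
    have "g (scale a x) = g 0" using that by (simp add: g.scale g.zero)
    then have "scale a x = 0" by (rule inj_onD[OF bij_betw_imp_inj_on[OF g(2)] _ a(3) P_zero])
    then show ?thesis using a(2) by simp
  qed
  note zero = this
  show ?thesis
  proof (rule injI)
    fix x y assume "g x = g y"
    then have "g (x - y) = 0" by (simp add: g.diff)
    from zero[OF this] show "x = y" by simp
  qed
qed

text \<open>The multiples of \<open>L\<close> by powers of \<open>a\<close> are nested; equal finite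
  numbers of points of \<open>P\<close> make their intersections with \<open>P\<close> coincide. A
  non-zero common point would have coordinates that, up to a fixed factor, are divisible in
  \<open>R\<close> by every power of \<open>a\<close>.\<close>

lemma not_homothetic_nonunit:
  assumes L: "R_lattice L" and g: "Vector_Spaces.linear scale scale g" "bij_betw g P P"
    and a: "a \<in> nonunits R" "a \<noteq> 0"
    and card: "\<And>c. c \<noteq> 0 \<Longrightarrow> card (P \<inter> scale (a * c) ` L) = card (P \<inter> scale c ` L)"
  shows False
proof -
  obtain b x where bx: "b \<noteq> 0" "x \<noteq> 0" "x \<in> P \<inter> scale b ` L" using lattice_meets_P[OF L] by blast
  have aR: "a \<in> R" using a by (simp add: nonunits_def)
  have eq: "P \<inter> scale (a ^ j * b) ` L = P \<inter> scale b ` L" for j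
  proof (induction j)
    case (Suc j)
    have "scale (a * (a ^ j * b)) ` L \<subseteq> scale (a ^ j * b) ` L"
    proof (rule image_subsetI)
      fix v assume "v \<in> L"
      then have "scale a v \<in> L" using lattice_zero_add_scale(3)[OF L aR] by blast
      then have "scale (a ^ j * b) (scale a v) \<in> scale (a ^ j * b) ` L" by blast
      then show "scale (a * (a ^ j * b)) v \<in> scale (a ^ j * b) ` L" by (simp add: ac_simps)
    qed
    moreover have "finite (P \<inter> scale (a ^ j * b) ` L)"
      using a(2) bx(1) L by (intro finite_P_lattice lattice_scale) auto
    ultimately have "P \<inter> scale (a * (a ^ j * b)) ` L = P \<inter> scale (a ^ j * b) ` L"
      using card[of "a ^ j * b"] a(2) bx(1) by (intro card_subset_eq) auto
    then show ?case using Suc by (simp add: mult.assoc)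
  qed simp
  obtain c where c: "c \<noteq> 0" "\<And>x b. x \<in> L \<Longrightarrow> b \<in> Bs \<Longrightarrow> coord x b / c \<in> R"
    using lattice_coord_bound[OF L] by blast
  have "coord x v = 0" if v: "v \<in> Bs" for v
  proof -
    have "coord x v / (b * c) = 0"
    proof (rule R_separated[OF a])
      fix j
      have "x \<in> scale (a ^ j * b) ` L" using eq[of j] bx(3) by blast
      then obtain u where u: "u \<in> L" "x = scale (a ^ j * b) u" by blast
      then have "coord x v / (b * c) / a ^ j = coord u v / c"
        using a(2) bx(1) by (simp add: coord_scale field_simps)
      then show "coord x v / (b * c) / a ^ j \<in> R" using c(2)[OF u(1) v] by simp
    qed
    then show ?thesis using bx(1) c(1) by simp
  qed
  then show False using coord_zero_imp bx(2) by blast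
qed

text \<open>As \<open>h\<close> preserves \<open>P\<close>, the lattices c L and a c L contain
  equally many points of \<open>P\<close> for every non-zero c. So neither \<open>a\<close> nor its
  inverse is a non-unit of \<open>R\<close>, and multiplication by a unit preserves L.\<close>

lemma homothetic_image_eq:
  assumes L: "R_lattice L" and h: "Vector_Spaces.linear scale scale h" "bij_betw h P P"
    and a: "a \<noteq> 0" "h ` L = scale a ` L"
  shows "h ` L = L"
proof (rule ccontr)
  assume ne: "h ` L \<noteq> L"
  interpret h: Vector_Spaces.linear scale scale h by (rule h)
  have inj: "inj h" by (rule linear_bij_P_inj[OF h])
  have card: "card (P \<inter> scale (a * c) ` L) = card (P \<inter> scale c ` L)" if "c \<noteq> 0" for c
  proof -
    have "h ` (P \<inter> scale c ` L) = h ` P \<inter> h ` scale c ` L" by (rule image_Int[OF inj])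
    also have "h ` P = P" using h(2) by (simp add: bij_betw_def)
    also have "h ` scale c ` L = scale c ` h ` L" by (simp add: image_image h.scale)
    also have "\<dots> = scale (a * c) ` L" unfolding a(2) by (simp add: image_image mult.commute)
    finally show ?thesis using card_image[OF inj_on_subset[OF inj subset_UNIV], of "P \<inter> scale c ` L"] by simp
  qed
  consider "a \<in> R" "inverse a \<in> R" | "a \<in> nonunits R" | "inverse a \<in> nonunits R"
    using R_valuation by (auto simp: nonunits_def valuation_set_def)
  then show False
  proof cases
    case 1
    have "scale a ` L = L"
    proof
      show "scale a ` L \<subseteq> L" using lattice_zero_add_scale(3)[OF L 1(1)] by blast
      show "L \<subseteq> scale a ` L"
      proof
        fix v assume "v \<in> L"
        then have "scale a (scale (inverse a) v) \<in> scale a ` L" using lattice_zero_add_scale(3)[OF L 1(2)] by blast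
        then show "v \<in> scale a ` L" using a(1) by simp
      qed
    qed
    then show False using ne a(2) by simp
  next
    case 2
    then show False using not_homothetic_nonunit[OF L h _ a(1)] card by blast
  next
    case 3
    have "card (P \<inter> scale (inverse a * c) ` L) = card (P \<inter> scale c ` L)" if "c \<noteq> 0" for c
      using card[of "inverse a * c"] that a(1) by (simp add: mult.assoc[symmetric])
    then show False using not_homothetic_nonunit[OF L h 3] a(1) by auto
  qed
qed

end


section \<open>Arithmetic groups acting on the building\<close>

lemma homothety_class_self: "vector_space scale \<Longrightarrow> L \<in> homothety_class scale L"
  unfolding homothety_class_def
  by (intro CollectI exI[of _ 1]) (simp add: vector_space_def)

section \<open>Automorphisms of \<open>P\<close> and congruence subgroups\<close>

context arithmetic_module
begin

definition automorphism :: "('w \<Rightarrow> 'w) \<Rightarrow> bool" where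
  "automorphism g \<longleftrightarrow> Vector_Spaces.linear scale scale g \<and> bij_betw g P P"

lemma carrier_aut_group: "carrier (aut_group scale P) = Collect automorphism"
  by (auto simp: aut_group_def automorphism_def)

lemma automorphism_linear: "automorphism g \<Longrightarrow> Vector_Spaces.linear scale scale g"
  by (simp add: automorphism_def)

lemma automorphism_P: "automorphism g \<Longrightarrow> x \<in> P \<Longrightarrow> g x \<in> P"
  by (auto simp: automorphism_def bij_betw_def)

lemma automorphism_image_P: "automorphism g \<Longrightarrow> g ` P = P"
  by (simp add: automorphism_def bij_betw_def)

text \<open>For surjectivity, every vector has a non-zero multiple in \<open>P\<close>, which is the
  image of \<open>P\<close>.\<close>

lemma automorphism_bij:
  assumes "automorphism g"
  shows "bij g"
proof (rule bijI)
  show "inj g" using assms linear_bij_P_inj by (simp add: automorphism_def)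
  interpret g: Vector_Spaces.linear scale scale g by (rule automorphism_linear[OF assms])
  show "surj g"
  proof (rule surjI)
    fix x
    obtain a where a: "a \<in> A" "a \<noteq> 0" "scale a x \<in> P" using P_denominator by blast
    then have "\<exists>p. scale a x = g p" using automorphism_image_P[OF assms] by blast
    then obtain p where "scale a x = g p" ..
    then have "g (scale (inverse a) p) = x" using a(2) by (simp add: g.scale flip: \<open>scale a x = g p\<close>)
    then show "g (SOME y. g y = x) = x" by (rule someI)
  qed
qed

lemma automorphism_id: "automorphism id"
  unfolding automorphism_def by (auto simp: Vector_Spaces.linear_iff vector_space_axioms)

lemma automorphism_comp: "automorphism g \<Longrightarrow> automorphism h \<Longrightarrow> automorphism (g \<circ> h)"
  unfolding automorphism_def by (auto simp: Vector_Spaces.linear_iff intro: bij_betw_trans)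

lemma automorphism_inverse:
  assumes "automorphism g"
  shows "automorphism (inv_into UNIV g)"
proof -
  interpret g: Vector_Spaces.linear scale scale g by (rule automorphism_linear[OF assms])
  note b = automorphism_bij[OF assms]
  have gi: "g (inv_into UNIV g x) = x" for x using b by (simp add: bij_is_surj surj_f_inv_f)
  have ig: "inv_into UNIV g (g x) = x" for x using b by (simp add: bij_is_inj)
  have "inv_into UNIV g (x + y) = inv_into UNIV g x + inv_into UNIV g y" for x y
    using ig[of "inv_into UNIV g x + inv_into UNIV g y"] by (simp add: g.add gi)
  moreover have "inv_into UNIV g (scale a x) = scale a (inv_into UNIV g x)" for a x
    using ig[of "scale a (inv_into UNIV g x)"] by (simp add: g.scale gi)
  moreover have "bij_betw (inv_into UNIV g) P P"
  proof (rule bij_betwI[where g = g])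
    show "g \<in> P \<rightarrow> P" using automorphism_P[OF assms] by auto
    show "inv_into UNIV g \<in> P \<rightarrow> P"
    proof
      fix x assume "x \<in> P"
      then obtain p where "x = g p" "p \<in> P" using automorphism_image_P[OF assms] by blast
      then show "inv_into UNIV g x \<in> P" by (simp add: ig)
    qed
  qed (simp_all add: gi ig)
  ultimately show ?thesis
    unfolding automorphism_def by (simp add: Vector_Spaces.linear_iff vector_space_axioms)
qed

lemma automorphism_power: "automorphism g \<Longrightarrow> automorphism (g ^^ n)"
  by (induction n) (auto simp: automorphism_id automorphism_comp)

lemma group_aut_group: "Group.group (aut_group scale P)"
proof (rule groupI)
  fix g assume "g \<in> carrier (aut_group scale P)"
  then have g: "automorphism g" by (simp add: carrier_aut_group)
  have "inv_into UNIV g \<circ> g = id" using automorphism_bij[OF g] by (simp add: bij_is_inj)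
  then have "inv_into UNIV g \<otimes>\<^bsub>aut_group scale P\<^esub> g = \<one>\<^bsub>aut_group scale P\<^esub>"
    by (simp add: aut_group_def)
  moreover have "inv_into UNIV g \<in> carrier (aut_group scale P)"
    by (simp add: carrier_aut_group automorphism_inverse[OF g])
  ultimately show "\<exists>h\<in>carrier (aut_group scale P). h \<otimes>\<^bsub>aut_group scale P\<^esub> g = \<one>\<^bsub>aut_group scale P\<^esub>"
    by (rule bexI)
qed (auto simp: carrier_aut_group automorphism_id automorphism_comp, auto simp: aut_group_def automorphism_id automorphism_comp comp_assoc)

lemma inv_aut_group:
  assumes "automorphism g"
  shows "inv\<^bsub>aut_group scale P\<^esub> g = inv_into UNIV g"
proof -
  interpret G: group "aut_group scale P" by (rule group_aut_group)
  have "inv_into UNIV g \<circ> g = id" using automorphism_bij[OF assms] by (simp add: bij_is_inj)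
  then show ?thesis
    using assms automorphism_inverse[OF assms]
    by (intro G.inv_equality) (auto simp: carrier_aut_group, auto simp: aut_group_def)
qed

abbreviation "\<Gamma> \<equiv> congruence_subgroup scale P I"
abbreviation "IP \<equiv> ideal_times scale I P"

lemma \<Gamma>_iff: "g \<in> \<Gamma> \<longleftrightarrow> automorphism g \<and> (\<forall>x\<in>P. g x - x \<in> IP)"
  by (auto simp: congruence_subgroup_def carrier_aut_group)

lemma add_monoid_group: "comm_group (add_monoid (module_of scale (UNIV :: 'w set)))"
  by (rule comm_groupI) (auto simp: module_of_def add.assoc add.commute intro: exI[of _ "- _"])

lemma IP_subgroup: "subgroup IP (add_monoid (module_of scale (UNIV :: 'w set)))"
proof -
  interpret W: comm_group "add_monoid (module_of scale (UNIV :: 'w set))" by (rule add_monoid_group)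
  show ?thesis unfolding ideal_times_def by (rule W.generate_is_subgroup) (simp add: module_of_def)
qed

lemma minus_module_of: "inv\<^bsub>add_monoid (module_of scale UNIV)\<^esub> h = - (h::'w)"
proof -
  interpret W: comm_group "add_monoid (module_of scale (UNIV :: 'w set))" by (rule add_monoid_group)
  show ?thesis by (rule W.inv_equality) (auto simp: module_of_def)
qed

lemma IP_zero: "0 \<in> IP" and IP_add: "x \<in> IP \<Longrightarrow> y \<in> IP \<Longrightarrow> x + y \<in> IP" and IP_minus: "x \<in> IP \<Longrightarrow> - x \<in> IP"
  using subgroup.one_closed[OF IP_subgroup] subgroup.m_closed[OF IP_subgroup, of x y]
    subgroup.m_inv_closed[OF IP_subgroup, of x]
  by (simp_all add: minus_module_of) (simp_all add: module_of_def)

lemma IP_automorphism: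
  assumes "automorphism g" "x \<in> IP"
  shows "g x \<in> IP"
proof -
  interpret g: Vector_Spaces.linear scale scale g by (rule automorphism_linear[OF assms(1)])
  have gen: "g h \<in> IP" if h: "h \<in> {scale a x |a x. a \<in> I \<and> x \<in> P}" for h
  proof -
    obtain a x where "h = scale a x" "a \<in> I" "x \<in> P" using h by blast
    then have "g h \<in> {scale a x |a x. a \<in> I \<and> x \<in> P}" using automorphism_P[OF assms(1)] by (auto simp: g.scale)
    then show ?thesis unfolding ideal_times_def by (rule generate.incl)
  qed
  show ?thesis
    \<comment> \<open>The instantiated equation unfolds only the membership of \<open>x\<close>, so
      that the goal keeps \<open>IP\<close> folded.\<close>
    using assms(2) unfolding ideal_times_def[of scale I P, THEN arg_cong[of _ _ "\<lambda>S. x \<in> S"]]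
  proof (induction x rule: generate.induct)
    case one
    then show ?case using IP_zero g.zero by (simp add: module_of_def)
  next
    case (incl h)
    then show ?case by (rule gen)
  next
    case (inv h)
    then show ?case using IP_minus[OF gen] by (simp add: minus_module_of g.neg)
  next
    case (eng h h')
    then show ?case using IP_add by (simp add: module_of_def g.add)
  qed
qed

text \<open>With y the preimage of x under t, one has t h t^-1 x - x = t (h y - y), and
  automorphisms of \<open>P\<close> preserve \<open>IP\<close>.\<close>

lemma \<Gamma>_normal: "\<Gamma> \<lhd> aut_group scale P"
proof -
  interpret G: group "aut_group scale P" by (rule group_aut_group)
  have mult: "g \<otimes>\<^bsub>aut_group scale P\<^esub> h = g \<circ> h" for g h by (simp add: aut_group_def)
  have gi: "g (inv_into UNIV g x) = x" if "automorphism g" for g x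
    using automorphism_bij[OF that] by (simp add: bij_is_surj surj_f_inv_f)
  show ?thesis
  proof (rule G.normal_invI)
    show "subgroup \<Gamma> (aut_group scale P)"
    proof (rule G.subgroupI)
      show "\<Gamma> \<subseteq> carrier (aut_group scale P)" by (auto simp: \<Gamma>_iff carrier_aut_group)
      have "id \<in> \<Gamma>" by (simp add: \<Gamma>_iff automorphism_id IP_zero)
      then show "\<Gamma> \<noteq> {}" by blast
    next
      fix g assume g: "g \<in> \<Gamma>"
      then have a: "automorphism g" by (simp add: \<Gamma>_iff)
      have "inv_into UNIV g x - x \<in> IP" if "x \<in> P" for x
      proof -
        have "inv_into UNIV g x \<in> P" by (rule automorphism_P[OF automorphism_inverse[OF a] that])
        then have "g (inv_into UNIV g x) - inv_into UNIV g x \<in> IP" using g by (simp add: \<Gamma>_iff)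
        then have "- (x - inv_into UNIV g x) \<in> IP" unfolding gi[OF a] by (rule IP_minus)
        then show ?thesis by simp
      qed
      then show "inv\<^bsub>aut_group scale P\<^esub> g \<in> \<Gamma>"
        unfolding inv_aut_group[OF a] by (simp add: \<Gamma>_iff automorphism_inverse[OF a])
    next
      fix g h assume gh: "g \<in> \<Gamma>" "h \<in> \<Gamma>"
      have "g (h x) - x \<in> IP" if "x \<in> P" for x
      proof -
        have "h x \<in> P" using gh(2) that automorphism_P by (simp add: \<Gamma>_iff)
        then have "(g (h x) - h x) + (h x - x) \<in> IP" using gh that by (intro IP_add) (auto simp: \<Gamma>_iff)
        then show ?thesis by simp
      qed
      then show "g \<otimes>\<^bsub>aut_group scale P\<^esub> h \<in> \<Gamma>" using gh by (simp add: \<Gamma>_iff mult automorphism_comp)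
    qed
    fix t h assume th: "t \<in> carrier (aut_group scale P)" "h \<in> \<Gamma>"
    then have t: "automorphism t" by (simp add: carrier_aut_group)
    interpret t: Vector_Spaces.linear scale scale t by (rule automorphism_linear[OF t])
    have "t (h (inv_into UNIV t x)) - x \<in> IP" if "x \<in> P" for x
    proof -
      have "inv_into UNIV t x \<in> P" by (rule automorphism_P[OF automorphism_inverse[OF t] that])
      then have "t (h (inv_into UNIV t x) - inv_into UNIV t x) \<in> IP"
        using th(2) by (intro IP_automorphism[OF t]) (simp add: \<Gamma>_iff)
      then show ?thesis by (simp add: t.diff gi[OF t])
    qed
    then show "t \<otimes>\<^bsub>aut_group scale P\<^esub> h \<otimes>\<^bsub>aut_group scale P\<^esub> inv\<^bsub>aut_group scale P\<^esub> t \<in> \<Gamma>"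
      unfolding inv_aut_group[OF t] mult
      using th(2) t by (simp add: \<Gamma>_iff automorphism_comp automorphism_inverse)
  qed
qed

section \<open>The building and the action on it\<close>

abbreviation "bldg \<equiv> building scale R \<pi>"

lemma buildingE:
  assumes "s \<in> bldg"
  obtains d L where "card s = d + 1" "s = homothety_class scale ` L ` {0..d}" "\<forall>i\<le>d. R_lattice (L i)"
    "\<forall>i<d. L (Suc i) \<subset> L i" "scale \<pi> ` L 0 \<subset> L d" "\<forall>i j. i < j \<longrightarrow> j \<le> d \<longrightarrow> L j \<subset> L i"
proof -
  obtain d L where *: "card s = d + 1" "s = homothety_class scale ` L ` {0..d}" "\<forall>i\<le>d. R_lattice (L i)"
    "\<forall>i<d. L (Suc i) \<subset> L i" "scale \<pi> ` L 0 \<subset> L d"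
    using assms unfolding building_def by blast
  have "L j \<subset> L i" if "i < j" "j \<le> d" for i j
    using that
  proof (induction j rule: less_induct)
    case (less j)
    obtain j' where j': "j = Suc j'" using less.prems by (cases j) auto
    have "L j \<subset> L j'" using * less.prems j' by simp
    then show ?case using less.IH[of j'] less.prems j' by (cases "i = j'") auto
  qed
  then show ?thesis using that[of d L] * by blast
qed

lemma homothety_class_scale:
  assumes "a \<noteq> 0"
  shows "homothety_class scale (scale a ` L) = homothety_class scale L"
proof (rule equalityI; rule subsetI)
  fix K assume "K \<in> homothety_class scale (scale a ` L)"
  then obtain b where "b \<noteq> 0" "K = scale (b * a) ` L" by (auto simp: homothety_class_def image_image)
  then show "K \<in> homothety_class scale L" unfolding homothety_class_def using assms
    by (intro CollectI exI[of _ "b * a"]) auto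
next
  fix K assume "K \<in> homothety_class scale L"
  then obtain b where "b \<noteq> 0" "K = scale b ` L" by (auto simp: homothety_class_def)
  then show "K \<in> homothety_class scale (scale a ` L)" unfolding homothety_class_def using assms
    by (intro CollectI exI[of _ "b / a"]) (auto simp: image_image)
qed

lemma self_homothety_class: "L \<in> homothety_class scale L"
  by (rule homothety_class_self) (rule vector_space_axioms)

lemma building_vertex:
  assumes "s \<in> bldg" "v \<in> s" "K \<in> v"
  shows "R_lattice K" "v = homothety_class scale K"
proof -
  obtain d L where B: "card s = d + 1" "s = homothety_class scale ` L ` {0..d}" "\<forall>i\<le>d. R_lattice (L i)"
    "\<forall>i<d. L (Suc i) \<subset> L i" "scale \<pi> ` L 0 \<subset> L d" "\<forall>i j. i < j \<longrightarrow> j \<le> d \<longrightarrow> L j \<subset> L i"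
    using assms(1) by (rule buildingE)
  note * = B(2) B(3)[rule_format]
  then obtain i where "i \<le> d" "v = homothety_class scale (L i)" using assms(2) by auto
  moreover from this assms(3) obtain a where "a \<noteq> 0" "K = scale a ` L i" by (auto simp: homothety_class_def)
  ultimately show "R_lattice K" "v = homothety_class scale K"
    using lattice_scale *(2) by (auto simp: homothety_class_scale)
qed

lemma building_finite: "s \<in> bldg \<Longrightarrow> finite s" and building_nonempty: "s \<in> bldg \<Longrightarrow> s \<noteq> {}"
proof -
  assume "s \<in> bldg"
  then have "card s > 0" by (auto simp: building_def)
  then show "finite s" "s \<noteq> {}" by (auto simp: card_gt_0_iff)
qed

lemma building_vertex_nonempty:
  assumes "s \<in> bldg" "v \<in> s"
  shows "\<exists>K. K \<in> v"
proof -
  obtain d L where B: "card s = d + 1" "s = homothety_class scale ` L ` {0..d}" "\<forall>i\<le>d. R_lattice (L i)"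
    "\<forall>i<d. L (Suc i) \<subset> L i" "scale \<pi> ` L 0 \<subset> L d" "\<forall>i j. i < j \<longrightarrow> j \<le> d \<longrightarrow> L j \<subset> L i"
    using assms(1) by (rule buildingE)
  from B(2) obtain i where "v = homothety_class scale (L i)" using assms(2) by auto
  then show ?thesis using self_homothety_class by blast
qed

lemma face_closed_building: "face_closed bldg"
  unfolding face_closed_def
proof (intro ballI allI impI)
  fix s t assume s: "s \<in> bldg" and t: "t \<subseteq> s" "t \<noteq> {}"
  obtain d L where B: "card s = d + 1" "s = homothety_class scale ` L ` {0..d}" "\<forall>i\<le>d. R_lattice (L i)"
    "\<forall>i<d. L (Suc i) \<subset> L i" "scale \<pi> ` L 0 \<subset> L d" "\<forall>i j. i < j \<longrightarrow> j \<le> d \<longrightarrow> L j \<subset> L i"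
    using s by (rule buildingE)
  note * = B(1,2) B(3,4)[rule_format] B(5) B(6)[rule_format]
  define T where "T = {i. i \<le> d \<and> homothety_class scale (L i) \<in> t}"
  have Tf: "finite T" by (simp add: T_def)
  have img: "(\<lambda>i. homothety_class scale (L i)) ` T = t" using t(1) *(2) by (auto simp: T_def)
  have Tn: "T \<noteq> {}" using img t(2) by blast
  have inj: "inj_on (\<lambda>i. homothety_class scale (L i)) {0..d}"
    using *(1,2) by (intro eq_card_imp_inj_on) (auto simp: image_image)
  have "T \<subseteq> {0..d}" by (auto simp: T_def)
  from card_image[OF inj_on_subset[OF inj this]] have "card t = card T" by (simp add: img)
  obtain m where m: "card T = Suc m" using Tf Tn by (cases "card T") auto
  then have cT: "card t = m + 1" using \<open>card t = card T\<close> by simp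
  \<comment> \<open>An increasing enumeration of the indices that occur in \<open>t\<close>. The
    corresponding lattices form a subchain between \<open>L 0\<close> and \<open>L d\<close>, so the
    last inclusion is inherited from pi L_0 and L_d.\<close>
  define e where "e i = sorted_list_of_set T ! i" for i
  have len: "length (sorted_list_of_set T) = card T" by simp
  have eT: "e ` {0..m} = T"
  proof -
    have "e ` {0..<card T} = T"
      unfolding e_def using nth_image[of "card T" "sorted_list_of_set T"] Tf by simp
    moreover have "{0..m} = {0..<card T}" unfolding m by auto
    ultimately show ?thesis by simp
  qed
  have e_mono: "e i < e j" if "i < j" "j \<le> m" for i j
  proof -
    have "sorted_wrt (<) (sorted_list_of_set T)" by simp
    moreover have "j < length (sorted_list_of_set T)" using that m by simp
    ultimately show ?thesis unfolding e_def using sorted_wrt_nth_less[OF _ that(1)] by blast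
  qed
  have ed: "e i \<le> d" if "i \<le> m" for i
  proof -
    have "e i \<in> T" using eT that by auto
    then show ?thesis by (simp add: T_def)
  qed
  have sub: "L j \<subseteq> L i" if "i \<le> j" "j \<le> d" for i j using *(6)[of i j] that by (cases "i = j") auto
  have "scale \<pi> ` L (e 0) \<subset> L (e (m))"
  proof -
    have "scale \<pi> ` L (e 0) \<subseteq> scale \<pi> ` L 0" using sub[of 0 "e 0"] ed[of 0] by (intro image_mono) auto
    also have "\<dots> \<subset> L d" by (rule *(5))
    also have "\<dots> \<subseteq> L (e (m))" using sub ed by auto
    finally show ?thesis .
  qed
  moreover have "t = homothety_class scale ` (\<lambda>i. L (e i)) ` {0..m}"
  proof -
    have "homothety_class scale ` (\<lambda>i. L (e i)) ` {0..m} = (\<lambda>i. homothety_class scale (L i)) ` (e ` {0..m})"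
      by (simp add: image_image)
    then show ?thesis by (simp add: eT img)
  qed
  moreover have "\<forall>i\<le>m. R_lattice (L (e i))" using *(3) ed by blast
  moreover have "\<forall>i<m. L (e (Suc i)) \<subset> L (e i)" using *(6) e_mono ed by (simp add: Suc_le_eq)
  ultimately show "t \<in> bldg" unfolding building_def using cT by (intro CollectI exI[of _ "m"] exI[of _ "\<lambda>i. L (e i)"] conjI)
qed

lemma vertex_action_homothety_class:
  assumes "automorphism g"
  shows "vertex_action g (homothety_class scale L) = homothety_class scale (g ` L)"
proof -
  interpret g: Vector_Spaces.linear scale scale g by (rule automorphism_linear[OF assms])
  have "g ` scale a ` L = scale a ` g ` L" for a by (simp add: image_image g.scale)
  then show ?thesis unfolding vertex_action_def homothety_class_def by blast
qed

lemma automorphism_lattice: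
  assumes g: "automorphism g" and L: "R_lattice L"
  shows "R_lattice (g ` L)"
proof -
  interpret g: Vector_Spaces.linear scale scale g by (rule automorphism_linear[OF g])
  obtain B where B: "finite B" "L = {\<Sum>b\<in>B. scale (c b) b | c. \<forall>b\<in>B. c b \<in> R}" "dim L = dim UNIV"
    using L by (auto simp: lattice_in_def)
  have inj: "inj g" "surj g" using automorphism_bij[OF g] by (auto simp: bij_def)
  have sum_eq: "(\<Sum>b\<in>g ` B. scale (c b) b) = g (\<Sum>b\<in>B. scale (c (g b)) b)" for c
    by (simp add: sum.reindex[OF inj_on_subset[OF inj(1) subset_UNIV]] g.sum g.scale)
  have "g ` L = {\<Sum>b\<in>g ` B. scale (c b) b | c. \<forall>b\<in>g ` B. c b \<in> R}"
  proof (rule equalityI; rule subsetI)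
    fix x assume "x \<in> g ` L"
    then obtain v where v: "x = g v" "v \<in> L" by blast
    then obtain c where c: "v = (\<Sum>b\<in>B. scale (c b) b)" "\<forall>b\<in>B. c b \<in> R" unfolding B(2) by blast
    let ?c = "\<lambda>b. c (inv_into UNIV g b)"
    have "x = (\<Sum>b\<in>g ` B. scale (?c b) b)" "\<forall>b\<in>g ` B. ?c b \<in> R"
      using v c inj(1) by (auto simp: sum_eq)
    then show "x \<in> {\<Sum>b\<in>g ` B. scale (c b) b | c. \<forall>b\<in>g ` B. c b \<in> R}"
      by (intro CollectI exI[of _ ?c] conjI)
  next
    fix x assume "x \<in> {\<Sum>b\<in>g ` B. scale (c b) b | c. \<forall>b\<in>g ` B. c b \<in> R}"
    then obtain c where c: "x = (\<Sum>b\<in>g ` B. scale (c b) b)" "\<forall>b\<in>g ` B. c b \<in> R" by blast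
    have "(\<Sum>b\<in>B. scale (c (g b)) b) \<in> L" unfolding B(2) using c(2) by (intro CollectI exI[of _ "\<lambda>b. c (g b)"]) auto
    then show "x \<in> g ` L" unfolding c(1) sum_eq by (rule imageI)
  qed
  moreover have "dim (g ` L) = dim UNIV"
  proof -
    have "span L = UNIV" using B(3) dim_eq_full by (metis dim_UNIV dimension_def)
    then have "span (g ` L) = UNIV" using g.span_image[of L] inj(2) by simp
    then show ?thesis using dim_eq_full by (metis dim_UNIV dimension_def)
  qed
  ultimately show ?thesis unfolding lattice_in_def using finite_imageI[OF B(1), of g] by blast
qed

lemma vertex_action_inj: "bij g \<Longrightarrow> inj (vertex_action g)"
proof (rule injI)
  fix u v assume g: "bij g" and "vertex_action g u = vertex_action g v"
  then have "(`) g ` u = (`) g ` v" by (simp add: vertex_action_def)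
  moreover have "inj ((`) g)" by (rule injI) (simp add: inj_image_eq_iff bij_is_inj[OF g])
  ultimately show "u = v" by (simp only: inj_image_eq_iff)
qed

lemma automorphism_building:
  assumes g: "automorphism g" and s: "s \<in> bldg"
  shows "vertex_action g ` s \<in> bldg"
proof -
  interpret g: Vector_Spaces.linear scale scale g by (rule automorphism_linear[OF g])
  have b: "bij g" by (rule automorphism_bij[OF g])
  obtain d L where B: "card s = d + 1" "s = homothety_class scale ` L ` {0..d}" "\<forall>i\<le>d. R_lattice (L i)"
    "\<forall>i<d. L (Suc i) \<subset> L i" "scale \<pi> ` L 0 \<subset> L d" "\<forall>i j. i < j \<longrightarrow> j \<le> d \<longrightarrow> L j \<subset> L i"
    using s by (rule buildingE)
  note * = B(1,2) B(3,4)[rule_format] B(5)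
  have strict: "g ` U \<subset> g ` V" if "U \<subset> V" for U V
    using that b by (simp add: bij_is_inj inj_image_subset_iff inj_image_eq_iff psubset_eq)
  have "card (vertex_action g ` s) = d + 1"
    using *(1) card_image[OF inj_on_subset[OF vertex_action_inj[OF b] subset_UNIV]] by simp
  moreover have "vertex_action g ` s = homothety_class scale ` (\<lambda>i. g ` L i) ` {0..d}"
    unfolding *(2) image_image vertex_action_homothety_class[OF g] ..
  moreover have "\<forall>i\<le>d. R_lattice (g ` L i)" using *(3) automorphism_lattice[OF g] by blast
  moreover have "\<forall>i<d. g ` L (Suc i) \<subset> g ` L i" by (intro allI impI strict *(4))
  moreover have "scale \<pi> ` g ` L 0 \<subset> g ` L d"
  proof -
    have "scale \<pi> ` g ` L 0 = g ` scale \<pi> ` L 0" by (simp add: image_image g.scale)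
    then show ?thesis using strict[OF *(5)] by simp
  qed
  ultimately show ?thesis unfolding building_def
    by (intro CollectI exI[of _ d] exI[of _ "\<lambda>i. g ` L i"] conjI)
qed

text \<open>The chain L_0, ..., L_d continues periodically by multiples of pi. For i <= j the
  quotient c / b decides: if it lies in \<open>R\<close>, then c L_j lies in b L_i; otherwise b / c
  is divisible by pi in \<open>R\<close>, and b L_i lies in c L_j because pi L_0 lies in
  L_d.\<close>

lemma building_comparable:
  assumes s: "s \<in> bldg" and "v \<in> s" "K \<in> v" "v' \<in> s" "K' \<in> v'"
  shows "K \<subseteq> K' \<or> K' \<subseteq> K"
proof -
  obtain d L where B: "card s = d + 1" "s = homothety_class scale ` L ` {0..d}" "\<forall>i\<le>d. R_lattice (L i)"
    "\<forall>i<d. L (Suc i) \<subset> L i" "scale \<pi> ` L 0 \<subset> L d" "\<forall>i j. i < j \<longrightarrow> j \<le> d \<longrightarrow> L j \<subset> L i"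
    using s by (rule buildingE)
  note * = B(2) B(3)[rule_format] B(5) B(6)[rule_format]
  have sub: "L j \<subseteq> L i" if "i \<le> j" "j \<le> d" for i j using *(4)[of i j] that by (cases "i = j") auto
  have cmp: "scale b ` L i \<subseteq> scale c ` L j \<or> scale c ` L j \<subseteq> scale b ` L i"
    if "i \<le> j" "j \<le> d" "b \<noteq> 0" "c \<noteq> 0" for b c i j
  proof (cases "c / b \<in> R")
    case True
    have "scale c ` L j \<subseteq> scale b ` L i"
    proof (rule image_subsetI)
      fix v assume "v \<in> L j"
      then have v: "v \<in> L i" using sub that by blast
      have "i \<le> d" using that by simp
      have "scale b (scale (c / b) v) \<in> scale b ` L i"
        by (rule imageI) (rule lattice_zero_add_scale(3)[OF *(2)[OF \<open>i \<le> d\<close>] True v])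
      then show "scale c v \<in> scale b ` L i" using that by simp
    qed
    then show ?thesis ..
  next
    case False
    have r: "inverse (c / b) / \<pi> \<in> R" by (rule not_R_iff[OF False])
    have "scale b ` L i \<subseteq> scale c ` L j"
    proof (rule image_subsetI)
      fix v assume "v \<in> L i"
      then have "v \<in> L 0" using sub[of 0 i] that by auto
      then have v: "scale \<pi> v \<in> L j" using *(3) sub[of j d] that by blast
      have "scale c (scale (inverse (c / b) / \<pi>) (scale \<pi> v)) \<in> scale c ` L j"
        by (rule imageI) (rule lattice_zero_add_scale(3)[OF *(2)[OF that(2)] r v])
      then show "scale b v \<in> scale c ` L j" using that \<pi>_nonzero by simp
    qed
    then show ?thesis ..
  qed
  obtain i j where ij: "i \<le> d" "j \<le> d" "v = homothety_class scale (L i)" "v' = homothety_class scale (L j)"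
  proof -
    have "v \<in> homothety_class scale ` L ` {0..d}" "v' \<in> homothety_class scale ` L ` {0..d}"
      using assms(2,4) unfolding *(1) by auto
    then show ?thesis using that by auto
  qed
  obtain b where b: "b \<noteq> 0" "K = scale b ` L i" using assms(3) ij by (auto simp: homothety_class_def)
  obtain c where c: "c \<noteq> 0" "K' = scale c ` L j" using assms(5) ij by (auto simp: homothety_class_def)
  show ?thesis
  proof (cases "i \<le> j")
    case True
    then show ?thesis using cmp[of i j b c] ij b c by blast
  next
    case False
    then show ?thesis using cmp[of j i c b] ij b c by auto
  qed
qed

end


section \<open>Stabilizers of simplices and their fixed spaces\<close>

context arithmetic_module
begin

text \<open>The lattices in a simplex form a chain, so an automorphism that permutes them without fixing
  them would have a power that is a nontrivial homothety on one of them.\<close>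

lemma simplex_stabilizer_fixes:
  assumes g: "automorphism g" and s: "s \<in> bldg" "vertex_action g ` s = s" and K: "v \<in> s" "K \<in> v"
  shows "g ` K = K"
proof -
  have step: "\<exists>v\<in>s. g ` U \<in> v" if U: "\<exists>v\<in>s. U \<in> v" for U
  proof -
    obtain v where "v \<in> s" "U \<in> v" using U by blast
    then show ?thesis using s(2) by (auto simp: vertex_action_def)
  qed
  have iter: "\<exists>v\<in>s. (g ^^ n) ` K \<in> v" for n
  proof (induction n)
    case (Suc n)
    then show ?case using step[OF Suc] by (simp add: image_comp)
  qed (use K in auto)
  \<comment> \<open>The orbit of the vertex of \<open>K\<close> stays in the finite set
    \<open>s\<close>, so two members coincide, and a positive power \<open>h\<close> of
    \<open>g\<close> maps \<open>K\<close> to a homothetic lattice.\<close>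
  define c where "c n = homothety_class scale ((g ^^ n) ` K)" for n
  have "range c \<subseteq> s"
    unfolding c_def using iter building_vertex(2)[OF s(1)] by blast
  then have "finite (range c)" using building_finite[OF s(1)] finite_subset by blast
  then have "\<not> inj c" using finite_imageD[of c UNIV] by auto
  then obtain i j where "c i = c j" "i \<noteq> j" by (auto simp: inj_def)
  then obtain i j where ij: "c i = c j" "i < j" by (metis linorder_neqE_nat)
  define h where "h = g ^^ (j - i)"
  have h: "automorphism h" unfolding h_def by (rule automorphism_power[OF g])
  have "(g ^^ j) ` K \<in> c j" unfolding c_def by (rule self_homothety_class)
  then have "(g ^^ j) ` K \<in> c i" by (simp only: ij(1))
  then obtain a where a: "a \<noteq> 0" "(g ^^ j) ` K = scale a ` (g ^^ i) ` K"
    by (auto simp: c_def homothety_class_def)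
  interpret gi: Vector_Spaces.linear scale scale "g ^^ i"
    by (rule automorphism_linear[OF automorphism_power[OF g]])
  have "g ^^ i \<circ> h = g ^^ j" unfolding h_def using ij(2) by (simp flip: funpow_add)
  then have "(g ^^ i) ` (h ` K) = (g ^^ j) ` K" by (simp only: image_comp)
  also have "\<dots> = scale a ` (g ^^ i) ` K" by (rule a(2))
  also have "\<dots> = (g ^^ i) ` (scale a ` K)" by (simp add: image_image gi.scale)
  finally have "(g ^^ i) ` (h ` K) = (g ^^ i) ` (scale a ` K)" .
  then have haK: "h ` K = scale a ` K"
    using bij_is_inj[OF automorphism_bij[OF automorphism_power[OF g]]] by (simp add: inj_image_eq_iff)
  have "Vector_Spaces.linear scale scale h" "bij_betw h P P" using h by (simp_all add: automorphism_def)
  then have hK: "h ` K = K"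
    by (rule homothetic_image_eq[OF building_vertex(1)[OF s(1) K] _ _ a(1) haK])
  obtain m where m: "j - i = Suc m" using ij(2) by (cases "j - i") auto
  have K_eq: "g ` (g ^^ m) ` K = K" using hK by (simp add: h_def m image_comp)
  obtain v' where "v' \<in> s" "g ` K \<in> v'" using step K by blast
  \<comment> \<open>By comparability the lattices K, g K, g^2 K, ... form a monotone sequence; since
    it returns to K, it is constant.\<close>
  then consider "g ` K \<subseteq> K" | "K \<subseteq> g ` K" using building_comparable[OF s(1) K] by blast
  then show ?thesis
  proof cases
    case 1
    have "(g ^^ n) ` K \<subseteq> K" for n
    proof (induction n)
      case (Suc n)
      then have "g ` (g ^^ n) ` K \<subseteq> g ` K" by (rule image_mono)
      then show ?case using 1 by (simp add: image_comp)
    qed simp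
    from image_mono[OF this[of m], of g] show ?thesis using 1 K_eq by auto
  next
    case 2
    have "K \<subseteq> (g ^^ n) ` K" for n
    proof (induction n)
      case (Suc n)
      then have "g ` K \<subseteq> g ` (g ^^ n) ` K" by (rule image_mono)
      then show ?case using 2 by (simp add: image_comp)
    qed simp
    from image_mono[OF this[of m], of g] show ?thesis using 2 K_eq by auto
  qed
qed

text \<open>As in \<open>fixing_subcomplex\<close>, every lattice of each class is fixed and not
  merely the class. \<open>unstable_iff\<close> relates this to the setwise stabilizers in
  \<open>unstable\<close>.\<close>

definition fixing :: "'w set set set \<Rightarrow> ('w \<Rightarrow> 'w) set" where
  "fixing s = {g \<in> \<Gamma>. \<forall>v\<in>s. \<forall>L\<in>v. g ` L = L}"

abbreviation "unst \<equiv> unstable scale R \<pi> \<Gamma>"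

lemma unstable_iff: "s \<in> unst \<longleftrightarrow> s \<in> bldg \<and> (\<exists>g\<in>fixing s. g \<noteq> id)"
proof
  assume "s \<in> unst"
  then obtain g where "s \<in> bldg" "g \<in> \<Gamma>" "g \<noteq> id" "vertex_action g ` s = s" by (auto simp: unstable_def)
  then have "g \<in> fixing s"
    using simplex_stabilizer_fixes[of g s] unfolding fixing_def by (simp add: \<Gamma>_iff)
  then show "s \<in> bldg \<and> (\<exists>g\<in>fixing s. g \<noteq> id)" using \<open>s \<in> bldg\<close> \<open>g \<noteq> id\<close> by blast
next
  assume "s \<in> bldg \<and> (\<exists>g\<in>fixing s. g \<noteq> id)"
  then obtain g where g: "s \<in> bldg" "g \<in> \<Gamma>" "g \<noteq> id" "\<forall>v\<in>s. \<forall>L\<in>v. g ` L = L" by (auto simp: fixing_def)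
  then have "vertex_action g v = v" if "v \<in> s" for v using that by (simp add: vertex_action_def)
  then have "vertex_action g ` s = s" by simp
  then show "s \<in> unst" using g by (auto simp: unstable_def)
qed

lemma fixing_antimono: "s \<subseteq> t \<Longrightarrow> fixing t \<subseteq> fixing s"
  unfolding fixing_def by blast

lemma face_closed_unstable: "face_closed unst"
  unfolding face_closed_def
proof (intro ballI allI impI)
  fix s t assume s: "s \<in> unst" and t: "t \<subseteq> s" "t \<noteq> {}"
  have "t \<in> bldg" using s t face_closed_building unfolding face_closed_def unstable_iff by blast
  then show "t \<in> unst" using s fixing_antimono[OF t(1)] unfolding unstable_iff by blast
qed

lemma unstable_subset: "unst \<subseteq> bldg"
  by (auto simp: unstable_def)

definition fixed_space :: "'w set set set \<Rightarrow> 'w set" where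
  "fixed_space s = {w. \<forall>g\<in>fixing s. g w = w}"

lemma fixing_linear: "g \<in> fixing s \<Longrightarrow> Vector_Spaces.linear scale scale g"
  by (simp add: fixing_def \<Gamma>_iff automorphism_def)

lemma subspace_fixed:
  assumes "\<And>g. g \<in> G \<Longrightarrow> Vector_Spaces.linear scale scale g"
  shows "subspace {w. \<forall>g\<in>G. g w = w}"
proof (rule subspaceI)
  have "g 0 = 0" if "g \<in> G" for g
  proof -
    interpret g: Vector_Spaces.linear scale scale g by (rule assms[OF that])
    show ?thesis by (rule g.zero)
  qed
  then show "0 \<in> {w. \<forall>g\<in>G. g w = w}" by blast
next
  fix c x y assume x: "x \<in> {w. \<forall>g\<in>G. g w = w}"
  have lin: "g (x + y) = g x + g y" "g (scale c x) = scale c (g x)" if "g \<in> G" for g c x y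
    using assms[OF that] by (simp_all add: Vector_Spaces.linear_iff)
  have gx: "g x = x" if "g \<in> G" for g using x that by blast
  show "scale c x \<in> {w. \<forall>g\<in>G. g w = w}"
  proof (intro CollectI ballI)
    fix g assume g: "g \<in> G"
    show "g (scale c x) = scale c x" unfolding lin(2)[OF g] gx[OF g] ..
  qed
  assume y: "y \<in> {w. \<forall>g\<in>G. g w = w}"
  show "x + y \<in> {w. \<forall>g\<in>G. g w = w}"
  proof (intro CollectI ballI)
    fix g assume g: "g \<in> G"
    then have "g y = y" using y by blast
    then show "g (x + y) = x + y" unfolding lin(1)[OF g] gx[OF g] by simp
  qed
qed

text \<open>Some multiple of a lattice in the simplex meets \<open>P\<close> non-trivially. It
  belongs to the same class, hence is preserved by the stabilizer, and \<open>fixed_vector\<close>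
  applies to it.\<close>

lemma fixed_space_nonzero:
  assumes "s \<in> bldg"
  shows "fixed_space s \<noteq> {0}"
proof -
  obtain v K where vK: "v \<in> s" "K \<in> v" using building_nonempty[OF assms] building_vertex_nonempty[OF assms] by blast
  note K = building_vertex[OF assms vK]
  obtain a x where ax: "a \<noteq> 0" "x \<noteq> 0" "x \<in> P \<inter> scale a ` K" using lattice_meets_P[OF K(1)] by blast
  have "scale a ` K \<in> v" unfolding K(2) using ax(1) by (auto simp: homothety_class_def)
  then have "g ` scale a ` K = scale a ` K" if "g \<in> fixing s" for g
    using that vK(1) unfolding fixing_def by blast
  then have "\<exists>x. x \<noteq> 0 \<and> (\<forall>g\<in>fixing s. g x = x)"
    using ax by (intro fixed_vector[OF lattice_scale[OF K(1) ax(1)]])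
      (auto simp: fixing_def \<Gamma>_iff automorphism_linear automorphism_P)
  then show ?thesis by (auto simp: fixed_space_def)
qed

lemma fixed_space_proper:
  assumes "s \<in> unst"
  shows "fixed_space s \<in> proper_subspaces scale"
proof -
  obtain g where g: "g \<in> fixing s" "g \<noteq> id" using assms by (auto simp: unstable_iff)
  have "fixed_space s \<noteq> UNIV"
  proof
    assume "fixed_space s = UNIV"
    then have "g w = w" for w using g(1) by (auto simp: fixed_space_def)
    then show False using g(2) by auto
  qed
  moreover have "subspace (fixed_space s)"
    unfolding fixed_space_def by (rule subspace_fixed) (rule fixing_linear)
  ultimately show ?thesis
    using fixed_space_nonzero assms by (auto simp: proper_subspaces_def unstable_iff)
qed

lemma Z_poset_iff:
  "(s, \<sigma>) \<in> Z_poset scale R \<pi> \<Gamma> \<longleftrightarrow>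
    s \<in> bldg \<and> \<sigma> \<in> proper_subspaces scale \<and> (\<exists>g\<in>fixing s. g \<noteq> id \<and> (\<forall>x\<in>\<sigma>. g x = x))"
  unfolding Z_poset_def fixing_subcomplex_def
  by (auto simp: unstable_iff) (auto simp: fixing_def)

lemma poset_rel_prod: "poset (rel_prod (\<subseteq>) (\<subseteq>))"
proof
  fix x y z :: "'x set \<times> 'y set"
  show "rel_prod (\<subseteq>) (\<subseteq>) x x" by (cases x) simp
  show "x = y" if "rel_prod (\<subseteq>) (\<subseteq>) x y" "rel_prod (\<subseteq>) (\<subseteq>) y x"
    using that by (cases x; cases y) auto
  show "rel_prod (\<subseteq>) (\<subseteq>) x z" if "rel_prod (\<subseteq>) (\<subseteq>) x y" "rel_prod (\<subseteq>) (\<subseteq>) y z"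
    using that by (cases x; cases y; cases z) (simp, blast)
qed

lemma fixed_space_mono: "s \<subseteq> t \<Longrightarrow> fixed_space s \<subseteq> fixed_space t"
  using fixing_antimono unfolding fixed_space_def by blast

lemma phi_map_class:
  assumes z: "z \<in> oriented_chains unst (int (dim UNIV) - 2)" "simplicial_boundary z = 0"
  shows "phi_map scale R \<pi> \<Gamma> (homology_class (chain_complex_of unst) (int (dim UNIV) - 2) z) =
    homology_class (chain_complex_of (tits_building scale)) (int (dim UNIV) - 2)
      (simplicial_chain_map fixed_space (subdivision z))"
proof -
  let ?n = "int (dim UNIV) - 2"
  let ?Z = "Z_poset scale R \<pi> \<Gamma>"
  \<comment> \<open>The second component is the subspace tau through which the homotopy passes. It
    is non-zero because it contains sigma, proper because a non-trivial g fixes it, and monotone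
    because fewer elements fix a larger pair.\<close>
  let ?F = "\<lambda>(s, \<sigma>). (s, {w. \<forall>g\<in>{g \<in> fixing s. \<forall>x\<in>\<sigma>. g x = x}. g w = w})"
  let ?s = "\<lambda>s. (s, fixed_space s)"
  let ?le = "rel_prod (\<subseteq>) (\<subseteq>) :: 'w set set set \<times> 'w set \<Rightarrow> _"
  have sd: "subdivision z \<in> oriented_chains (order_complex (\<subseteq>) unst) ?n" "simplicial_boundary (subdivision z) = 0"
    using subdivision_closed[OF face_closed_unstable z(1)] subdivision_boundary[OF z(1)] z(2)
    by (auto simp: subdivision_def)
  have s1: "?le (?s x) (?s y)" if "x \<subseteq> y" for x y
    using that fixed_space_mono by simp
  have s2: "?s ` unst \<subseteq> ?Z"
  proof (rule image_subsetI)
    fix x assume x: "x \<in> unst"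
    then obtain g where "g \<in> fixing x" "g \<noteq> id" "x \<in> bldg" by (auto simp: unstable_iff)
    then show "?s x \<in> ?Z" using fixed_space_proper[OF x] by (auto simp: Z_poset_iff fixed_space_def)
  qed
  have F1: "?le (?F x) (?F y)" if "?le x y" for x y
    using that fixing_antimono[of "fst x" "fst y"] by (cases x, cases y) (simp, blast)
  have F2: "?F ` ?Z \<subseteq> ?Z"
  proof (rule image_subsetI)
    fix x assume "x \<in> ?Z"
    moreover obtain s \<sigma> where x: "x = (s, \<sigma>)" by (cases x)
    ultimately have "s \<in> bldg" "\<sigma> \<in> proper_subspaces scale" and g: "\<exists>g\<in>fixing s. g \<noteq> id \<and> (\<forall>x\<in>\<sigma>. g x = x)"
      by (auto simp: Z_poset_iff)
    then obtain g where g: "g \<in> fixing s" "g \<noteq> id" "\<forall>x\<in>\<sigma>. g x = x" by blast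
    let ?W = "{w. \<forall>g\<in>{g \<in> fixing s. \<forall>x\<in>\<sigma>. g x = x}. g w = w}"
    have "subspace ?W" by (rule subspace_fixed) (auto intro: fixing_linear)
    moreover have "\<sigma> \<subseteq> ?W" by auto
    moreover have "\<sigma> \<noteq> {0}" "0 \<in> \<sigma>"
      using \<open>\<sigma> \<in> proper_subspaces scale\<close> subspace_0 by (auto simp: proper_subspaces_def)
    moreover have "?W \<noteq> UNIV"
    proof
      assume "?W = UNIV"
      then have "g w = w" for w using g by blast
      then show False using g(2) by auto
    qed
    ultimately have "?W \<in> proper_subspaces scale" by (auto simp: proper_subspaces_def)
    then show "?F x \<in> ?Z" using g \<open>s \<in> bldg\<close> unfolding x by (auto simp: Z_poset_iff)
  qed
  have "phi_map scale R \<pi> \<Gamma> (homology_class (chain_complex_of unst) ?n z) =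
    homology_map (chain_complex_of (order_complex ?le ?Z)) (chain_complex_of (tits_building scale)) ?n
      (simplicial_chain_map snd)
      (inv_into (carrier (homology_group (chain_complex_of (order_complex ?le ?Z)) ?n))
        (homology_map (chain_complex_of (order_complex ?le ?Z)) (chain_complex_of (order_complex (\<subseteq>) unst)) ?n
          (simplicial_chain_map fst))
        (homology_class (chain_complex_of (order_complex (\<subseteq>) unst)) ?n (subdivision z)))"
    unfolding phi_map_def Let_def o_def subdivision_homology_class[OF face_closed_unstable z(1)] ..
  also have "inv_into (carrier (homology_group (chain_complex_of (order_complex ?le ?Z)) ?n))
        (homology_map (chain_complex_of (order_complex ?le ?Z)) (chain_complex_of (order_complex (\<subseteq>) unst)) ?n
          (simplicial_chain_map fst))
        (homology_class (chain_complex_of (order_complex (\<subseteq>) unst)) ?n (subdivision z)) =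
      homology_class (chain_complex_of (order_complex ?le ?Z)) ?n (simplicial_chain_map ?s (subdivision z))"
  proof (rule poset_section_inverse[OF poset_rel_prod poset_subset, where F = ?F])
    show "fst ` ?Z \<subseteq> unst" by (auto simp: Z_poset_def)
    show "fst x \<subseteq> fst y" if "?le x y" for x y :: "'w set set set \<times> 'w set" using that by (cases x, cases y) auto
    show "?le x (?F x)" "?le (?s (fst x)) (?F x)" for x by (auto simp: fixed_space_def split: prod.split)
  qed (use s1 s2 F1 F2 sd in auto)
  also have "homology_map (chain_complex_of (order_complex ?le ?Z)) (chain_complex_of (tits_building scale)) ?n
      (simplicial_chain_map snd) \<dots> =
    homology_class (chain_complex_of (tits_building scale)) ?n
      (simplicial_chain_map snd (simplicial_chain_map ?s (subdivision z)))"
    unfolding tits_building_def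
  proof (rule poset_homology_class(1)[OF poset_rel_prod poset_subset])
    show "snd x \<subseteq> snd y" if "?le x y" for x y :: "'w set set set \<times> 'w set" using that by (cases x, cases y) auto
    show "snd ` ?Z \<subseteq> proper_subspaces scale" by (auto simp: Z_poset_def)
    show "simplicial_chain_map ?s (subdivision z) \<in> oriented_chains (order_complex ?le ?Z) ?n"
      by (rule poset_homology_class(2)[OF poset_subset poset_rel_prod _ s2 sd(1)]) (rule s1)
  qed
  also have "simplicial_chain_map snd (simplicial_chain_map ?s (subdivision z)) =
      simplicial_chain_map fixed_space (subdivision z)"
    unfolding simplicial_chain_map_comp[OF sd(1)] by (simp add: o_def)
  finally show ?thesis .
qed

text \<open>Conjugation by \<open>g\<close> carries an element stabilizing \<open>s\<close> to one
  stabilizing its image, and stays in the normal subgroup.\<close>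

lemma automorphism_unstable:
  assumes g: "automorphism g" and s: "s \<in> unst"
  shows "vertex_action g ` s \<in> unst"
proof -
  obtain h where h: "s \<in> bldg" "h \<in> \<Gamma>" "h \<noteq> id" "vertex_action h ` s = s"
    using s by (auto simp: unstable_def)
  interpret G: group "aut_group scale P" by (rule group_aut_group)
  define h' where "h' = g \<circ> h \<circ> inv_into UNIV g"
  have ig: "inv_into UNIV g \<circ> g = id" using automorphism_bij[OF g] by (simp add: bij_is_inj)
  have h'g: "h' \<circ> g = g \<circ> h" by (simp add: h'_def comp_assoc ig)
  have "g \<otimes>\<^bsub>aut_group scale P\<^esub> h \<otimes>\<^bsub>aut_group scale P\<^esub> inv\<^bsub>aut_group scale P\<^esub> g \<in> \<Gamma>"
    using \<Gamma>_normal g h(2) unfolding G.normal_inv_iff by (simp add: carrier_aut_group)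
  then have "h' \<in> \<Gamma>" unfolding inv_aut_group[OF g] h'_def by (simp add: aut_group_def)
  moreover have "h' \<noteq> id"
  proof
    assume "h' = id"
    then have "inv_into UNIV g \<circ> (g \<circ> h) = inv_into UNIV g \<circ> g" using h'g by simp
    then have "h = id" by (simp add: ig flip: comp_assoc)
    then show False using h(3) by simp
  qed
  moreover have "vertex_action h' ` vertex_action g ` s = vertex_action g ` s"
  proof -
    have va: "vertex_action (a \<circ> b) v = vertex_action a (vertex_action b v)" for a b and v :: "'w set set"
      by (simp add: vertex_action_def image_image image_comp)
    have "vertex_action h' ` vertex_action g ` s = vertex_action (g \<circ> h) ` s"
      by (simp add: image_image va flip: h'g)
    also have "\<dots> = vertex_action g ` vertex_action h ` s" by (simp add: image_image va)
    finally show ?thesis by (simp add: h(4))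
  qed
  ultimately show ?thesis using automorphism_building[OF g h(1)] by (auto simp: unstable_def)
qed

end


section \<open>Change of level\<close>

text \<open>Both levels share \<open>P\<close>, the basis and the dual basis. Unprefixed notions
  belong to \<open>I\<close>, those prefixed by \<open>small\<close> to \<open>J\<close>.\<close>

locale level_pair = arithmetic_module k R A \<pi> I scale Bs P f e + small: arithmetic_module k R A \<pi> J scale Bs P f e
  for k R A :: "'k::field set" and \<pi> :: 'k and I J :: "'k set"
    and scale :: "'k \<Rightarrow> 'w::ab_group_add \<Rightarrow> 'w" and Bs :: "'w set" and P :: "'w set"
    and f :: "'w \<Rightarrow> 'w \<Rightarrow> 'k" and e :: "'w \<Rightarrow> 'w" +
  assumes ideals: "J \<subseteq> I"
begin

lemma \<Gamma>_mono: "small.\<Gamma> \<subseteq> \<Gamma>"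
proof -
  interpret W: comm_group "add_monoid (module_of scale (UNIV :: 'w set))" by (rule add_monoid_group)
  have "small.IP \<subseteq> IP"
    unfolding ideal_times_def using ideals by (intro W.mono_generate) blast
  then show ?thesis by (auto simp: congruence_subgroup_def)
qed

lemma small_\<Gamma>_normal: "small.\<Gamma> \<lhd> (aut_group scale P)\<lparr>carrier := \<Gamma>\<rparr>"
proof -
  interpret G: group "aut_group scale P" by (rule group_aut_group)
  show ?thesis
    using G.normal_restrict_supergroup[OF normal_imp_subgroup[OF \<Gamma>_normal] small.\<Gamma>_normal \<Gamma>_mono] .
qed

lemma unstable_mono: "small.unst \<subseteq> unst"
  using \<Gamma>_mono by (auto simp: unstable_def)

lemma fixed_space_antitone: "fixed_space s \<subseteq> small.fixed_space s"
  using \<Gamma>_mono unfolding fixed_space_def small.fixed_space_def fixing_def small.fixing_def by blast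

sublocale C: nested_subcomplexes "chain_complex_of bldg" "chain_complex_of unst" "chain_complex_of small.unst"
proof (intro nested_subcomplexes.intro nested_subcomplexes_axioms.intro)
  show "chain_subcomplex (chain_complex_of bldg) (chain_complex_of unst)"
    by (rule chain_subcomplex_chain_complex_of[OF face_closed_building face_closed_unstable unstable_subset])
  show "chain_subcomplex (chain_complex_of bldg) (chain_complex_of small.unst)"
    by (rule chain_subcomplex_chain_complex_of[OF face_closed_building small.face_closed_unstable small.unstable_subset])
  show "carrier (grp (chain_complex_of small.unst) n) \<subseteq> carrier (grp (chain_complex_of unst) n)" for n
    using oriented_chains_mono[OF unstable_mono] by simp
qed

abbreviation "top_deg \<equiv> int (dim (UNIV :: 'w set)) - 1"

lemma level_SteinbergE:
  assumes "\<alpha> \<in> carrier (level_Steinberg scale R \<pi> small.\<Gamma>)"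
  obtains x where "x \<in> oriented_chains bldg top_deg" "simplicial_boundary x \<in> oriented_chains small.unst (top_deg - 1)"
    "\<alpha> = homology_class (stable_chains scale R \<pi> small.\<Gamma>) top_deg (C.small.proj top_deg x)"
  using assms unfolding level_Steinberg_def stable_chains_def C.small.carrier_homology_quot by auto

lemma level_change_class:
  assumes "x \<in> oriented_chains bldg top_deg"
  shows "level_change scale R \<pi> small.\<Gamma> \<Gamma> (homology_class (stable_chains scale R \<pi> small.\<Gamma>) top_deg (C.small.proj top_deg x)) =
    homology_class (stable_chains scale R \<pi> \<Gamma>) top_deg (C.proj top_deg x)"
  unfolding level_change_def stable_chains_def stable_projection_def Let_def
  using C.change_homology_class[of x top_deg] assms by simp

lemma level_change_hom:
  "level_change scale R \<pi> small.\<Gamma> \<Gamma> \<in> hom (level_Steinberg scale R \<pi> small.\<Gamma>) (level_Steinberg scale R \<pi> \<Gamma>)"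
  unfolding level_change_def stable_chains_def stable_projection_def Let_def level_Steinberg_def
  by (rule C.change_homology_hom)

lemma action_hom:
  assumes g: "automorphism g"
  defines "F \<equiv> simplicial_chain_map (vertex_action g)"
  shows "F \<in> hom (grp (chain_complex_of bldg) n) (grp (chain_complex_of bldg) n)"
    and "F ` carrier (grp (chain_complex_of unst) n) \<subseteq> carrier (grp (chain_complex_of unst) n)"
    and "F ` carrier (grp (chain_complex_of small.unst) n) \<subseteq> carrier (grp (chain_complex_of small.unst) n)"
    and "x \<in> carrier (grp (chain_complex_of bldg) n) \<Longrightarrow>
      F (bd (chain_complex_of bldg) n x) = bd (chain_complex_of bldg) n (F x)"
  using simplicial_chain_map_closed[of bldg "vertex_action g" bldg, OF automorphism_building[OF g]]
    simplicial_chain_map_closed[of unst "vertex_action g" unst, OF automorphism_unstable[OF g]]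
    simplicial_chain_map_closed[of small.unst "vertex_action g" small.unst, OF small.automorphism_unstable[OF g]]
    simplicial_boundary_chain_map[of x bldg n "vertex_action g"]
  by (auto simp: F_def hom_def simplicial_chain_map_add)

lemma level_change_equivariant:
  assumes g: "automorphism g" and \<alpha>: "\<alpha> \<in> carrier (level_Steinberg scale R \<pi> small.\<Gamma>)"
  shows "level_change scale R \<pi> small.\<Gamma> \<Gamma> (level_Steinberg_action scale R \<pi> small.\<Gamma> g \<alpha>) =
    level_Steinberg_action scale R \<pi> \<Gamma> g (level_change scale R \<pi> small.\<Gamma> \<Gamma> \<alpha>)"
proof -
  let ?F = "simplicial_chain_map (vertex_action g)"
  obtain x where x: "x \<in> oriented_chains bldg top_deg" "simplicial_boundary x \<in> oriented_chains small.unst (top_deg - 1)"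
    "\<alpha> = homology_class (stable_chains scale R \<pi> small.\<Gamma>) top_deg (C.small.proj top_deg x)"
    using \<alpha> by (rule level_SteinbergE)
  have x': "simplicial_boundary x \<in> oriented_chains unst (top_deg - 1)"
    using x(2) oriented_chains_mono[OF unstable_mono] by blast
  note F = action_hom[OF g]
  have "level_Steinberg_action scale R \<pi> small.\<Gamma> g \<alpha> =
      homology_class (stable_chains scale R \<pi> small.\<Gamma>) top_deg (C.small.proj top_deg (?F x))"
    unfolding level_Steinberg_action_def Let_def x(3) stable_chains_def
    by (rule C.small.quot_map_chain_map(1)[OF F(1,3,4)]) (use x in simp_all)
  moreover have "level_Steinberg_action scale R \<pi> \<Gamma> g (homology_class (stable_chains scale R \<pi> \<Gamma>) top_deg (C.proj top_deg x)) =
      homology_class (stable_chains scale R \<pi> \<Gamma>) top_deg (C.proj top_deg (?F x))"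
    unfolding level_Steinberg_action_def Let_def stable_chains_def
    by (rule C.quot_map_chain_map(1)[OF F(1,2,4)]) (use x(1) x' in simp_all)
  moreover have "?F x \<in> oriented_chains bldg top_deg"
    by (rule simplicial_chain_map_closed[OF automorphism_building[OF g] x(1)])
  ultimately show ?thesis using level_change_class[OF x(1)] level_change_class[of "?F x"] x(3) by simp
qed

text \<open>On the simplices that are unstable at level \<open>J\<close> both fixed-space maps are
  defined and comparable. The prism between them bounds the difference of the two images of the
  subdivided cycle.\<close>

lemma GQ_level_change:
  assumes \<alpha>: "\<alpha> \<in> carrier (level_Steinberg scale R \<pi> small.\<Gamma>)"
  shows "GQ scale R \<pi> \<Gamma> (level_change scale R \<pi> small.\<Gamma> \<Gamma> \<alpha>) = GQ scale R \<pi> small.\<Gamma> \<alpha>"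
proof -
  let ?n = "int (dim UNIV) - 2"
  obtain x where x: "x \<in> oriented_chains bldg top_deg" "simplicial_boundary x \<in> oriented_chains small.unst (top_deg - 1)"
    "\<alpha> = homology_class (stable_chains scale R \<pi> small.\<Gamma>) top_deg (C.small.proj top_deg x)"
    using \<alpha> by (rule level_SteinbergE)
  define z where "z = simplicial_boundary x"
  have top_deg: "top_deg - 1 = ?n" by simp
  have z: "z \<in> oriented_chains small.unst ?n" "simplicial_boundary z = 0"
    using x(2) simplicial_boundary_boundary[OF x(1)] by (simp_all add: z_def)
  then have z': "z \<in> oriented_chains unst ?n"
    using oriented_chains_mono[OF unstable_mono] by blast
  have "delta_map scale R \<pi> small.\<Gamma> \<alpha> = homology_class (chain_complex_of small.unst) ?n z"
    unfolding delta_map_def x(3) stable_chains_def z_def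
    using C.small.connecting_map_class[of x top_deg] x(1,2) by simp
  moreover have "delta_map scale R \<pi> \<Gamma> (level_change scale R \<pi> small.\<Gamma> \<Gamma> \<alpha>) = homology_class (chain_complex_of unst) ?n z"
    unfolding x(3) level_change_class[OF x(1)] unfolding delta_map_def stable_chains_def z_def
    using C.connecting_map_class[of x top_deg] x(1) z' by (simp add: z_def)
  moreover have "homology_class (chain_complex_of (tits_building scale)) ?n
      (simplicial_chain_map small.fixed_space (subdivision z)) =
    homology_class (chain_complex_of (tits_building scale)) ?n (simplicial_chain_map fixed_space (subdivision z))"
    unfolding tits_building_def
  proof (rule poset_homotopy_class[OF poset_subset poset_subset])
    show "subdivision z \<in> oriented_chains (order_complex (\<subseteq>) small.unst) ?n"
      by (rule subdivision_closed[OF small.face_closed_unstable z(1)])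
    show "simplicial_boundary (subdivision z) = 0"
      using subdivision_boundary[OF z(1)] z(2) by (simp add: subdivision_def)
    show "fixed_space s \<subseteq> fixed_space t \<and> small.fixed_space s \<subseteq> small.fixed_space t" if "s \<subseteq> t" for s t
      using fixed_space_mono[OF that] small.fixed_space_mono[OF that] ..
    show "fixed_space s \<subseteq> small.fixed_space s" for s by (rule fixed_space_antitone)
    show "fixed_space ` small.unst \<subseteq> proper_subspaces scale"
      by (rule image_subsetI) (rule fixed_space_proper[OF subsetD[OF unstable_mono]])
    show "small.fixed_space ` small.unst \<subseteq> proper_subspaces scale"
      by (rule image_subsetI) (rule small.fixed_space_proper)
  qed
  ultimately show ?thesis
    unfolding GQ_def o_def by (simp only: phi_map_class[OF z' z(2)] small.phi_map_class[OF z])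
qed

end

text \<open>The basis and the dual basis are chosen before the ideal, so that one choice serves both
  levels.\<close>

lemma arithmetic_module_exists:
  assumes C: "curve k R A \<pi>" and vs: "vector_space (scale :: 'k::field \<Rightarrow> 'w::ab_group_add \<Rightarrow> 'w)"
    and dim: "vector_space.dim scale (UNIV :: 'w set) = r" "r \<ge> 2"
    and P: "submodule P (subring_as_ring A) (module_of scale UNIV)"
      "projective_module (subring_as_ring A) (module_of scale P)"
      "vector_space.dim scale P = r" "module.span scale P = UNIV"
  obtains Bs f e where "\<And>I. ideal I (subring_as_ring A) \<Longrightarrow> I \<noteq> {0} \<Longrightarrow> I \<noteq> A \<Longrightarrow>
    arithmetic_module k R A \<pi> I scale Bs P f e"
proof -
  interpret curve k R A \<pi> by (rule C)
  interpret vector_space scale by (rule vs)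
  obtain Bs where Bs: "Bs \<subseteq> P" "independent Bs" "P \<subseteq> span Bs" "card Bs = dim P"
    by (rule basis_exists)
  \<comment> \<open>An infinite set has cardinality 0, so this bound yields finiteness as well as
    non-emptiness.\<close>
  have "card Bs \<ge> 2" using Bs(4) P(3) dim by simp
  then have Bs': "finite Bs" "Bs \<noteq> {}" by (auto intro: card_ge_0_finite)
  have "span P \<subseteq> span Bs" using Bs(3) by (rule span_minimal) (rule subspace_span)
  then have spanB: "span Bs = UNIV" using P(4) by auto
  note Pm = submodule_module_ofD[OF P(1)]
  show ?thesis
  proof (rule projective_module_dual_basis[OF A_subring Pm(1) P(2)])
    fix f :: "'w \<Rightarrow> 'w \<Rightarrow> 'k" and e :: "'w \<Rightarrow> 'w"
    assume f:
    "\<And>x y. x \<in> P \<Longrightarrow> f y x \<in> A" "\<And>x x' y. x \<in> P \<Longrightarrow> x' \<in> P \<Longrightarrow> f y (x + x') = f y x + f y x'"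
    "\<And>a x y. a \<in> A \<Longrightarrow> x \<in> P \<Longrightarrow> f y (scale a x) = a * f y x" "\<And>x. x \<in> P \<Longrightarrow> finite {y. f y x \<noteq> 0}"
    "\<And>y x. x \<in> P \<Longrightarrow> f y x \<noteq> 0 \<Longrightarrow> e y \<in> P"
    "\<And>x. x \<in> P \<Longrightarrow> x = (\<Sum>y | f y x \<noteq> 0. scale (f y x) (e y))"
    have "arithmetic_module k R A \<pi> I scale Bs P f e"
    if I: "ideal I (subring_as_ring A)" "I \<noteq> {0}" "I \<noteq> A" for I
    by (intro arithmetic_module.intro curve_ideal.intro curve_ideal_axioms.intro
        finite_dimensional_vector_space.intro finite_dimensional_vector_space_axioms.intro
        arithmetic_module_axioms.intro C vs I Bs(1,2) Bs' spanB Pm f)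
    then show ?thesis by (rule that)
  qed
qed


theorem mainTheorem2:
  fixes k R A I J :: "'k::field set"
    and \<pi> :: 'k
    and scale :: "'k \<Rightarrow> 'w::ab_group_add \<Rightarrow> 'w"
    and P :: "'w set"
    and r :: nat
    and \<Gamma> \<Gamma>' :: "('w \<Rightarrow> 'w) set"
  assumes curve: "function_field_of_curve k"
    and infinity: "R \<in> closed_points k"
    and A: "A = regular_functions_away k R"
    and \<pi>: "uniformizer R \<pi>"
    and W: "vector_space scale" "vector_space.dim scale (UNIV :: 'w set) = r" "r \<ge> 2"
    and P: "submodule P (subring_as_ring A) (module_of scale UNIV)"
      "projective_module (subring_as_ring A) (module_of scale P)"
      "vector_space.dim scale P = r" "module.span scale P = UNIV"
    and I: "ideal I (subring_as_ring A)" "I \<noteq> {0}" "I \<noteq> A"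
    and J: "ideal J (subring_as_ring A)" "J \<noteq> {0}" "J \<noteq> A"
    and JI: "J \<subseteq> I"
    and \<Gamma>: "\<Gamma> = congruence_subgroup scale P I"
    and \<Gamma>': "\<Gamma>' = congruence_subgroup scale P J"
  shows "\<Gamma>' \<lhd> (aut_group scale P)\<lparr>carrier := \<Gamma>\<rparr> \<and> \<Gamma> \<lhd> aut_group scale P \<and>
    unstable scale R \<pi> \<Gamma>' \<subseteq> unstable scale R \<pi> \<Gamma> \<and>
    (\<forall>n. stable_projection scale R \<pi> \<Gamma> n
        \<in> epi (grp (stable_chains scale R \<pi> \<Gamma>') n) (grp (stable_chains scale R \<pi> \<Gamma>) n)) \<and>
    (\<forall>n. \<forall>c \<in> carrier (grp (stable_chains scale R \<pi> \<Gamma>') n).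
        stable_projection scale R \<pi> \<Gamma> (n - 1) (bd (stable_chains scale R \<pi> \<Gamma>') n c)
          = bd (stable_chains scale R \<pi> \<Gamma>) n (stable_projection scale R \<pi> \<Gamma> n c)) \<and>
    level_change scale R \<pi> \<Gamma>' \<Gamma>
      \<in> hom (level_Steinberg scale R \<pi> \<Gamma>') (level_Steinberg scale R \<pi> \<Gamma>) \<and>
    (\<forall>g \<in> carrier (aut_group scale P). \<forall>\<alpha> \<in> carrier (level_Steinberg scale R \<pi> \<Gamma>').
        level_change scale R \<pi> \<Gamma>' \<Gamma> (level_Steinberg_action scale R \<pi> \<Gamma>' g \<alpha>)
          = level_Steinberg_action scale R \<pi> \<Gamma> g (level_change scale R \<pi> \<Gamma>' \<Gamma> \<alpha>)) \<and>
    (\<forall>\<alpha> \<in> carrier (level_Steinberg scale R \<pi> \<Gamma>').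
        GQ scale R \<pi> \<Gamma> (level_change scale R \<pi> \<Gamma>' \<Gamma> \<alpha>) = GQ scale R \<pi> \<Gamma>' \<alpha>)"
proof -
  have C: "curve k R A \<pi>" by (rule curve.intro[OF curve infinity A \<pi>])
  obtain Bs f e where AM: "\<And>I. ideal I (subring_as_ring A) \<Longrightarrow> I \<noteq> {0} \<Longrightarrow> I \<noteq> A \<Longrightarrow>
    arithmetic_module k R A \<pi> I scale Bs P f e"
    using arithmetic_module_exists[OF C W P] by blast
  interpret level_pair k R A \<pi> I J scale Bs P f e
    using AM[OF I] AM[OF J] JI by (intro level_pair.intro level_pair_axioms.intro)
  let ?G = "congruence_subgroup scale P I" and ?G' = "congruence_subgroup scale P J"
  show ?thesis
    unfolding \<Gamma> \<Gamma>'
  proof (intro conjI allI ballI)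
    show "?G' \<lhd> (aut_group scale P)\<lparr>carrier := ?G\<rparr>" by (rule small_\<Gamma>_normal)
    show "?G \<lhd> aut_group scale P" by (rule \<Gamma>_normal)
    show "small.unst \<subseteq> unst" by (rule unstable_mono)
    show "stable_projection scale R \<pi> ?G n
        \<in> epi (grp (stable_chains scale R \<pi> ?G') n) (grp (stable_chains scale R \<pi> ?G) n)" for n
      unfolding stable_projection_def stable_chains_def by (rule C.change_epi)
    show "stable_projection scale R \<pi> ?G (n - 1) (bd (stable_chains scale R \<pi> ?G') n c)
        = bd (stable_chains scale R \<pi> ?G) n (stable_projection scale R \<pi> ?G n c)"
      if "c \<in> carrier (grp (stable_chains scale R \<pi> ?G') n)" for n c
      using that unfolding stable_projection_def stable_chains_def by (rule C.change_bd)
    show "level_change scale R \<pi> ?G' ?G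
        \<in> hom (level_Steinberg scale R \<pi> ?G') (level_Steinberg scale R \<pi> ?G)"
      by (rule level_change_hom)
    show "level_change scale R \<pi> ?G' ?G (level_Steinberg_action scale R \<pi> ?G' g \<alpha>)
        = level_Steinberg_action scale R \<pi> ?G g (level_change scale R \<pi> ?G' ?G \<alpha>)"
      if "g \<in> carrier (aut_group scale P)" "\<alpha> \<in> carrier (level_Steinberg scale R \<pi> ?G')" for g \<alpha>
      using that by (intro level_change_equivariant) (simp_all add: carrier_aut_group)
    show "GQ scale R \<pi> ?G (level_change scale R \<pi> ?G' ?G \<alpha>) = GQ scale R \<pi> ?G' \<alpha>"
      if "\<alpha> \<in> carrier (level_Steinberg scale R \<pi> ?G')" for \<alpha>
      using that by (rule GQ_level_change)
  qed
qed

end
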